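(* (1) The family $\mathcal{C}^{\mathbf{\Pi}^0_2}$ has exactly 52 elements and is both a $\sqsubseteq_c$-antichain basis and a $\leq_c$-antichain basis for the class of non-$\mathbf{\Pi}^0_2$ s-acyclic locally countable Borel relations on an analytic space. (2) $\{(\mathbb{D},\mathbb{G}^{\mathbf{\Pi}^0_2}_m),(\mathbb{S},\mathbb{G}^{\mathbf{\Pi}^0_2,a}_m)\}$ is both a $\sqsubseteq_c$-antichain basis and a $\leq_c$-antichain basis for the class of non-$\mathbf{\Pi}^0_2$ acyclic locally countable Borel graphs on an analytic space.
   Context: A relation on $X$ is a subset of $X^2$. For topological spaces $X,Y$ and $A\subseteq X^2$, $B\subseteq Y^2$: $(X,A)\leq_c(Y,B)$ means there is a continuous $f:X\to Y$ with $A=(f\times f)^{-1}(B)$; $(X,A)\sqsubseteq_c(Y,B)$ means such an $f$ can be chosen injective. An analytic space is a separable metrizable space homeomorphic to an analytic subset of a Polish space. A relation is locally countable if all its horizontal and vertical sections are countable. A graph is a symmetric relation disjoint from the diagonal. A relation $R$ on $X$ is non-$\mathbf{\Pi}^0_2$ if it is not a $\mathbf{\Pi}^0_2$ subset of $X^2$. For a relation $A$ on $X$, $s(A)=A\cup A^{-1}$ is its symmetrization. An $A$-path is a finite sequence $(x_i)_{i\leq n}$ of points of $X$ with $(x_i,x_{i+1})\in A$ for $i<n$. $A$ is acyclic if there is no injective $A$-path $(x_i)_{i\leq n}$ with $n\geq 2$ and $(x_n,x_0)\in A$; $A$ is s-acyclic if $s(A)$ is acyclic. For a class $\mathcal Q$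 of pairs $(X,R)$ and a quasi-order $\leq$, an antichain is a subclass of pairwise $\leq$-incomparable elements; a basis for $\mathcal Q$ is a subclass $B$ of $\mathcal Q$ such that every element of $\mathcal Q$ is $\leq$-above an element of $B$; an antichain basis is a basis which is an antichain. Let $2=\{0,1\}$, $4=\{0,1,2,3\}$, $\mathbb{D}=2\times 2^\omega$, $N_1=\{\alpha\in 2^\omega\mid\alpha(0)=1\}$, $\mathbb{S}=\{0^\infty\}\cup N_1\subseteq 2^\omega$, $\mathbb{C}=\mathbb{P}_f:=\{\alpha\in 2^\omega\mid\alpha(n)=0\text{ for all but finitely many }n\}$, $S_0=\mathbb{C}$, $S_1=\emptyset$, $S_2=2^\omega\setminus\mathbb{C}$, $S_3=2^\omega$, $\Delta(E)=\{(x,x)\mid x\in E\}$. Let $P$ be the set of functions $t:2\times 2\to 4$ such that $t(0,0)\neq 0$, $t(1,1)\neq 0$, $t(0,1)=0$, and ($t(1,0)=0\Rightarrow t(0,0)\leq t(1,1)$). For $t\in P$, $\mathbb{R}^{\mathbf{\Pi}^0_2}_t=\{((\varepsilon,x),(\eta,x))\in\mathbb{D}^2\mid x\in S_{t(\varepsilon,\eta)}\}$. Put $\mathcal{A}^{\mathbf{\Pi}^0_2}=\{(2^\omega,\Delta(\mathbb{C}))\}\cup\{(\mathbb{D},\mathbb{R}^{\mathbf{\Pi}^0_2}_t)\mid t\in P\}$. For $t:2\times 2\to 4$, let $\mathbb{R}^{\mathbf{\Pi}^0_2,a}_t$ be the relation on $\mathbb{S}$ equal to $\{(0^\infty,0^\infty)\mid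 t(0,0)=1\}\cup\{(0^\infty,1\alpha)\mid\alpha\in S_{t(0,1)}\}\cup\{(1\alpha,0^\infty)\mid\alpha\in S_{t(1,0)}\}\cup\{(1\alpha,1\alpha)\mid\alpha\in S_{t(1,1)}\}$. Then $\mathcal{C}^{\mathbf{\Pi}^0_2}=\mathcal{A}^{\mathbf{\Pi}^0_2}\cup\{(\mathbb{S},\mathbb{R}^{\mathbf{\Pi}^0_2,a}_t)\mid t:2\times 2\to 4,\ t(0,0),t(0,1),t(1,0)\in\{0,1\},\ (t(0,1)=0\text{ or }t(1,0)=0),\ t(1,1)\neq 0\}$. Finally $\mathbb{G}^{\mathbf{\Pi}^0_2}_m=\{((\varepsilon,x),(1-\varepsilon,x))\mid\varepsilon\in 2,\ x\in\mathbb{C}\}$ and $\mathbb{G}^{\mathbf{\Pi}^0_2,a}_m=s(\{(0^\infty,1\alpha)\mid\alpha\in\mathbb{C}\})$. *)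

theory Defs
  imports "HOL-Analysis.Analysis"
begin

section \<open>Analytic spaces\<close>

definition Polish_topology :: "'a topology \<Rightarrow> bool" where
  "Polish_topology P \<longleftrightarrow> completely_metrizable_space P \<and> separable_space P"

text \<open>A subset of a Polish space is analytic if it is a continuous image of a Polish space.
  Polish spaces have at most continuum many points, so every Polish space has a homeomorphic copy
  whose underlying set is a subset of the type \<^typ>\<open>nat \<Rightarrow> real\<close>. Hence nothing is lost by
  letting the existential quantifiers over Polish spaces here and in the definition of
  analytic spaces range over arbitrary Polish topologies on subsets of that type.\<close>

definition analytic_in :: "'a topology \<Rightarrow> 'a set \<Rightarrow> bool" where
  "analytic_in P A \<longleftrightarrow> A \<subseteq> topspace P \<and>
     (\<exists>(Y :: (nat \<Rightarrow> real) topology) g.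
        Polish_topology Y \<and> continuous_map Y P g \<and> g ` topspace Y = A)"

definition analytic_space :: "'a topology \<Rightarrow> bool" where
  "analytic_space X \<longleftrightarrow> separable_space X \<and> metrizable_space X \<and>
     (\<exists>(P :: (nat \<Rightarrow> real) topology) A.
        Polish_topology P \<and> analytic_in P A \<and> X homeomorphic_space subtopology P A)"

definition Borel_in :: "'a topology \<Rightarrow> 'a set \<Rightarrow> bool" where
  "Borel_in X B \<longleftrightarrow> B \<in> sigma_sets (topspace X) {U. openin X U}"


section \<open>Relations on topological spaces\<close>

type_synonym 'a relspace = "'a topology \<times> ('a \<times> 'a) set"

definition c_reduction :: "'a relspace \<Rightarrow> 'b relspace \<Rightarrow> ('a \<Rightarrow> 'b) \<Rightarrow> bool" where
  "c_reduction = (\<lambda>(X, A) (Y, B) f. continuous_map X Y f \<and>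
     A = {(x, y) \<in> topspace X \<times> topspace X. (f x, f y) \<in> B})"

definition c_le :: "'a relspace \<Rightarrow> 'b relspace \<Rightarrow> bool" (infix \<open>\<le>\<^sub>c\<close> 50) where
  "S \<le>\<^sub>c T \<longleftrightarrow> (\<exists>f. c_reduction S T f)"

definition c_emb :: "'a relspace \<Rightarrow> 'b relspace \<Rightarrow> bool" (infix \<open>\<sqsubseteq>\<^sub>c\<close> 50) where
  "S \<sqsubseteq>\<^sub>c T \<longleftrightarrow> (\<exists>f. c_reduction S T f \<and> inj_on f (topspace (fst S)))"

definition locally_countable :: "('a \<times> 'a) set \<Rightarrow> bool" where
  "locally_countable R \<longleftrightarrow>
     (\<forall>x. countable {y. (x, y) \<in> R}) \<and> (\<forall>y. countable {x. (x, y) \<in> R})"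

definition symmetrization :: "('a \<times> 'a) set \<Rightarrow> ('a \<times> 'a) set" where
  "symmetrization R = R \<union> R\<inverse>"

text \<open>This differs from the library's \<^const>\<open>acyclic\<close>: loops and cycles of length two
  are allowed.\<close>

definition path_acyclic :: "('a \<times> 'a) set \<Rightarrow> bool" where
  "path_acyclic R \<longleftrightarrow>
     \<not> (\<exists>(n :: nat) x. n \<ge> 2 \<and> inj_on x {..n} \<and> (\<forall>i<n. (x i, x (Suc i)) \<in> R) \<and> (x n, x 0) \<in> R)"

definition s_acyclic :: "('a \<times> 'a) set \<Rightarrow> bool" where
  "s_acyclic R \<longleftrightarrow> path_acyclic (symmetrization R)"

definition graph_rel :: "('a \<times> 'a) set \<Rightarrow> bool" where
  "graph_rel R \<longleftrightarrow> sym R \<and> irrefl R"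

text \<open>Locally countable Borel relations on an analytic space that are not $\Pi^0_2$,
  that is, not $G_\delta$ in the square.\<close>

definition nonPi2_lcB :: "'a relspace \<Rightarrow> bool" where
  "nonPi2_lcB = (\<lambda>(X, R). analytic_space X \<and> R \<subseteq> topspace X \<times> topspace X \<and>
     Borel_in (prod_topology X X) R \<and> locally_countable R \<and> \<not> gdelta_in (prod_topology X X) R)"

definition nonPi2_s_acyclic_relation :: "'a relspace \<Rightarrow> bool" where
  "nonPi2_s_acyclic_relation S \<longleftrightarrow> nonPi2_lcB S \<and> s_acyclic (snd S)"

definition nonPi2_acyclic_graph :: "'a relspace \<Rightarrow> bool" where
  "nonPi2_acyclic_graph S \<longleftrightarrow> nonPi2_lcB S \<and> graph_rel (snd S) \<and> path_acyclic (snd S)"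


section \<open>Antichain bases\<close>

definition is_antichain :: "('b \<Rightarrow> 'b \<Rightarrow> bool) \<Rightarrow> 'b set \<Rightarrow> bool" where
  "is_antichain le B \<longleftrightarrow> (\<forall>S\<in>B. \<forall>T\<in>B. S \<noteq> T \<longrightarrow> \<not> le S T \<and> \<not> le T S)"

text \<open>The classes considered contain spaces over arbitrary types, whereas a concrete basis lives
  over one fixed type. The class and the quasi-order are therefore passed in two instances:
  \<open>Qb\<close>, \<open>leb\<close> at the type of the basis, and \<open>Qa\<close>, \<open>lea\<close> for comparison with
  a space over any other type.\<close>

definition is_basis :: "('b \<Rightarrow> 'a \<Rightarrow> bool) \<Rightarrow> ('b \<Rightarrow> bool) \<Rightarrow> ('a \<Rightarrow> bool) \<Rightarrow> 'b set \<Rightarrow> bool" where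
  "is_basis lea Qb Qa B \<longleftrightarrow> (\<forall>S\<in>B. Qb S) \<and> (\<forall>T. Qa T \<longrightarrow> (\<exists>S\<in>B. lea S T))"

definition antichain_basis ::
  "('b \<Rightarrow> 'b \<Rightarrow> bool) \<Rightarrow> ('b \<Rightarrow> 'a \<Rightarrow> bool) \<Rightarrow> ('b \<Rightarrow> bool) \<Rightarrow> ('a \<Rightarrow> bool) \<Rightarrow> 'b set \<Rightarrow> bool" where
  "antichain_basis leb lea Qb Qa B \<longleftrightarrow> is_basis lea Qb Qa B \<and> is_antichain leb B"


section \<open>The concrete spaces\<close>

text \<open>The set $2 = \{0, 1\}$ is rendered by \<^typ>\<open>bool\<close>, with \<^const>\<open>False\<close> for $0$ and
  \<^const>\<open>True\<close> for $1$; the set $4$ by the natural numbers below $4$.\<close>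

definition cantor :: "(nat \<Rightarrow> bool) topology" where
  "cantor = product_topology (\<lambda>_. discrete_topology UNIV) UNIV"

definition DD :: "(bool \<times> (nat \<Rightarrow> bool)) topology" where
  "DD = prod_topology (discrete_topology UNIV) cantor"

definition zeros :: "nat \<Rightarrow> bool" where
  "zeros = (\<lambda>_. False)"

definition SS :: "(nat \<Rightarrow> bool) topology" where
  "SS = subtopology cantor ({zeros} \<union> {\<alpha>. \<alpha> 0})"

definition one_cons :: "(nat \<Rightarrow> bool) \<Rightarrow> nat \<Rightarrow> bool" where
  "one_cons \<alpha> = case_nat True \<alpha>"

definition CC :: "(nat \<Rightarrow> bool) set" where
  "CC = {\<alpha>. finite {n. \<alpha> n}}"

definition Sset :: "nat \<Rightarrow> (nat \<Rightarrow> bool) set" where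
  "Sset i = (if i = 0 then CC else if i = 1 then {} else if i = 2 then - CC else UNIV)"

definition tables :: "(bool \<Rightarrow> bool \<Rightarrow> nat) set" where
  "tables = {t. \<forall>\<epsilon> \<eta>. t \<epsilon> \<eta> < 4}"

definition PP :: "(bool \<Rightarrow> bool \<Rightarrow> nat) set" where
  "PP = {t \<in> tables. t False False \<noteq> 0 \<and> t True True \<noteq> 0 \<and> t False True = 0 \<and>
          (t True False = 0 \<longrightarrow> t False False \<le> t True True)}"

definition RR :: "(bool \<Rightarrow> bool \<Rightarrow> nat) \<Rightarrow> ((bool \<times> (nat \<Rightarrow> bool)) \<times> (bool \<times> (nat \<Rightarrow> bool))) set" where
  "RR t = {((\<epsilon>, x), (\<eta>, x)) | \<epsilon> \<eta> x. x \<in> Sset (t \<epsilon> \<eta>)}"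

definition RRa :: "(bool \<Rightarrow> bool \<Rightarrow> nat) \<Rightarrow> ((nat \<Rightarrow> bool) \<times> (nat \<Rightarrow> bool)) set" where
  "RRa t = {p. p = (zeros, zeros) \<and> t False False = 1}
     \<union> {(zeros, one_cons \<alpha>) | \<alpha>. \<alpha> \<in> Sset (t False True)}
     \<union> {(one_cons \<alpha>, zeros) | \<alpha>. \<alpha> \<in> Sset (t True False)}
     \<union> {(one_cons \<alpha>, one_cons \<alpha>) | \<alpha>. \<alpha> \<in> Sset (t True True)}"

definition PPa :: "(bool \<Rightarrow> bool \<Rightarrow> nat) set" where
  "PPa = {t \<in> tables. t False False \<in> {0, 1} \<and> t False True \<in> {0, 1} \<and> t True False \<in> {0, 1} \<and>
           (t False True = 0 \<or> t True False = 0) \<and> t True True \<noteq> 0}"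

definition GGm :: "((bool \<times> (nat \<Rightarrow> bool)) \<times> (bool \<times> (nat \<Rightarrow> bool))) set" where
  "GGm = {((\<epsilon>, x), (\<not> \<epsilon>, x)) | \<epsilon> x. x \<in> CC}"

definition GGma :: "((nat \<Rightarrow> bool) \<times> (nat \<Rightarrow> bool)) set" where
  "GGma = symmetrization {(zeros, one_cons \<alpha>) | \<alpha>. \<alpha> \<in> CC}"


section \<open>Collecting the examples over one type\<close>

text \<open>The spaces $2^\omega$ and $\mathbb{S}$ live on one type and $\mathbb{D}$ on another. To
  form sets of examples, they are copied homeomorphically into the sum type along the two
  injections; this does not identify distinct examples.\<close>

definition copy :: "('a \<Rightarrow> 'b) \<Rightarrow> 'a relspace \<Rightarrow> 'b relspace" where
  "copy h = (\<lambda>(X, R). (pullback_topology (h ` topspace X) (inv h) X, map_prod h h ` R))"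

type_synonym point = "(nat \<Rightarrow> bool) + (bool \<times> (nat \<Rightarrow> bool))"

abbreviation on_cantor :: "(nat \<Rightarrow> bool) relspace \<Rightarrow> point relspace" where
  "on_cantor \<equiv> copy Inl"

abbreviation on_D :: "(bool \<times> (nat \<Rightarrow> bool)) relspace \<Rightarrow> point relspace" where
  "on_D \<equiv> copy Inr"

definition AA_family :: "point relspace set" where
  "AA_family = {on_cantor (cantor, {(x, x) | x. x \<in> CC})} \<union> {on_D (DD, RR t) | t. t \<in> PP}"

definition CC_family :: "point relspace set" where
  "CC_family = AA_family \<union> {on_cantor (SS, RRa t) | t. t \<in> PPa}"

definition GG_family :: "point relspace set" where
  "GG_family = {on_D (DD, GGm), on_cantor (SS, GGma)}"

lemma homeomorphic_map_copy:
  assumes "inj h"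
  shows "homeomorphic_map X (fst (copy h (X, R))) h"
proof -
  let ?Y = "pullback_topology (h ` topspace X) (inv h) X"
  have top: "topspace ?Y = h ` topspace X"
    using assms by (auto simp: topspace_pullback_topology)
  have "continuous_map X ?Y h"
    unfolding continuous_map_def openin_pullback_topology top
  proof (intro conjI allI impI)
    fix U assume "\<exists>V. openin X V \<and> U = inv h -` V \<inter> h ` topspace X"
    then obtain V where V: "openin X V" "U = inv h -` V \<inter> h ` topspace X" by blast
    have "{x \<in> topspace X. h x \<in> U} = V"
      using V assms openin_subset[OF V(1)] by auto
    with V show "openin X {x \<in> topspace X. h x \<in> U}" by simp
  qed auto
  moreover have "continuous_map ?Y X (inv h)"
    using continuous_map_pullback[OF continuous_map_id, of "h ` topspace X" "inv h" X] by simp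
  ultimately have "homeomorphic_maps X ?Y h (inv h)"
    using assms by (auto simp: homeomorphic_maps_def top)
  then show ?thesis
    by (auto simp: copy_def homeomorphic_maps_map)
qed

lemma copy_inject:
  assumes "inj h" "copy h (X, R) = copy h (Y, S)"
  shows "X = Y" "R = S"
proof -
  have "inj (map_prod h h)" using assms(1) by (simp add: prod.inj_map)
  then show "R = S" using assms(2) by (auto simp: copy_def inj_image_eq_iff)
  have *: "openin Z U \<longleftrightarrow> openin (fst (copy h (Z, R))) (h ` U)" for Z U and R
  proof (cases "U \<subseteq> topspace Z")
    case True
    then show ?thesis
      using homeomorphic_map_openness_eq[OF homeomorphic_map_copy[OF assms(1), of Z R], of U] by auto
  next
    case False
    have "topspace (fst (copy h (Z, R))) = h ` topspace Z"
      using homeomorphic_imp_surjective_map[OF homeomorphic_map_copy[OF assms(1)]] by metis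
    with False show ?thesis
      by (metis assms(1) inj_image_subset_iff openin_subset)
  qed
  show "X = Y"
    unfolding topology_eq using *[of X _ R] *[of Y _ S] assms(2) by simp
qed

end

theory Submission
  imports Defs
begin

text \<open>Let \<open>R\<close> be a locally countable Borel relation on an analytic space \<open>X\<close> whose
symmetrization is acyclic, and suppose that \<open>R\<close> is not $G_\delta$ in the square. By the
Hurewicz dichotomy (lemma \<open>hurewicz\<close>), there is a continuous map
\<open>(f, g)\<close> from Cantor space into \<open>X \<times> X\<close> that is in \<open>R\<close> exactly on the
countable dense set \<open>CC\<close> of eventually vanishing sequences. From here on the work takes place in
Cantor space: one passes to copies of Cantor space inside itself on which \<open>CC\<close> is still cut out
by the inclusion, until \<open>R\<close> looks like one of the examples.

On a suitable cylinder either \<open>f = g\<close>, or \<open>f\<close> and \<open>g\<close> have disjoint ranges. In the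
latter case each of them is constant somewhere or nowhere constant, and they cannot both be
constant. A nowhere constant map becomes injective on a copy (\<open>injectivize\<close>). So one finds in
\<open>X\<close> a continuous injective image of Cantor space, of \<open>DD\<close> or of \<open>SS\<close>, and \<open>R\<close> restricted to
it is given by finitely many relations on Cantor space, one for each pair of sheets. If these
relations have no off-diagonal part, and if their diagonal parts are among the four sets
\<open>Sset i\<close>, then \<open>R\<close> is one of the listed relations there. Lemma \<open>normalize\<close>
provides a copy on which both hold, by three means.

\<^item> The diagonal parts have the Baire property. So on some cylinder each of them contains almost all
  or almost none of the generic points, and all or none of the points of a dense subset
  of \<open>CC\<close>.
\<^item> Off-diagonal pairs with a coordinate outside \<open>CC\<close> are destroyed by category. A Borel
  relation with countable sections is tame, that is, covered by countably many relations that
  can be avoided next to any given point by shrinking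
  (\<open>Borel_locally_countable_tame\<close>, which takes the place of the Lusin--Novikov theorem), and
  lemma \<open>thinning\<close> constructs copies whose generic points are unrelated under a tame relation.
\<^item> Off-diagonal pairs inside \<open>CC\<close> are destroyed by acyclicity. If at some stage no
  further point of \<open>CC\<close> is unrelated to the finitely many points chosen so far, then a single one of
  them is adjacent to a somewhere dense set of points of \<open>CC\<close>. As all of these have a common
  neighbour, an edge between two of them would close a cycle, so one continues with this dense set
  in place of \<open>CC\<close> (\<open>independent_selection\<close>).

The examples are incomparable because \<open>CC\<close> is not $G_\delta$ in any cylinder. A reduction between
two examples has to preserve the shape of the space, since on the dense set \<open>CC\<close> edges must go
to edges. Between examples of the same shape, on a small cylinder, it acts on the sheets by a
permutation and on Cantor space by a map that reduces \<open>CC\<close> to some \<open>Sset i\<close>. This is possible for \<open>i = 0\<close> only, and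
then all entries of the two tables agree, up to exchanging the two sheets.

A relation that is reducible to a graph is itself a graph, and only two of the examples are
graphs, which gives the second part.\<close>

section \<open>Cylinders and branches\<close>

text \<open>The initial segment of length \<open>n\<close>. Basic open sets of sequence spaces are indexed by lists, and a
basic set inside \<open>cyl u\<close> is written \<open>cyl (u @ w)\<close>.\<close>

definition pre :: "(nat \<Rightarrow> 'k) \<Rightarrow> nat \<Rightarrow> 'k list" where
  "pre x n = map x [0..<n]"

definition cyl :: "'k list \<Rightarrow> (nat \<Rightarrow> 'k) set" where
  "cyl u = {x. pre x (length u) = u}"

definition branches :: "'k list set \<Rightarrow> (nat \<Rightarrow> 'k) set" where
  "branches T = {z. \<forall>n. pre z n \<in> T}"

lemma length_pre [simp]: "length (pre x n) = n"
  by (simp add: pre_def)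

lemma pre_0 [simp]: "pre x 0 = []"
  by (simp add: pre_def)

lemma pre_eq_iff: "pre x n = pre y n \<longleftrightarrow> (\<forall>i<n. x i = y i)"
  by (auto simp: pre_def)

lemma pre_in_cyl [simp]: "x \<in> cyl (pre x n)"
  by (simp add: cyl_def)

lemma cyl_Nil [simp]: "cyl [] = UNIV"
  by (simp add: cyl_def)

lemma cyl_pre_iff: "y \<in> cyl (pre x n) \<longleftrightarrow> pre y n = pre x n"
  by (simp add: cyl_def)

lemma cyl_iff_nth: "x \<in> cyl u \<longleftrightarrow> (\<forall>i<length u. x i = u ! i)"
proof
  assume "x \<in> cyl u"
  then have "pre x (length u) = u" by (simp add: cyl_def)
  then show "\<forall>i<length u. x i = u ! i" by (metis add_0 length_pre nth_map_upt pre_def diff_zero)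
next
  assume "\<forall>i<length u. x i = u ! i"
  then have "pre x (length u) = u" by (intro nth_equalityI) (auto simp: pre_def)
  then show "x \<in> cyl u" by (simp add: cyl_def)
qed

lemma cyl_append_subset: "cyl (u @ w) \<subseteq> cyl u"
  by (auto simp: cyl_iff_nth nth_append)

lemma cyl_appendD: "x \<in> cyl (u @ w) \<Longrightarrow> x \<in> cyl u"
  using cyl_append_subset by blast

lemma pre_Suc: "pre x (Suc n) = pre x n @ [x n]"
  by (simp add: pre_def)

lemma pre_add: "\<exists>w. pre x (n + m) = pre x n @ w"
  by (metis add_0 pre_def map_append upt_add_eq_append zero_le)

lemma pre_mono: "n \<le> m \<Longrightarrow> \<exists>w. pre x m = pre x n @ w"
  by (metis le_add_diff_inverse pre_add)

lemma pre_extends: "x \<in> cyl u \<Longrightarrow> length u \<le> n \<Longrightarrow> \<exists>w. pre x n = u @ w"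
  by (metis (mono_tags, lifting) cyl_def mem_Collect_eq pre_mono)

lemma cyl_pre_antimono: "n \<le> m \<Longrightarrow> cyl (pre x m) \<subseteq> cyl (pre x n)"
  using pre_mono[of n m x] cyl_append_subset by metis

lemma cyl_pre_length: "x \<in> cyl u \<Longrightarrow> pre x (length u) = u"
  by (simp add: cyl_def)

lemma cyl_nonempty: "\<exists>x. x \<in> cyl u"
  by (rule exI[of _ "\<lambda>i. u ! i"]) (simp add: cyl_iff_nth)

lemma cyl_comparable:
  assumes "x \<in> cyl u" "x \<in> cyl v"
  shows "(\<exists>w. v = u @ w) \<or> (\<exists>w. u = v @ w)"
  by (metis assms cyl_pre_length linorder_le_cases pre_mono)

lemma cyl_eqI: "(\<And>n. x \<in> cyl (pre y n)) \<Longrightarrow> x = y"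
  by (rule ext) (metis cyl_pre_iff lessI pre_eq_iff)

lemma separating_pre: "x \<noteq> y \<Longrightarrow> \<exists>n. cyl (pre x n) \<inter> cyl (pre y n) = {}"
proof -
  assume "x \<noteq> y"
  then obtain i where "x i \<noteq> y i" by blast
  then have "cyl (pre x (Suc i)) \<inter> cyl (pre y (Suc i)) = {}"
    by (auto simp: cyl_pre_iff pre_eq_iff)
  then show ?thesis ..
qed

text \<open>This produces every limit point constructed below.\<close>

lemma increasing_lists_limit:
  fixes L :: "nat \<Rightarrow> 'k list"
  assumes ext: "\<And>k. \<exists>w. L (Suc k) = L k @ w" and len: "\<And>i. \<exists>k. i < length (L k)"
  obtains z where "\<And>k. z \<in> cyl (L k)"
proof
  have mono: "\<exists>w. L m = L k @ w" if "k \<le> m" for k m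
    using that
  proof (induction rule: dec_induct)
    case (step n)
    then show ?case using ext[of n] by (metis append.assoc)
  qed auto
  define K where "K i = (SOME k. i < length (L k))" for i
  have K: "i < length (L (K i))" for i unfolding K_def using len by (rule someI_ex)
  show "(\<lambda>i. L (K i) ! i) \<in> cyl (L k)" for k
    unfolding cyl_iff_nth
  proof (intro allI impI)
    fix i assume i: "i < length (L k)"
    show "L (K i) ! i = L k ! i"
    proof (cases "k \<le> K i")
      case True
      then show ?thesis using mono[OF True] i by (metis nth_append)
    next
      case False
      then have "K i \<le> k" by simp
      then show ?thesis using mono[of "K i" k] K[of i] by (metis nth_append)
    qed
  qed
qed

text \<open>The Baire category theorem for the body of a pruned tree: meet the requirements one after the other
while extending the finite approximation inside \<open>T\<close>.\<close>

lemma baire_branches: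
  fixes T :: "'k list set" and N :: "nat \<Rightarrow> (nat \<Rightarrow> 'k) set"
  assumes v0: "v0 \<in> T" and closed: "\<And>v w. v @ w \<in> T \<Longrightarrow> v \<in> T"
    and avoid: "\<And>k v. v \<in> T \<Longrightarrow> \<exists>w. w \<noteq> [] \<and> v @ w \<in> T \<and> branches T \<inter> cyl (v @ w) \<inter> N k = {}"
  obtains z where "z \<in> branches T" "z \<in> cyl v0" "\<And>k. z \<notin> N k"
proof -
  obtain L where L0: "L 0 = v0" and LT: "\<And>k. L k \<in> T"
    and step: "\<And>k. \<exists>w. w \<noteq> [] \<and> L (Suc k) = L k @ w \<and> branches T \<inter> cyl (L k @ w) \<inter> N k = {}"
  proof -
    let ?Q = "\<lambda>n (v :: 'k list) v'. \<exists>w. w \<noteq> [] \<and> v' = v @ w \<and> branches T \<inter> cyl (v @ w) \<inter> N n = {}"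
    have "\<exists>f. \<forall>n. (f n \<in> T \<and> (n = 0 \<longrightarrow> f n = v0)) \<and> ?Q n (f n) (f (Suc n))"
    proof (rule dependent_nat_choice)
      show "\<exists>y. (y \<in> T \<and> (Suc n = 0 \<longrightarrow> y = v0)) \<and> ?Q n x y" if "x \<in> T \<and> (n = 0 \<longrightarrow> x = v0)" for x n
        using avoid[of x n] that by auto
    qed (use v0 in auto)
    then obtain f where "\<And>n. (f n \<in> T \<and> (n = 0 \<longrightarrow> f n = v0)) \<and> ?Q n (f n) (f (Suc n))" by auto
    then show thesis by (intro that[of f]) auto
  qed
  have len: "k \<le> length (L k)" for k
  proof (induction k)
    case (Suc k)
    obtain w where "w \<noteq> []" "L (Suc k) = L k @ w" using step by blast
    then show ?case using Suc by (cases w) auto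
  qed simp
  obtain z where z: "\<And>k. z \<in> cyl (L k)"
    using increasing_lists_limit[of L] step len by (metis Suc_le_eq)
  have "z \<in> branches T"
    unfolding branches_def
  proof safe
    fix n
    have "\<exists>w. L n = pre z n @ w"
      using pre_mono[OF len[of n], of z] cyl_pre_length[OF z] by metis
    then show "pre z n \<in> T" using closed LT by metis
  qed
  moreover have "z \<notin> N k" for k
    using step[of k] z[of "Suc k"] \<open>z \<in> branches T\<close> by auto
  ultimately show thesis using that z[of 0] L0 by metis
qed

section \<open>Meagre sets and tame relations\<close>

definition nowhere_dense :: "(nat \<Rightarrow> 'k) set \<Rightarrow> bool" where
  "nowhere_dense N \<longleftrightarrow> (\<forall>u. \<exists>w. cyl (u @ w) \<inter> N = {})"

text \<open>The \<open>\<sigma>\<close>-ideal generated by the sets satisfying \<open>P\<close>. It occurs with nowhere dense sets, with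
thin relations, and with the closed sets disjoint from a given set.\<close>

definition countably_covered :: "('b set \<Rightarrow> bool) \<Rightarrow> 'b set \<Rightarrow> bool" where
  "countably_covered P M \<longleftrightarrow> (\<exists>\<N>. countable \<N> \<and> (\<forall>N\<in>\<N>. P N) \<and> M \<subseteq> \<Union>\<N>)"

abbreviation meagre :: "(nat \<Rightarrow> 'k) set \<Rightarrow> bool" where
  "meagre \<equiv> countably_covered nowhere_dense"

lemma countably_covered_self: "P N \<Longrightarrow> countably_covered P N"
  unfolding countably_covered_def by (intro exI[of _ "{N}"]) auto

lemma countably_covered_empty [simp]: "countably_covered P {}"
  unfolding countably_covered_def by (intro exI[of _ "{}"]) auto

lemma countably_covered_subset: "countably_covered P N \<Longrightarrow> M \<subseteq> N \<Longrightarrow> countably_covered P M"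
  unfolding countably_covered_def by (meson order_trans)

lemma countably_covered_UN:
  assumes "countable I" "\<And>i. i \<in> I \<Longrightarrow> countably_covered P (M i)"
  shows "countably_covered P (\<Union>i\<in>I. M i)"
proof -
  have "\<forall>i\<in>I. \<exists>\<N>. countable \<N> \<and> (\<forall>N\<in>\<N>. P N) \<and> M i \<subseteq> \<Union>\<N>"
    using assms(2) unfolding countably_covered_def by blast
  then obtain \<N> where N: "\<And>i. i \<in> I \<Longrightarrow> countable (\<N> i) \<and> (\<forall>N\<in>\<N> i. P N) \<and> M i \<subseteq> \<Union>(\<N> i)"
    by metis
  show ?thesis
    unfolding countably_covered_def
  proof (intro exI conjI)
    show "countable (\<Union>i\<in>I. \<N> i)" using assms(1) N by (intro countable_UN) auto
    show "\<forall>N\<in>(\<Union>i\<in>I. \<N> i). P N" using N by simp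
    show "(\<Union>i\<in>I. M i) \<subseteq> \<Union>(\<Union>i\<in>I. \<N> i)"
    proof (rule UN_least)
      fix i assume i: "i \<in> I"
      then have "M i \<subseteq> \<Union>(\<N> i)" using N by simp
      also have "\<dots> \<subseteq> \<Union>(\<Union>i\<in>I. \<N> i)" using i by blast
      finally show "M i \<subseteq> \<Union>(\<Union>i\<in>I. \<N> i)" .
    qed
  qed
qed

lemma countably_covered_UN_nat: "(\<And>k :: nat. countably_covered P (M k)) \<Longrightarrow> countably_covered P (\<Union>k. M k)"
  by (rule countably_covered_UN) auto

lemma countably_covered_Un:
  "countably_covered P A \<Longrightarrow> countably_covered P B \<Longrightarrow> countably_covered P (A \<union> B)"
  using countably_covered_UN[of "{A, B}" P "\<lambda>x. x"] by fastforce

lemma countably_covered_sequence: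
  assumes "countably_covered P M" "P {}"
  obtains N :: "nat \<Rightarrow> 'b set" where "\<And>k. P (N k)" "M \<subseteq> (\<Union>k. N k)"
proof -
  obtain \<N> where N: "countable \<N>" "\<forall>N\<in>\<N>. P N" "M \<subseteq> \<Union>\<N>"
    using assms(1) unfolding countably_covered_def by meson
  have ran: "range (from_nat_into (insert {} \<N>)) = insert {} \<N>"
    using N(1) by (intro range_from_nat_into) auto
  show thesis
  proof
    show "P (from_nat_into (insert {} \<N>) k)" for k
      using from_nat_into[of "insert {} \<N>" k] N(2) assms(2) by auto
    show "M \<subseteq> (\<Union>k. from_nat_into (insert {} \<N>) k)" using N(3) unfolding ran by simp
  qed
qed

text \<open>The points outside the cylinders on which \<open>M\<close> is small form a nowhere dense set, and there are
only countably many cylinders.\<close>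

lemma countably_covered_local:
  fixes p :: "'b \<Rightarrow> nat \<Rightarrow> 'k::countable"
  assumes small: "\<And>N. nowhere_dense N \<Longrightarrow> countably_covered P (p -` N)"
    and dense: "\<And>u. \<exists>w. countably_covered P (M \<inter> p -` cyl (s @ u @ w))"
  shows "countably_covered P (M \<inter> p -` cyl s)"
proof -
  define G where "G = {v. countably_covered P (M \<inter> p -` cyl v)}"
  have "nowhere_dense (cyl s - (\<Union>v\<in>G. cyl v))"
    unfolding nowhere_dense_def
  proof
    fix u
    show "\<exists>w. cyl (u @ w) \<inter> (cyl s - (\<Union>v\<in>G. cyl v)) = {}"
    proof (cases "cyl u \<inter> cyl s = {}")
      case True
      then show ?thesis by (intro exI[of _ "[]"]) auto
    next
      case False
      then obtain w1 w2 where w: "u @ w1 = s @ w2"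
        using cyl_comparable[of _ u s] by (metis append.right_neutral disjoint_iff)
      obtain w3 where "countably_covered P (M \<inter> p -` cyl (s @ w2 @ w3))" using dense by blast
      moreover have "s @ w2 @ w3 = u @ w1 @ w3" using arg_cong[OF w, of "\<lambda>v. v @ w3"] by simp
      ultimately have "u @ w1 @ w3 \<in> G" by (simp only: G_def mem_Collect_eq)
      then show ?thesis by blast
    qed
  qed
  then have "countably_covered P (p -` (cyl s - (\<Union>v\<in>G. cyl v)) \<union> (\<Union>v\<in>G. M \<inter> p -` cyl v))"
    by (intro countably_covered_Un countably_covered_UN small) (auto simp: G_def)
  then show ?thesis by (rule countably_covered_subset) auto
qed

lemma nowhere_dense_empty: "nowhere_dense {}"
  by (simp add: nowhere_dense_def)

lemma cyl_not_meagre: "\<not> meagre (cyl (u :: 'k list))"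
proof
  assume "meagre (cyl u)"
  then obtain N where N: "\<And>k. nowhere_dense (N k)" "cyl u \<subseteq> (\<Union>k::nat. N k)"
    using countably_covered_sequence nowhere_dense_empty by blast
  have "\<exists>w. w \<noteq> [] \<and> v @ w \<in> UNIV \<and> branches UNIV \<inter> cyl (v @ w) \<inter> N k = {}" for k and v :: "'k list"
  proof -
    obtain w where w: "cyl (v @ [undefined] @ w) \<inter> N k = {}"
      using N(1)[of k] unfolding nowhere_dense_def by (metis append.assoc)
    then show ?thesis by (intro exI[of _ "[undefined] @ w"]) auto
  qed
  then obtain z where "z \<in> cyl u" "\<And>k. z \<notin> N k"
    by (rule baire_branches[of u UNIV N, rotated 2]) auto
  with N(2) show False by blast
qed

lemma meagre_local:
  fixes M :: "(nat \<Rightarrow> 'k::countable) set"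
  assumes "\<And>u. \<exists>w. meagre (M \<inter> cyl (s @ u @ w))"
  shows "meagre (M \<inter> cyl s)"
  using countably_covered_local[of nowhere_dense "\<lambda>x. x" M s] assms by (simp add: countably_covered_self)

text \<open>Whatever point \<open>y\<close> is prescribed for the second coordinate, \<open>Q\<close> can be avoided by moving the first
coordinate a little and keeping the second one near \<open>y\<close>. For a closed relation on Cantor space this says that
its horizontal sections are nowhere dense. The notion is asymmetric on purpose: in the construction
of a copy the first coordinate is about to be chosen, whereas the second one stays
close to a point that has been fixed.\<close>

definition thin :: "((nat \<Rightarrow> 'k) \<times> (nat \<Rightarrow> 'k)) set \<Rightarrow> bool" where
  "thin Q \<longleftrightarrow> (\<forall>y u. \<exists>w m. cyl (u @ w) \<times> cyl (pre y m) \<inter> Q = {})"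

abbreviation tame :: "((nat \<Rightarrow> 'k) \<times> (nat \<Rightarrow> 'k)) set \<Rightarrow> bool" where
  "tame \<equiv> countably_covered thin"

lemma thin_empty: "thin {}"
  by (simp add: thin_def)

lemma thin_cylinder: "nowhere_dense N \<Longrightarrow> thin (N \<times> UNIV)"
  unfolding thin_def nowhere_dense_def by fastforce

lemma tame_meagre:
  assumes "meagre N" shows "tame (N \<times> UNIV)"
proof -
  obtain Q where Q: "\<And>k. nowhere_dense (Q k)" "N \<subseteq> (\<Union>k::nat. Q k)"
    using countably_covered_sequence[OF assms nowhere_dense_empty] by blast
  have "tame (\<Union>k. Q k \<times> UNIV)"
    by (intro countably_covered_UN_nat countably_covered_self thin_cylinder Q(1))
  then show ?thesis by (rule countably_covered_subset) (use Q(2) in auto)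
qed

lemma tame_local:
  fixes M :: "((nat \<Rightarrow> 'k::countable) \<times> (nat \<Rightarrow> 'k)) set"
  assumes "\<And>u. \<exists>w. tame (M \<inter> cyl (s @ u @ w) \<times> UNIV)"
  shows "tame (M \<inter> cyl s \<times> UNIV)"
proof -
  have fst: "A \<times> UNIV = fst -` A" for A :: "(nat \<Rightarrow> 'k) set" by auto
  have "tame (fst -` N)" if "nowhere_dense N" for N :: "(nat \<Rightarrow> 'k) set"
    using countably_covered_self[of thin, OF thin_cylinder[OF that]] unfolding fst .
  then show ?thesis using assms unfolding fst by (intro countably_covered_local) auto
qed

section \<open>A category version of the Lusin--Novikov theorem\<close>

definition seqclosed :: "(nat \<Rightarrow> 'k) set \<Rightarrow> bool" where
  "seqclosed F \<longleftrightarrow> (\<forall>z. (\<forall>n. F \<inter> cyl (pre z n) \<noteq> {}) \<longrightarrow> z \<in> F)"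

text \<open>This is a category version of the Lusin--Novikov theorem for the relation
\<open>{(a z, b z) | z \<in> F}\<close>. If it were not tame, attach to each \<open>x\<close> the tree \<open>T x\<close> of those \<open>v\<close>
such that no neighbourhood of \<open>x\<close> makes the part coming from \<open>cyl v\<close> tame. For almost all \<open>x\<close> this is
a pruned tree whose branches are witnesses for points of the section at \<open>x\<close>. As that section is
countable, \<open>b\<close> is constant on the branches through some \<open>v\<close>, and the same \<open>v\<close> serves
for a nonmeagre set of \<open>x\<close>. On it the relation is essentially the graph of a function, which is
thin since its fibres are meagre.\<close>

lemma category_uniformization:
  fixes F :: "(nat \<Rightarrow> nat) set" and a b :: "(nat \<Rightarrow> nat) \<Rightarrow> nat \<Rightarrow> bool"
  assumes closed: "seqclosed F"
    and ca: "\<And>z N. z \<in> F \<Longrightarrow> \<exists>n. a ` (F \<inter> cyl (pre z n)) \<subseteq> cyl (pre (a z) N)"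
    and cb: "\<And>z N. z \<in> F \<Longrightarrow> \<exists>n. b ` (F \<inter> cyl (pre z n)) \<subseteq> cyl (pre (b z) N)"
    and vert: "\<And>x. countable {b z | z. z \<in> F \<and> a z = x}"
    and hor: "\<And>y. meagre {a z | z. z \<in> F \<and> b z = y}"
  shows "tame ((\<lambda>z. (a z, b z)) ` F)"
proof (rule ccontr)
  assume not_tame: "\<not> tame ((\<lambda>z. (a z, b z)) ` F)"
  define R where "R s v = (\<lambda>z. (a z, b z)) ` {z \<in> F \<inter> cyl v. a z \<in> cyl s}" for s v
  define P where "P s v \<longleftrightarrow> \<not> tame (R s v)" for s v
  \<comment> \<open>The closed hull of \<open>a ` (F \<inter> cyl v)\<close> with respect to tameness.\<close>
  define H where "H v = {x. \<forall>n. P (pre x n) v}" for v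
  have R_local: "R (s @ u) v = R s v \<inter> cyl (s @ u) \<times> UNIV" for s u v
    unfolding R_def using cyl_append_subset[of s u] by auto
  have R_mono: "R (s @ u) (v @ w) \<subseteq> R s v" for s u v w
    unfolding R_def using cyl_append_subset[of s u] cyl_append_subset[of v w] by blast
  have P_mono: "P s v" if "P (s @ u) (v @ w)" for s u v w
    using that R_mono countably_covered_subset unfolding P_def by metis
  have P0: "P [] []"
    using not_tame by (simp add: P_def R_def)
  have H_mono: "H (v @ w) \<subseteq> H v" for v w
    unfolding H_def using P_mono[of _ "[]" v w] by auto
  have hull_somewhere_full: "\<exists>w. cyl (s @ w) \<subseteq> H v" if "P s v" for s v
  proof (rule ccontr)
    assume contra: "\<nexists>w. cyl (s @ w) \<subseteq> H v"
    have "\<exists>w'. tame (R s v \<inter> cyl (s @ w @ w') \<times> UNIV)" for w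
    proof -
      obtain x n where x: "x \<in> cyl (s @ w)" and n: "\<not> P (pre x n) v"
        using contra unfolding H_def by blast
      define m where "m = max n (length (s @ w))"
      obtain w' where w': "pre x m = (s @ w) @ w'"
        using pre_extends[OF x, of m] unfolding m_def by auto
      obtain w'' where "pre x m = pre x n @ w''"
        using pre_mono[of n m x] unfolding m_def by auto
      then have "\<not> P (s @ w @ w') v"
        using n P_mono[of "pre x n" w'' v "[]"] w' by auto
      then show ?thesis using R_local[of s "w @ w'" v] by (auto simp: P_def)
    qed
    then have "tame (R s v \<inter> cyl s \<times> UNIV)" by (rule tame_local)
    then have "tame (R s v)" using R_local[of s "[]" v] by simp
    with that show False by (simp add: P_def)
  qed
  have hull_child: "\<exists>n w. cyl (s @ w) \<subseteq> H (v @ [n])" if "P s v" for s v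
  proof -
    have "\<exists>n. P s (v @ [n])"
    proof (rule ccontr)
      assume "\<nexists>n. P s (v @ [n])"
      then have "tame (\<Union>n. R s (v @ [n]))" by (intro countably_covered_UN_nat) (simp add: P_def)
      moreover have "R s v \<subseteq> (\<Union>n. R s (v @ [n]))"
      proof
        fix p assume "p \<in> R s v"
        then obtain z where z: "z \<in> F" "z \<in> cyl v" "a z \<in> cyl s" "p = (a z, b z)"
          unfolding R_def by auto
        have "z \<in> cyl (v @ [z (length v)])"
          using z(2) by (auto simp: cyl_iff_nth nth_append less_Suc_eq)
        then have "p \<in> R s (v @ [z (length v)])" unfolding R_def using z by auto
        then show "p \<in> (\<Union>n. R s (v @ [n]))" by blast
      qed
      ultimately show False using that countably_covered_subset unfolding P_def by blast
    qed
    then show ?thesis using hull_somewhere_full by blast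
  qed
  \<comment> \<open>Outside \<open>W\<close> the trees \<open>T x\<close> defined below are pruned.\<close>
  define W where "W = (\<Union>v. H v - (\<Union>n. H (v @ [n])))"
  have "meagre W"
    unfolding W_def
  proof (rule countably_covered_UN, simp, rule countably_covered_self)
    fix v
    show "nowhere_dense (H v - (\<Union>n. H (v @ [n])))"
      unfolding nowhere_dense_def
    proof
      fix u
      show "\<exists>w. cyl (u @ w) \<inter> (H v - (\<Union>n. H (v @ [n]))) = {}"
      proof (cases "cyl u \<inter> H v = {}")
        case True
        then show ?thesis by (intro exI[of _ "[]"]) auto
      next
        case False
        then obtain x where x: "x \<in> cyl u" "x \<in> H v" by blast
        have "P u v" using x(2) cyl_pre_length[OF x(1)] unfolding H_def by (metis mem_Collect_eq)
        then obtain n w where "cyl (u @ w) \<subseteq> H (v @ [n])" using hull_child by blast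
        then show ?thesis by (intro exI[of _ w]) blast
      qed
    qed
  qed
  define T where "T x = {v. x \<in> H v}" for x
  have T_closed: "v \<in> T x" if "v @ w \<in> T x" for v w x
    using that H_mono[of v w] unfolding T_def by auto
  have T_step: "\<exists>n. v @ [n] \<in> T x" if "v \<in> T x" "x \<notin> W" for v x
    using that unfolding T_def W_def by blast
  have T_branch: "z \<in> F \<and> a z = x" if z: "z \<in> branches (T x)" for z x
  proof -
    have ne: "\<exists>z'\<in>F \<inter> cyl (pre z n). a z' \<in> cyl (pre x m)" for n m
    proof -
      have "P (pre x m) (pre z n)" using z unfolding branches_def T_def H_def by blast
      then have "R (pre x m) (pre z n) \<noteq> {}" by (metis P_def countably_covered_empty)
      then show ?thesis unfolding R_def by blast
    qed
    then have zF: "z \<in> F" using closed unfolding seqclosed_def by blast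
    have "x \<in> cyl (pre (a z) N)" for N
    proof -
      obtain n where n: "a ` (F \<inter> cyl (pre z n)) \<subseteq> cyl (pre (a z) N)" using ca[OF zF] by blast
      obtain z' where "z' \<in> F \<inter> cyl (pre z n)" "a z' \<in> cyl (pre x N)" using ne by blast
      moreover from this n have "a z' \<in> cyl (pre (a z) N)" by blast
      ultimately show ?thesis by (metis cyl_pre_iff)
    qed
    then show ?thesis using zF cyl_eqI by metis
  qed
  have T_extend: "\<exists>z\<in>branches (T x). z \<in> cyl v" if vT: "v \<in> T x" and xW: "x \<notin> W" for v x
  proof -
    obtain z where "z \<in> branches (T x)" "z \<in> cyl v"
    proof (rule baire_branches[of v "T x" "\<lambda>_. {}"])
      show "\<exists>w. w \<noteq> [] \<and> v @ w \<in> T x \<and> branches (T x) \<inter> cyl (v @ w) \<inter> {} = {}"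
        if "v \<in> T x" for v
        using T_step[OF that xW] by auto
    qed (use vT T_closed in auto)
    then show ?thesis by blast
  qed
  define C where "C v x \<longleftrightarrow> (\<forall>z\<in>branches (T x) \<inter> cyl v. \<forall>z'\<in>branches (T x) \<inter> cyl v. b z = b z')" for v x
  have const: "\<exists>v\<in>T x. C v x" if x: "x \<notin> W" "[] \<in> T x" for x
  proof (rule ccontr)
    assume contra: "\<not> (\<exists>v\<in>T x. C v x)"
    \<comment> \<open>Enumerate the countable set of values of \<open>b\<close> and run away from all of them.\<close>
    define Y where "Y = b ` branches (T x)"
    have "Y \<subseteq> {b z | z. z \<in> F \<and> a z = x}" unfolding Y_def using T_branch by blast
    then have "countable Y" using vert countable_subset by blast
    have "Y \<noteq> {}" using T_extend[OF x(2,1)] unfolding Y_def by blast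
    define y where "y = from_nat_into Y"
    have avoid: "\<exists>w. w \<noteq> [] \<and> v @ w \<in> T x \<and> branches (T x) \<inter> cyl (v @ w) \<inter> {z. b z = y k} = {}"
      if v: "v \<in> T x" for v k
    proof -
      obtain z where z: "z \<in> branches (T x)" "z \<in> cyl v" "b z \<noteq> y k"
      proof -
        have "\<not> C v x" using contra v by blast
        then obtain z1 z2 where "z1 \<in> branches (T x)" "z1 \<in> cyl v" "z2 \<in> branches (T x)" "z2 \<in> cyl v"
          "b z1 \<noteq> b z2" unfolding C_def by blast
        then show thesis using that[of z1] that[of z2] by metis
      qed
      obtain N where N: "cyl (pre (b z) N) \<inter> cyl (pre (y k) N) = {}"
        using separating_pre[OF z(3)] by blast
      obtain n where n: "b ` (F \<inter> cyl (pre z n)) \<subseteq> cyl (pre (b z) N)"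
        using cb T_branch[OF z(1)] by blast
      define m where "m = max n (Suc (length v))"
      obtain w where w: "pre z m = v @ w" using pre_extends[OF z(2), of m] unfolding m_def by (auto simp: le_max_iff_disj)
      have "w \<noteq> []" using arg_cong[OF w, of length] unfolding m_def by auto
      moreover have "v @ w \<in> T x" using z(1) w unfolding branches_def by (metis mem_Collect_eq)
      moreover have "b z' \<noteq> y k" if "z' \<in> branches (T x)" "z' \<in> cyl (v @ w)" for z'
      proof -
        have "n \<le> m" unfolding m_def by simp
        then have "z' \<in> cyl (pre z n)"
          using that(2) cyl_pre_antimono[of n m z] unfolding w by blast
        then have "b z' \<in> cyl (pre (b z) N)" using n T_branch[OF that(1)] by blast
        then show ?thesis using N pre_in_cyl[of "y k" N] by auto
      qed
      ultimately show ?thesis by blast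
    qed
    obtain z where z: "z \<in> branches (T x)" "\<And>k. b z \<noteq> y k"
    proof (rule baire_branches[of "[]" "T x" "\<lambda>k. {z. b z = y k}"])
      show "[] \<in> T x" by (rule x(2))
      show "v \<in> T x" if "v @ w \<in> T x" for v w using that by (rule T_closed)
      show "\<exists>w. w \<noteq> [] \<and> v @ w \<in> T x \<and> branches (T x) \<inter> cyl (v @ w) \<inter> {z. b z = y k} = {}"
        if "v \<in> T x" for k v using that by (rule avoid)
    qed auto
    have "b z \<in> Y" using z(1) unfolding Y_def by blast
    then show False
      using z(2) range_from_nat_into[OF \<open>Y \<noteq> {}\<close> \<open>countable Y\<close>] unfolding y_def by (metis imageE)
  qed
  define S where "S v = {x. x \<notin> W \<and> v \<in> T x \<and> C v x}" for v
  obtain s0 where s0: "cyl s0 \<subseteq> H []" using hull_somewhere_full[OF P0] by auto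
  have "\<exists>v. \<not> meagre (S v \<inter> cyl s0)"
  proof (rule ccontr)
    assume "\<nexists>v. \<not> meagre (S v \<inter> cyl s0)"
    then have "meagre (\<Union>v. S v \<inter> cyl s0)" by (intro countably_covered_UN) auto
    then have "meagre (W \<union> (\<Union>v. S v \<inter> cyl s0))" using \<open>meagre W\<close> by (rule countably_covered_Un[rotated])
    moreover have "cyl s0 \<subseteq> W \<union> (\<Union>v. S v \<inter> cyl s0)"
      using const s0 unfolding S_def T_def by blast
    ultimately show False using cyl_not_meagre countably_covered_subset by blast
  qed
  then obtain v where v: "\<not> meagre (S v \<inter> cyl s0)" by blast
  then obtain w0 where w0: "\<And>w. \<not> meagre (S v \<inter> cyl (s0 @ w0 @ w))"
    using meagre_local[of "S v" s0] by metis
  define s where "s = s0 @ w0"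
  have s: "\<not> meagre (S v \<inter> cyl (s @ w))" for w
    using w0[of w] unfolding s_def by simp
  have "S v \<inter> cyl s \<noteq> {}" using s[of "[]"] by (metis append_Nil2 countably_covered_empty)
  then obtain x0 where x0: "x0 \<in> H v" "x0 \<in> cyl s" unfolding S_def T_def by auto
  then have Psv: "P s v" using cyl_pre_length[OF x0(2)] unfolding H_def by (metis mem_Collect_eq)
  \<comment> \<open>What remains of the part over \<open>s\<close> and \<open>v\<close> after removing all tame pieces. If it were
    not thin at \<open>y\<close>, then for almost all \<open>x\<close> near \<open>u\<close> the tree \<open>T x\<close> would have branches with
    value arbitrarily close to \<open>y\<close>; for \<open>x \<in> S v\<close> the common value would be \<open>y\<close>, which
    happens on a meagre set only.\<close>
  define Q where "Q = {(a z, b z) | z. z \<in> F \<and> z \<in> cyl v \<and> a z \<in> cyl s \<and> z \<in> branches (T (a z))}"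
  have "thin Q"
    unfolding thin_def
  proof (intro allI, rule ccontr)
    fix y u
    assume contra: "\<nexists>w m. cyl (u @ w) \<times> cyl (pre y m) \<inter> Q = {}"
    have "cyl u \<inter> cyl s \<noteq> {}"
    proof
      assume "cyl u \<inter> cyl s = {}"
      then have "cyl (u @ []) \<times> cyl (pre y 0) \<inter> Q = {}" unfolding Q_def by auto
      with contra show False by blast
    qed
    then obtain u' w' where u': "u @ w' = s @ u'"
      using cyl_comparable[of _ u s] by (metis append.right_neutral disjoint_iff)
    define D where "D N = {x. \<exists>w. x \<in> H (v @ w) \<and> b ` (F \<inter> cyl (v @ w)) \<subseteq> cyl (pre y N)}" for N
    have "nowhere_dense (cyl (u @ w') - D N)" for N
      unfolding nowhere_dense_def
    proof
      fix t
      show "\<exists>w. cyl (t @ w) \<inter> (cyl (u @ w') - D N) = {}"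
      proof (cases "cyl t \<inter> cyl (u @ w') = {}")
        case True
        then show ?thesis by (intro exI[of _ "[]"]) auto
      next
        case False
        then obtain t1 t2 where t: "t @ t1 = (u @ w') @ t2"
          using cyl_comparable[of _ t "u @ w'"] by (metis append.right_neutral disjoint_iff)
        obtain x0 y0 where "(x0, y0) \<in> cyl (u @ w' @ t2) \<times> cyl (pre y N) \<inter> Q"
          using contra by (metis all_not_in_conv surj_pair)
        then obtain z where z: "a z \<in> cyl (t @ t1)" "b z \<in> cyl (pre y N)" "z \<in> F" "z \<in> cyl v"
          "z \<in> branches (T (a z))" unfolding Q_def using t by auto
        obtain n where n: "b ` (F \<inter> cyl (pre z n)) \<subseteq> cyl (pre (b z) N)" using cb[OF z(3)] by blast
        define m where "m = max n (length v)"
        obtain w where w: "pre z m = v @ w" using pre_extends[OF z(4), of m] unfolding m_def by (auto simp: le_max_iff_disj)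
        have "b ` (F \<inter> cyl (v @ w)) \<subseteq> cyl (pre y N)"
        proof -
          have "n \<le> m" unfolding m_def by simp
          then have "cyl (v @ w) \<subseteq> cyl (pre z n)" using cyl_pre_antimono[of n m z] w by simp
          moreover have "cyl (pre (b z) N) = cyl (pre y N)" using z(2) by (simp add: cyl_pre_iff)
          ultimately show ?thesis using n by blast
        qed
        moreover
        have "v @ w \<in> T (a z)" using z(5) w unfolding branches_def by (metis mem_Collect_eq)
        then have "P (pre (a z) (length (t @ t1))) (v @ w)" unfolding T_def H_def by blast
        then have "P (t @ t1) (v @ w)" unfolding cyl_pre_length[OF z(1)] .
        then obtain w1 where "cyl ((t @ t1) @ w1) \<subseteq> H (v @ w)" using hull_somewhere_full by blast
        ultimately have "cyl (t @ t1 @ w1) \<subseteq> D N" unfolding D_def by auto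
        then show ?thesis by blast
      qed
    qed
    then have "meagre (\<Union>N. cyl (u @ w') - D N)" by (intro countably_covered_UN_nat countably_covered_self)
    then have "meagre ((\<Union>N. cyl (u @ w') - D N) \<union> {a z | z. z \<in> F \<and> b z = y})"
      using hor by (rule countably_covered_Un)
    moreover have "\<not> meagre (S v \<inter> cyl (u @ w'))" using s u' by simp
    ultimately obtain x where x: "x \<in> S v" "x \<in> cyl (u @ w')" "\<And>N. x \<in> D N"
      "x \<notin> {a z | z. z \<in> F \<and> b z = y}"
      using countably_covered_subset[of nowhere_dense "(\<Union>N. cyl (u @ w') - D N) \<union> {a z | z. z \<in> F \<and> b z = y}" "S v \<inter> cyl (u @ w')"]
      by blast
    have xW: "x \<notin> W" and vT: "v \<in> T x" and Cvx: "C v x" using x(1) unfolding S_def by auto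
    obtain z where z: "z \<in> branches (T x)" "z \<in> cyl v" using T_extend[OF vT xW] by blast
    have "b z \<in> cyl (pre y N)" for N
    proof -
      obtain w where w: "x \<in> H (v @ w)" "b ` (F \<inter> cyl (v @ w)) \<subseteq> cyl (pre y N)"
        using x(3)[of N] unfolding D_def by blast
      obtain z' where z': "z' \<in> branches (T x)" "z' \<in> cyl (v @ w)"
        using T_extend[of "v @ w" x] w(1) xW unfolding T_def by blast
      have "b z' = b z" using Cvx z z' cyl_append_subset[of v w] unfolding C_def by blast
      then show ?thesis using w(2) T_branch[OF z'(1)] z'(2) by auto
    qed
    then have "b z = y" by (rule cyl_eqI)
    then show False using x(4) T_branch[OF z(1)] by blast
  qed
  define J where "J = {(s', v'). \<not> P s' v'}"
  have "tame (\<Union>(s', v')\<in>J. R s' v')"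
    by (rule countably_covered_UN) (auto simp: J_def P_def)
  then have "tame ((\<Union>(s', v')\<in>J. R s' v') \<union> Q)"
    using countably_covered_self[of thin, OF \<open>thin Q\<close>] by (rule countably_covered_Un)
  moreover have "R s v \<subseteq> (\<Union>(s', v')\<in>J. R s' v') \<union> Q"
  proof
    fix p assume "p \<in> R s v"
    then obtain z where z: "z \<in> F" "z \<in> cyl v" "a z \<in> cyl s" "p = (a z, b z)"
      unfolding R_def by auto
    show "p \<in> (\<Union>(s', v')\<in>J. R s' v') \<union> Q"
    proof (cases "z \<in> branches (T (a z))")
      case True
      then show ?thesis using z unfolding Q_def by blast
    next
      case False
      then obtain n m where "\<not> P (pre (a z) m) (pre z n)"
        unfolding branches_def T_def H_def by blast
      then have "(pre (a z) m, pre z n) \<in> J" by (simp add: J_def)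
      moreover have "p \<in> R (pre (a z) m) (pre z n)" unfolding R_def using z by auto
      ultimately show ?thesis by blast
    qed
  qed
  ultimately show False using Psv countably_covered_subset unfolding P_def by blast
qed

section \<open>Thinning Cantor space\<close>

lemma extension_trans: "\<exists>w. c = b @ w \<Longrightarrow> \<exists>w. b = a @ w \<Longrightarrow> \<exists>w. c = a @ (w :: 'k list)"
  by (metis append.assoc)

lemma extension_cyl: "\<exists>w. b = a @ w \<Longrightarrow> cyl b \<subseteq> cyl a"
  using cyl_append_subset by auto

text \<open>Finitely many thin relations can be avoided next to finitely many points at once.\<close>

lemma thin_finite:
  assumes "finite A" and thin: "\<And>k. thin (Q k)"
  shows "\<exists>w m. \<forall>(k, y)\<in>A. cyl (u @ w) \<times> cyl (pre y m) \<inter> Q k = {}"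
  using \<open>finite A\<close>
proof (induction A)
  case (insert p A)
  obtain k y where p: "p = (k, y)" by (cases p)
  obtain w m where wm: "\<forall>(k, y)\<in>A. cyl (u @ w) \<times> cyl (pre y m) \<inter> Q k = {}"
    using insert.IH by blast
  obtain w' m' where wm': "cyl ((u @ w) @ w') \<times> cyl (pre y m') \<inter> Q k = {}"
    using thin[of k] unfolding thin_def by blast
  have "cyl (u @ w @ w') \<times> cyl (pre y' (max m m')) \<inter> Q k' = {}" if "(k', y') \<in> insert p A" for k' y'
  proof (cases "(k', y') = p")
    case True
    have "cyl (pre y (max m m')) \<subseteq> cyl (pre y m')" by (intro cyl_pre_antimono) simp
    then show ?thesis using True wm' p by auto
  next
    case False
    have "cyl (pre y' (max m m')) \<subseteq> cyl (pre y' m)" by (intro cyl_pre_antimono) simp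
    moreover have "cyl (u @ w @ w') \<subseteq> cyl (u @ w)" using cyl_append_subset[of "u @ w" w'] by simp
    moreover have "cyl (u @ w) \<times> cyl (pre y' m) \<inter> Q k' = {}" using wm False that by auto
    ultimately show ?thesis by blast
  qed
  then show ?case by blast
qed simp

text \<open>The elements of \<open>CC\<close> are in bijection with the natural numbers by reading a sequence as a
binary expansion, lowest digit first. The number \<open>binary \<alpha> j\<close> stands for the element of \<open>CC\<close>
that agrees with \<open>\<alpha>\<close> below \<open>j\<close> and vanishes from \<open>j\<close> on.\<close>

definition binary :: "(nat \<Rightarrow> bool) \<Rightarrow> nat \<Rightarrow> nat" where
  "binary \<alpha> j = (\<Sum>i<j. if \<alpha> i then 2 ^ i else 0)"

lemma binary_0 [simp]: "binary \<alpha> 0 = 0"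
  by (simp add: binary_def)

lemma binary_Suc: "binary \<alpha> (Suc j) = binary \<alpha> j + (if \<alpha> j then 2 ^ j else 0)"
  by (simp add: binary_def)

lemma binary_less: "binary \<alpha> j < 2 ^ j"
  by (induction j) (auto simp: binary_Suc)

lemma binary_cong: "pre \<alpha> j = pre \<beta> j \<Longrightarrow> binary \<alpha> j = binary \<beta> j"
  unfolding binary_def by (rule sum.cong) (auto simp: pre_eq_iff)

lemma binary_inj: "binary \<alpha> j = binary \<beta> j \<Longrightarrow> pre \<alpha> j = pre \<beta> j"
proof (induction j)
  case (Suc j)
  have "\<alpha> j = \<beta> j \<and> binary \<alpha> j = binary \<beta> j"
    using Suc.prems binary_less[of \<alpha> j] binary_less[of \<beta> j] by (auto simp: binary_Suc split: if_splits)
  with Suc.IH show ?case by (simp add: pre_Suc)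
qed simp

text \<open>Removal of the leading binary digit.\<close>

definition parent :: "nat \<Rightarrow> nat" where
  "parent m = (SOME c. \<exists>j. c < 2 ^ j \<and> m = c + 2 ^ j)"

lemma parent_eq:
  assumes "c < 2 ^ j" shows "parent (c + 2 ^ j) = c"
proof -
  have "c' = c" if "c' < 2 ^ j'" "c + 2 ^ j = c' + 2 ^ j'" for c' j' :: nat
  proof -
    have "\<not> j < j'"
    proof
      assume "j < j'"
      then have "(2::nat) ^ Suc j \<le> 2 ^ j'" by (intro power_increasing) auto
      then show False using that assms by simp
    qed
    moreover have "\<not> j' < j"
    proof
      assume "j' < j"
      then have "(2::nat) ^ Suc j' \<le> 2 ^ j" by (intro power_increasing) auto
      then show False using that assms by simp
    qed
    ultimately show ?thesis using that by (simp add: nat_neq_iff)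
  qed
  then show ?thesis unfolding parent_def using assms by (intro some_equality) blast+
qed

lemma parent_less: "parent (Suc m) \<le> m"
proof -
  have "\<exists>c j. c < 2 ^ j \<and> Suc m = c + 2 ^ j"
  proof -
    define j where "j = (GREATEST j. 2 ^ j \<le> Suc m)"
    have bound: "j' \<le> Suc m" if "2 ^ j' \<le> Suc m" for j'
      using that less_exp[of j'] by linarith
    have 1: "2 ^ j \<le> Suc m"
      unfolding j_def by (rule GreatestI_nat[where k = 0 and b = "Suc m"]) (use bound in auto)
    have "\<not> 2 ^ Suc j \<le> Suc m"
    proof
      assume "2 ^ Suc j \<le> Suc m"
      then have "Suc j \<le> j"
        unfolding j_def by (rule Greatest_le_nat[where b = "Suc m"]) (rule bound)
      then show False by simp
    qed
    then have "Suc m - 2 ^ j < 2 ^ j" by simp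
    moreover have "Suc m = Suc m - 2 ^ j + 2 ^ j" using 1 by simp
    ultimately show ?thesis by blast
  qed
  then obtain c j where cj: "c < 2 ^ j" "Suc m = c + 2 ^ j" by blast
  have "(1::nat) \<le> 2 ^ j" by simp
  moreover have "parent (Suc m) = c" using parent_eq[OF cj(1)] cj(2) by simp
  ultimately show ?thesis using cj(2) by linarith
qed

text \<open>The bookkeeping of the construction of a copy. Node \<open>n\<close> carries a point \<open>d n\<close> of \<open>D\<close>, which is
chosen at stage \<open>n\<close> and kept forever, and at each stage \<open>m \<ge> n\<close> a neighbourhood \<open>cyl (W m n)\<close> of
it, which shrinks with \<open>m\<close>. The new node \<open>Suc m\<close> is placed in the neighbourhood of its parent. Its
cylinder is found by thinness with respect to all the points present; the old neighbourhoods then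
shrink accordingly.\<close>

lemma thinning_states:
  fixes D :: "(nat \<Rightarrow> bool) set"
  assumes thin: "\<And>k::nat. thin (Q k)"
    and sel: "\<And>E w. finite E \<Longrightarrow> E \<subseteq> D \<Longrightarrow> \<exists>d\<in>D \<inter> cyl (s0 @ w). \<forall>e\<in>E. (d, e) \<notin> K \<and> (e, d) \<notin> K"
  obtains d :: "nat \<Rightarrow> nat \<Rightarrow> bool" and W :: "nat \<Rightarrow> nat \<Rightarrow> bool list" where
    "\<And>n. d n \<in> D" "\<And>m n. n \<le> m \<Longrightarrow> d n \<in> cyl (W m n)"
    "\<And>m n. n \<le> m \<Longrightarrow> \<exists>w. W m n = s0 @ w" "\<And>m n. n \<le> m \<Longrightarrow> m \<le> length (W m n)"
    "\<And>m n. m \<noteq> n \<Longrightarrow> (d m, d n) \<notin> K"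
    "\<And>m n. n \<le> m \<Longrightarrow> \<exists>w. W (Suc m) n = W m n @ w"
    "\<And>m. \<exists>w. W (Suc m) (Suc m) = W m (parent (Suc m)) @ w"
    "\<And>m n k. n \<le> m \<Longrightarrow> k \<le> m \<Longrightarrow> cyl (W (Suc m) (Suc m)) \<times> cyl (W (Suc m) n) \<inter> Q k = {}"
proof -
  define I where "I m st \<longleftrightarrow> (\<forall>n\<le>m. fst (st n) \<in> D \<and> fst (st n) \<in> cyl (snd (st n)) \<and>
      (\<exists>w. snd (st n) = s0 @ w) \<and> m \<le> length (snd (st n)) \<and>
      (\<forall>n'\<le>m. n \<noteq> n' \<longrightarrow> (fst (st n), fst (st n')) \<notin> K))"
    for m :: nat and st :: "nat \<Rightarrow> (nat \<Rightarrow> bool) \<times> bool list"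
  define S where "S m st st' \<longleftrightarrow>
      (\<forall>n\<le>m. fst (st' n) = fst (st n) \<and> (\<exists>w. snd (st' n) = snd (st n) @ w)) \<and>
      (\<exists>w. snd (st' (Suc m)) = snd (st (parent (Suc m))) @ w) \<and>
      (\<forall>n\<le>m. \<forall>k\<le>m. cyl (snd (st' (Suc m))) \<times> cyl (snd (st' n)) \<inter> Q k = {})"
    for m :: nat and st st' :: "nat \<Rightarrow> (nat \<Rightarrow> bool) \<times> bool list"
  have "\<exists>f. \<forall>n. I n (f n) \<and> S n (f n) (f (Suc n))"
  proof (rule dependent_nat_choice)
    obtain d where "d \<in> D" "d \<in> cyl s0" using sel[of "{}" "[]"] by auto
    then have "I 0 (\<lambda>_. (d, s0))" by (simp add: I_def)
    then show "\<exists>st. I 0 st" by blast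
  next
    fix st m assume I: "I m st"
    define p where "p = parent (Suc m)"
    have p: "p \<le> m" unfolding p_def by (rule parent_less)
    define dp where "dp = fst (st p)"
    define u where "u = pre dp (max (Suc m) (length (snd (st p))))"
    have "dp \<in> cyl (snd (st p))" using I p by (simp add: I_def dp_def)
    then have u_ext: "\<exists>w. u = snd (st p) @ w" unfolding u_def by (rule pre_extends) simp
    define A where "A = {..m} \<times> (fst ` st ` {..m})"
    obtain w1 l where wl: "\<forall>(k, y)\<in>A. cyl (u @ w1) \<times> cyl (pre y l) \<inter> Q k = {}"
      using thin_finite[of A Q u] thin unfolding A_def by blast
    obtain w2 where w2: "snd (st p) = s0 @ w2" using I p by (auto simp: I_def)
    obtain w3 where w3: "u = snd (st p) @ w3" using u_ext by blast
    have "finite (fst ` st ` {..m})" "fst ` st ` {..m} \<subseteq> D" using I by (auto simp: I_def)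
    then obtain d where d: "d \<in> D" "d \<in> cyl (u @ w1)"
      "\<And>n. n \<le> m \<Longrightarrow> (d, fst (st n)) \<notin> K \<and> (fst (st n), d) \<notin> K"
      using sel[of "fst ` st ` {..m}" "w2 @ w3 @ w1"] w2 w3 by auto
    define st' where "st' n = (if n = Suc m then (d, u @ w1)
        else (fst (st n), pre (fst (st n)) (max (Suc m) (max l (length (snd (st n)))))))" for n
    have new: "st' (Suc m) = (d, u @ w1)" by (simp add: st'_def)
    have fst_old: "fst (st' n) = fst (st n)" if "n \<le> m" for n using that by (simp add: st'_def)
    have snd_old: "snd (st' n) = pre (fst (st n)) (max (Suc m) (max l (length (snd (st n)))))"
      if "n \<le> m" for n using that by (simp add: st'_def)
    have ext_old: "\<exists>w. snd (st' n) = snd (st n) @ w" if "n \<le> m" for n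
    proof -
      have "fst (st n) \<in> cyl (snd (st n))" using I that by (simp add: I_def)
      then show ?thesis unfolding snd_old[OF that] by (rule pre_extends) simp
    qed
    have "S m st st'"
      unfolding S_def
    proof (intro conjI allI impI)
      fix n assume n: "n \<le> m"
      show "fst (st' n) = fst (st n)" "\<exists>w. snd (st' n) = snd (st n) @ w"
        using n by (rule fst_old, rule ext_old)
    next
      show "\<exists>w. snd (st' (Suc m)) = snd (st (parent (Suc m))) @ w"
        using w3 unfolding new p_def by simp
    next
      fix n k assume nk: "n \<le> m" "k \<le> m"
      have "(k, fst (st n)) \<in> A" using nk unfolding A_def by auto
      then have "cyl (u @ w1) \<times> cyl (pre (fst (st n)) l) \<inter> Q k = {}" using wl by blast
      moreover have "cyl (snd (st' n)) \<subseteq> cyl (pre (fst (st n)) l)"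
        unfolding snd_old[OF nk(1)] by (rule cyl_pre_antimono) simp
      ultimately show "cyl (snd (st' (Suc m))) \<times> cyl (snd (st' n)) \<inter> Q k = {}"
        unfolding new by auto
    qed
    moreover have "I (Suc m) st'"
      unfolding I_def
    proof (intro conjI allI impI)
      fix n assume n: "n \<le> Suc m"
      show "fst (st' n) \<in> D" using n d(1) I by (auto simp: st'_def I_def)
      show "fst (st' n) \<in> cyl (snd (st' n))" using d(2) by (auto simp: st'_def)
      show "\<exists>w. snd (st' n) = s0 @ w"
      proof (cases "n = Suc m")
        case True
        then show ?thesis using new w2 w3 by simp
      next
        case False
        then have "n \<le> m" using n by simp
        then show ?thesis using ext_old[of n] I extension_trans unfolding I_def by metis
      qed
      show "Suc m \<le> length (snd (st' n))" by (auto simp: st'_def u_def intro: trans_le_add1)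
      fix n' assume n': "n' \<le> Suc m" "n \<noteq> n'"
      show "(fst (st' n), fst (st' n')) \<notin> K"
        using n n' d(3) I by (auto simp: st'_def I_def)
    qed
    ultimately show "\<exists>st'. I (Suc m) st' \<and> S m st st'" by blast
  qed
  then obtain f where I: "\<And>n. I n (f n)" and S: "\<And>n. S n (f n) (f (Suc n))" by blast
  define d where "d n = fst (f n n)" for n
  define W where "W m n = snd (f m n)" for m n
  have d_eq: "fst (f m n) = d n" if "n \<le> m" for m n
    using that
  proof (induction rule: dec_induct)
    case (step m)
    then show ?case using S[of m] unfolding S_def by auto
  qed (simp add: d_def)
  show thesis
  proof
    show "d n \<in> D" for n using I[of n] unfolding I_def d_def by blast
    show "d n \<in> cyl (W m n)" if "n \<le> m" for m n
      using I[of m] d_eq[OF that] that unfolding I_def W_def by metis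
    show "\<exists>w. W m n = s0 @ w" if "n \<le> m" for m n using I[of m] that unfolding I_def W_def by blast
    show "m \<le> length (W m n)" if "n \<le> m" for m n using I[of m] that unfolding I_def W_def by blast
    show "(d m, d n) \<notin> K" if "m \<noteq> n" for m n
    proof -
      have "(fst (f (max m n) m), fst (f (max m n) n)) \<notin> K"
        using I[of "max m n"] that unfolding I_def by (metis max.cobounded1 max.cobounded2)
      then show ?thesis by (simp add: d_eq)
    qed
    show "\<exists>w. W (Suc m) n = W m n @ w" if "n \<le> m" for m n using S[of m] that unfolding S_def W_def by blast
    show "\<exists>w. W (Suc m) (Suc m) = W m (parent (Suc m)) @ w" for m using S[of m] unfolding S_def W_def by blast
    show "cyl (W (Suc m) (Suc m)) \<times> cyl (W (Suc m) n) \<inter> Q k = {}" if "n \<le> m" "k \<le> m" for m n k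
      using S[of m] that unfolding S_def W_def by blast
  qed
qed

text \<open>The sequence \<open>\<alpha>\<close> is sent to the limit of the cylinders carried by the nodes \<open>binary \<alpha> j\<close>.
If \<open>\<alpha> \<in> CC\<close>, these nodes are eventually constant, so that the limit is a point of \<open>D\<close>. If
\<open>\<alpha> \<notin> CC\<close>, then infinitely often a fresh node is visited; at that moment the next few of the thin
relations covering \<open>M\<close> are avoided with respect to all the other nodes, hence
with respect to every \<open>\<beta> \<noteq> \<alpha>\<close>.\<close>

lemma thinning:
  fixes D :: "(nat \<Rightarrow> bool) set"
  assumes M: "tame M"
    and sel: "\<And>E w. finite E \<Longrightarrow> E \<subseteq> D \<Longrightarrow> \<exists>d\<in>D \<inter> cyl (s0 @ w). \<forall>e\<in>E. (d, e) \<notin> K \<and> (e, d) \<notin> K"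
  obtains \<psi> :: "(nat \<Rightarrow> bool) \<Rightarrow> nat \<Rightarrow> bool" where
    "\<And>\<alpha> n. \<psi> ` cyl (pre \<alpha> n) \<subseteq> cyl (pre (\<psi> \<alpha>) n)" "range \<psi> \<subseteq> cyl s0"
    "\<psi> ` CC \<subseteq> D" "\<And>\<alpha> \<beta>. \<alpha> \<notin> CC \<Longrightarrow> \<alpha> \<noteq> \<beta> \<Longrightarrow> (\<psi> \<alpha>, \<psi> \<beta>) \<notin> M"
    "\<And>\<alpha> \<beta>. \<alpha> \<in> CC \<Longrightarrow> \<beta> \<in> CC \<Longrightarrow> \<alpha> \<noteq> \<beta> \<Longrightarrow> (\<psi> \<alpha>, \<psi> \<beta>) \<notin> K"
proof -
  obtain Q where Q: "\<And>k::nat. thin (Q k)" "M \<subseteq> (\<Union>k. Q k)" using countably_covered_sequence[OF M thin_empty] by blast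
  obtain d :: "nat \<Rightarrow> nat \<Rightarrow> bool" and W :: "nat \<Rightarrow> nat \<Rightarrow> bool list" where
    dD: "\<And>n. d n \<in> D" and dW: "\<And>m n. n \<le> m \<Longrightarrow> d n \<in> cyl (W m n)"
    and W0: "\<And>m n. n \<le> m \<Longrightarrow> \<exists>w. W m n = s0 @ w" and lenW: "\<And>m n. n \<le> m \<Longrightarrow> m \<le> length (W m n)"
    and dK: "\<And>m n. m \<noteq> n \<Longrightarrow> (d m, d n) \<notin> K"
    and W_Suc: "\<And>m n. n \<le> m \<Longrightarrow> \<exists>w. W (Suc m) n = W m n @ w"
    and W_new: "\<And>m. \<exists>w. W (Suc m) (Suc m) = W m (parent (Suc m)) @ w"
    and W_avoid: "\<And>m n k. n \<le> m \<Longrightarrow> k \<le> m \<Longrightarrow> cyl (W (Suc m) (Suc m)) \<times> cyl (W (Suc m) n) \<inter> Q k = {}"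
    using thinning_states[of Q D s0 K, OF Q(1) sel] by blast
  have W_mono: "\<exists>w. W m' n = W m n @ w" if "n \<le> m" "m \<le> m'" for n m m'
    using that(2)
  proof (induction rule: dec_induct)
    case (step i)
    then show ?case using W_Suc[of n i] that(1) extension_trans by (metis le_trans)
  qed simp
  have W_child: "\<exists>w. W t (c + 2 ^ j) = W t' c @ w"
    if "c < 2 ^ j" "c + 2 ^ j \<le> t" "c \<le> t'" "t' < c + 2 ^ j" for c j t t'
  proof -
    have "c + 2 ^ j = Suc (c + 2 ^ j - 1)" using that(1) by simp
    then have "\<exists>w. W (c + 2 ^ j) (c + 2 ^ j) = W (c + 2 ^ j - 1) c @ w"
      using W_new[of "c + 2 ^ j - 1"] parent_eq[OF that(1)] by metis
    moreover have "\<exists>w. W (c + 2 ^ j - 1) c = W t' c @ w"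
      by (rule W_mono) (use that in auto)
    moreover have "\<exists>w. W t (c + 2 ^ j) = W (c + 2 ^ j) (c + 2 ^ j) @ w"
      by (rule W_mono) (use that in auto)
    ultimately show ?thesis using extension_trans by metis
  qed
  \<comment> \<open>The nodes below \<open>2 ^ j\<close> are exactly those coded by \<open>j\<close> digits, and all of them have been
    created at stage \<open>2 ^ j - 1\<close>.\<close>
  define L where "L \<alpha> j = W (2 ^ j - 1) (binary \<alpha> j)" for \<alpha> j
  have binary_le: "binary \<alpha> j \<le> 2 ^ j - 1" for \<alpha> j using binary_less[of \<alpha> j] by linarith
  have L_Suc: "\<exists>w. L \<alpha> (Suc j) = L \<alpha> j @ w" for \<alpha> j
  proof (cases "\<alpha> j")
    case True
    have "binary \<alpha> j + 2 ^ j \<le> 2 ^ Suc j - 1" using binary_less[of \<alpha> j] by simp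
    then show ?thesis
      unfolding L_def binary_Suc using True binary_less[of \<alpha> j] binary_le[of \<alpha> j] W_child[of "binary \<alpha> j" j "2 ^ Suc j - 1" "2 ^ j - 1"]
      by auto
  next
    case False
    have "(2::nat) ^ j - 1 \<le> 2 ^ Suc j - 1" by simp
    then show ?thesis unfolding L_def binary_Suc using False W_mono binary_le by simp
  qed
  have lenL: "j \<le> length (L \<alpha> j)" for \<alpha> j
  proof -
    have "j \<le> 2 ^ j - 1" using less_exp[of j] by linarith
    then show ?thesis unfolding L_def using lenW[OF binary_le[of \<alpha> j]] by linarith
  qed
  have "\<exists>z. \<forall>j. z \<in> cyl (L \<alpha> j)" for \<alpha>
    using increasing_lists_limit[of "L \<alpha>", OF L_Suc] lenL by (metis Suc_le_eq)
  then obtain \<psi> where \<psi>: "\<And>\<alpha> j. \<psi> \<alpha> \<in> cyl (L \<alpha> j)" by metis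
  have psi_CC: "\<exists>j. \<psi> \<alpha> = d (binary \<alpha> j) \<and> (\<forall>i\<ge>j. binary \<alpha> i = binary \<alpha> j)" if "\<alpha> \<in> CC" for \<alpha>
  proof -
    obtain j where j: "\<And>i. i \<ge> j \<Longrightarrow> \<not> \<alpha> i"
    proof -
      have "finite {n. \<alpha> n}" using \<open>\<alpha> \<in> CC\<close> by (simp add: CC_def)
      then obtain j where "\<forall>i\<in>{n. \<alpha> n}. i < j"
        unfolding finite_nat_set_iff_bounded by (rule exE)
      then show thesis by (intro that[of j]) (auto simp: not_less[symmetric])
    qed
    have const: "binary \<alpha> i = binary \<alpha> j" if "j \<le> i" for i
      using that by (induction rule: dec_induct) (auto simp: binary_Suc j)
    have "\<psi> \<alpha> \<in> cyl (pre (d (binary \<alpha> j)) n)" for n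
    proof -
      define i where "i = max j n"
      have i: "j \<le> i" "n \<le> i" unfolding i_def by auto
      have "d (binary \<alpha> j) \<in> cyl (L \<alpha> i)"
        unfolding L_def const[OF i(1)] by (rule dW) (use binary_le[of \<alpha> i] const[OF i(1)] in simp)
      then have "L \<alpha> i = pre (d (binary \<alpha> j)) (length (L \<alpha> i))" using cyl_pre_length by metis
      moreover have "n \<le> length (L \<alpha> i)" using lenL[of i \<alpha>] i(2) by linarith
      ultimately show ?thesis using \<psi>[of \<alpha> i] cyl_pre_antimono[of n "length (L \<alpha> i)"] by (metis subsetD)
    qed
    then have "\<psi> \<alpha> = d (binary \<alpha> j)" by (rule cyl_eqI)
    with const show ?thesis by blast
  qed
  show thesis
  proof
    show "\<psi> ` cyl (pre \<alpha> n) \<subseteq> cyl (pre (\<psi> \<alpha>) n)" for \<alpha> n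
    proof safe
      fix \<beta> assume "\<beta> \<in> cyl (pre \<alpha> n)"
      then have "L \<beta> n = L \<alpha> n" unfolding L_def using binary_cong[of \<beta> n \<alpha>] by (simp add: cyl_pre_iff)
      then have "pre (\<psi> \<beta>) (length (L \<alpha> n)) = pre (\<psi> \<alpha>) (length (L \<alpha> n))"
        using \<psi>[of \<beta> n] \<psi>[of \<alpha> n] by (simp add: cyl_def)
      then show "\<psi> \<beta> \<in> cyl (pre (\<psi> \<alpha>) n)"
        using lenL[of n \<alpha>] by (auto simp: cyl_pre_iff pre_eq_iff)
    qed
    show "range \<psi> \<subseteq> cyl s0"
    proof
      fix x assume "x \<in> range \<psi>"
      then obtain \<alpha> where x: "x = \<psi> \<alpha>" by blast
      have "\<exists>w. L \<alpha> 0 = s0 @ w" unfolding L_def using W0[of 0 0] by simp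
      then show "x \<in> cyl s0" using \<psi>[of \<alpha> 0] x extension_cyl by blast
    qed
    show "\<psi> ` CC \<subseteq> D"
    proof safe
      fix \<alpha> assume "\<alpha> \<in> CC"
      then obtain j where "\<psi> \<alpha> = d (binary \<alpha> j)" using psi_CC by blast
      then show "\<psi> \<alpha> \<in> D" using dD by simp
    qed
    show "(\<psi> \<alpha>, \<psi> \<beta>) \<notin> K" if CC: "\<alpha> \<in> CC" "\<beta> \<in> CC" and "\<alpha> \<noteq> \<beta>" for \<alpha> \<beta>
    proof -
      obtain j where j: "\<psi> \<alpha> = d (binary \<alpha> j)" "\<And>i. i\<ge>j \<Longrightarrow> binary \<alpha> i = binary \<alpha> j" using psi_CC[OF CC(1)] by blast
      obtain k where k: "\<psi> \<beta> = d (binary \<beta> k)" "\<And>i. i\<ge>k \<Longrightarrow> binary \<beta> i = binary \<beta> k" using psi_CC[OF CC(2)] by blast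
      obtain i where i: "\<alpha> i \<noteq> \<beta> i" using \<open>\<alpha> \<noteq> \<beta>\<close> by blast
      define n where "n = max (Suc i) (max j k)"
      have "i < n" by (simp add: n_def)
      then have "pre \<alpha> n \<noteq> pre \<beta> n" using i unfolding pre_eq_iff by blast
      then have "binary \<alpha> n \<noteq> binary \<beta> n" using binary_inj by blast
      moreover have "binary \<alpha> n = binary \<alpha> j" by (rule j(2)) (simp add: n_def)
      moreover have "binary \<beta> n = binary \<beta> k" by (rule k(2)) (simp add: n_def)
      ultimately show ?thesis using dK j(1) k(1) by metis
    qed
    show "(\<psi> \<alpha>, \<psi> \<beta>) \<notin> M" if nCC: "\<alpha> \<notin> CC" and "\<alpha> \<noteq> \<beta>" for \<alpha> \<beta>
    proof
      assume "(\<psi> \<alpha>, \<psi> \<beta>) \<in> M"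
      then obtain k where k: "(\<psi> \<alpha>, \<psi> \<beta>) \<in> Q k" using Q(2) by blast
      obtain i where i: "\<alpha> i \<noteq> \<beta> i" using \<open>\<alpha> \<noteq> \<beta>\<close> by blast
      obtain j where j: "max (Suc i) k \<le> j" "\<alpha> j"
        using nCC unfolding CC_def mem_Collect_eq infinite_nat_iff_unbounded_le by blast
      \<comment> \<open>The fresh node visited by \<open>\<alpha>\<close> at a late digit 1.\<close>
      define m where "m = binary \<alpha> j + 2 ^ j"
      have m: "binary \<alpha> (Suc j) = m" using j(2) by (simp add: binary_Suc m_def)
      have m_pos: "2 ^ j \<le> m" "m = Suc (m - 1)" by (auto simp: m_def)
      have "k \<le> j" using j(1) by simp
      moreover have "j \<le> 2 ^ j - 1" using less_exp[of j] by linarith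
      moreover have "2 ^ j - 1 \<le> m - 1" using m_pos(1) by linarith
      ultimately have km: "k \<le> m - 1" by linarith
      have m_le: "m \<le> 2 ^ Suc j - 1" using binary_le[of \<alpha> "Suc j"] m by simp
      have "\<exists>w. L \<alpha> (Suc j) = W m m @ w" unfolding L_def m by (rule W_mono) (use m_le in auto)
      then have a: "\<psi> \<alpha> \<in> cyl (W m m)" using \<psi>[of \<alpha> "Suc j"] extension_cyl by blast
      have avoid: "\<psi> \<beta> \<notin> cyl (W m n)" if "n < m" for n
      proof -
        have "cyl (W m m) \<times> cyl (W m n) \<inter> Q k = {}"
          using W_avoid[of n "m - 1" k] that km m_pos(2) by (metis less_Suc_eq_le)
        then show ?thesis using a k by blast
      qed
      have "i < Suc j" using j(1) by simp
      then have "pre \<alpha> (Suc j) \<noteq> pre \<beta> (Suc j)" using i unfolding pre_eq_iff by blast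
      then have "binary \<beta> (Suc j) \<noteq> m" using binary_inj m by metis
      \<comment> \<open>If the node of \<open>\<beta>\<close> is younger than \<open>m\<close>, use its parent, which is older.\<close>
      then consider "binary \<beta> (Suc j) < m" | "binary \<beta> (Suc j) > m" by linarith
      then show False
      proof cases
        case 1
        have "\<exists>w. L \<beta> (Suc j) = W m (binary \<beta> (Suc j)) @ w"
          unfolding L_def by (rule W_mono) (use 1 m_le in auto)
        then have "\<psi> \<beta> \<in> cyl (W m (binary \<beta> (Suc j)))" using \<psi>[of \<beta> "Suc j"] extension_cyl by blast
        then show False using avoid 1 by blast
      next
        case 2
        have "\<beta> j"
        proof (rule ccontr)
          assume "\<not> \<beta> j"
          then have "binary \<beta> (Suc j) < 2 ^ j" using binary_less[of \<beta> j] by (simp add: binary_Suc)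
          then show False using 2 m_pos(1) by linarith
        qed
        then have c: "binary \<beta> (Suc j) = binary \<beta> j + 2 ^ j" by (simp add: binary_Suc)
        have lt: "binary \<beta> j < m" using binary_less[of \<beta> j] m_pos(1) by linarith
        have "\<exists>w. L \<beta> (Suc j) = W m (binary \<beta> j) @ w"
          unfolding L_def c
          by (rule W_child) (use binary_less[of \<beta> j] binary_le[of \<beta> "Suc j"] c lt 2 in auto)
        then have "\<psi> \<beta> \<in> cyl (W m (binary \<beta> j))" using \<psi>[of \<beta> "Suc j"] extension_cyl by blast
        then show False using avoid lt by blast
      qed
    qed
  qed
qed

section \<open>Continuous images of closed subsets of Baire space\<close>

definition seqtop :: "(nat \<Rightarrow> 'k) topology" where
  "seqtop = product_topology (\<lambda>_. discrete_topology UNIV) UNIV"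

lemma cantor_eq_seqtop: "cantor = seqtop"
  by (simp add: cantor_def seqtop_def)

lemma topspace_seqtop [simp]: "topspace seqtop = UNIV"
  by (simp add: seqtop_def)

lemma topspace_cantor [simp]: "topspace cantor = UNIV"
  by (simp add: cantor_eq_seqtop)

lemma openin_seqtop:
  fixes U :: "(nat \<Rightarrow> 'k) set"
  shows "openin seqtop U \<longleftrightarrow> (\<forall>x\<in>U. \<exists>n. cyl (pre x n) \<subseteq> U)"
proof
  assume U: "openin seqtop U"
  show "\<forall>x\<in>U. \<exists>n. cyl (pre x n) \<subseteq> U"
  proof
    fix x assume "x \<in> U"
    then obtain X where X: "x \<in> Pi\<^sub>E UNIV X" "finite {i. X i \<noteq> UNIV}" "Pi\<^sub>E UNIV X \<subseteq> U"
      using product_topology_open_contains_basis[OF U[unfolded seqtop_def], of x] by auto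
    obtain n where n: "\<And>i. X i \<noteq> UNIV \<Longrightarrow> i < n"
      using X(2) unfolding finite_nat_set_iff_bounded by auto
    have "y \<in> Pi\<^sub>E UNIV X" if "y \<in> cyl (pre x n)" for y
    proof -
      have "y i \<in> X i" for i
      proof (cases "i < n")
        case True
        then have "y i = x i" using that by (simp add: cyl_pre_iff pre_eq_iff)
        then show ?thesis using X(1) by auto
      next
        case False
        then have "X i = UNIV" using n by blast
        then show ?thesis by simp
      qed
      then show ?thesis by auto
    qed
    then show "\<exists>n. cyl (pre x n) \<subseteq> U" using X(3) by blast
  qed
next
  assume U: "\<forall>x\<in>U. \<exists>n. cyl (pre x n) \<subseteq> U"
  have cyl_open: "openin seqtop (cyl u)" for u :: "'k list"
  proof -
    have "openin seqtop {x. x i = c}" for i and c :: 'k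
    proof -
      have "openin seqtop {x \<in> topspace seqtop. x i \<in> {c}}"
        unfolding seqtop_def
        by (rule openin_continuous_map_preimage[OF continuous_map_product_projection]) auto
      then show ?thesis by simp
    qed
    then have "openin seqtop ((\<Inter>i\<in>{..<length u}. {x. x i = u ! i}) \<inter> topspace seqtop)"
      by (intro openin_INT) auto
    moreover have "(\<Inter>i\<in>{..<length u}. {x. x i = u ! i}) \<inter> topspace seqtop = cyl u"
      by (auto simp: cyl_iff_nth)
    ultimately show ?thesis by simp
  qed
  show "openin seqtop U"
    by (subst openin_subopen) (meson U cyl_open pre_in_cyl)
qed

text \<open>Continuity on the subspace \<open>F\<close> of a sequence space, in terms of cylinders.\<close>

definition cont_on :: "(nat \<Rightarrow> 'k) set \<Rightarrow> 'a topology \<Rightarrow> ((nat \<Rightarrow> 'k) \<Rightarrow> 'a) \<Rightarrow> bool" where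
  "cont_on F T f \<longleftrightarrow> (\<forall>z\<in>F. f z \<in> topspace T \<and>
     (\<forall>V. openin T V \<longrightarrow> f z \<in> V \<longrightarrow> (\<exists>n. f ` (F \<inter> cyl (pre z n)) \<subseteq> V)))"

lemma cont_onD:
  assumes "cont_on F T f" "z \<in> F" "openin T V" "f z \<in> V"
  obtains n where "\<And>x. x \<in> F \<Longrightarrow> pre x n = pre z n \<Longrightarrow> f x \<in> V"
proof -
  obtain n where "f ` (F \<inter> cyl (pre z n)) \<subseteq> V" using assms unfolding cont_on_def by blast
  then show thesis by (intro that[of n]) (auto simp: cyl_pre_iff)
qed

lemma cont_onI:
  assumes "\<And>z. z \<in> F \<Longrightarrow> f z \<in> topspace T"
    and "\<And>z V. z \<in> F \<Longrightarrow> openin T V \<Longrightarrow> f z \<in> V \<Longrightarrow> \<exists>n. \<forall>x\<in>F. pre x n = pre z n \<longrightarrow> f x \<in> V"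
  shows "cont_on F T f"
  unfolding cont_on_def
proof (intro ballI conjI allI impI)
  fix z V assume "z \<in> F" "openin T V" "f z \<in> V"
  then obtain n where "\<forall>x\<in>F. pre x n = pre z n \<longrightarrow> f x \<in> V" using assms(2) by blast
  then show "\<exists>n. f ` (F \<inter> cyl (pre z n)) \<subseteq> V" by (intro exI[of _ n]) (auto simp: cyl_pre_iff)
qed (use assms(1) in auto)

lemma cont_on_topspace: "cont_on F T f \<Longrightarrow> z \<in> F \<Longrightarrow> f z \<in> topspace T"
  by (simp add: cont_on_def)

lemma continuous_map_seqtop: "continuous_map seqtop T f \<longleftrightarrow> cont_on UNIV T f"
proof
  assume f: "continuous_map seqtop T f"
  show "cont_on UNIV T f"
  proof (rule cont_onI)
    fix z V assume V: "openin T V" "f z \<in> V"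
    have "openin seqtop {x. f x \<in> V}" using openin_continuous_map_preimage[OF f V(1)] by simp
    then obtain n where "cyl (pre z n) \<subseteq> {x. f x \<in> V}" unfolding openin_seqtop using V(2) by blast
    then show "\<exists>n. \<forall>x\<in>UNIV. pre x n = pre z n \<longrightarrow> f x \<in> V"
      by (intro exI[of _ n]) (auto simp: cyl_pre_iff)
  qed (use continuous_map_funspace[OF f] in auto)
next
  assume f: "cont_on UNIV T f"
  show "continuous_map seqtop T f"
    unfolding continuous_map_def openin_seqtop
  proof (intro conjI allI impI ballI)
    fix V x assume V: "openin T V" "x \<in> {x \<in> topspace seqtop. f x \<in> V}"
    then obtain n where "\<And>y. pre y n = pre x n \<Longrightarrow> f y \<in> V" using cont_onD[OF f, of x V] by auto
    then show "\<exists>n. cyl (pre x n) \<subseteq> {x \<in> topspace seqtop. f x \<in> V}"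
      by (intro exI[of _ n]) (auto simp: cyl_pre_iff)
  qed (use f cont_on_topspace in auto)
qed

lemma seqclosedD: "seqclosed F \<Longrightarrow> (\<And>n. \<exists>x\<in>F. pre x n = pre z n) \<Longrightarrow> z \<in> F"
  unfolding seqclosed_def cyl_def by (metis (mono_tags, lifting) Int_iff emptyE length_pre mem_Collect_eq)

lemma seqclosedI: "(\<And>z. (\<And>n. \<exists>x\<in>F. pre x n = pre z n) \<Longrightarrow> z \<in> F) \<Longrightarrow> seqclosed F"
  unfolding seqclosed_def cyl_def by (metis (mono_tags, lifting) Int_emptyI length_pre mem_Collect_eq)

text \<open>The analytic sets, with a fixed type for the parameter space. Closed subsets of Baire space
are used instead of all of Baire space so that the empty set is covered and
intersections can be formed by imposing closed conditions.\<close>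

definition baire_image :: "'a topology \<Rightarrow> 'a set \<Rightarrow> bool" where
  "baire_image T B \<longleftrightarrow> (\<exists>(F :: (nat \<Rightarrow> nat) set) f. seqclosed F \<and> cont_on F T f \<and> f ` F = B)"

lemma cont_on_subset: "cont_on F T f \<Longrightarrow> G \<subseteq> F \<Longrightarrow> cont_on G T f"
proof -
  assume f: "cont_on F T f" and sub: "G \<subseteq> F"
  show ?thesis
  proof (rule cont_onI)
    fix z assume "z \<in> G"
    then have z: "z \<in> F" using sub by blast
    show "f z \<in> topspace T" using cont_on_topspace[OF f z] .
    fix V assume "openin T V" "f z \<in> V"
    then obtain n where "\<And>x. x \<in> F \<Longrightarrow> pre x n = pre z n \<Longrightarrow> f x \<in> V" using cont_onD[OF f z] by metis
    then show "\<exists>n. \<forall>x\<in>G. pre x n = pre z n \<longrightarrow> f x \<in> V" using sub by (intro exI[of _ n]) auto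
  qed
qed

lemma cont_on_compose:
  assumes f: "cont_on F T f" and g: "continuous_map T T' g" shows "cont_on F T' (g \<circ> f)"
proof (rule cont_onI)
  fix z assume "z \<in> F"
  then show "(g \<circ> f) z \<in> topspace T'" using cont_on_topspace[OF f] continuous_map_funspace[OF g] by auto
next
  fix z V assume z: "z \<in> F" and V: "openin T' V" "(g \<circ> f) z \<in> V"
  have "openin T {x \<in> topspace T. g x \<in> V}" using openin_continuous_map_preimage[OF g V(1)] .
  moreover have "f z \<in> {x \<in> topspace T. g x \<in> V}" using V(2) cont_on_topspace[OF f z] by simp
  ultimately obtain n where "\<And>x. x \<in> F \<Longrightarrow> pre x n = pre z n \<Longrightarrow> f x \<in> {x \<in> topspace T. g x \<in> V}"
    using cont_onD[OF f z] by blast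
  then show "\<exists>n. \<forall>x\<in>F. pre x n = pre z n \<longrightarrow> (g \<circ> f) x \<in> V" by (intro exI[of _ n]) auto
qed

lemma baire_image_map:
  assumes "baire_image T B" "continuous_map T T' g" shows "baire_image T' (g ` B)"
proof -
  obtain F :: "(nat \<Rightarrow> nat) set" and f where "seqclosed F" "cont_on F T f" "f ` F = B"
    using assms(1) unfolding baire_image_def by blast
  then show ?thesis
    unfolding baire_image_def using cont_on_compose[OF _ assms(2)] by (metis image_comp)
qed

lemma baire_image_closed:
  assumes B: "baire_image T B" and C: "closedin T C" shows "baire_image T (B \<inter> C)"
proof -
  obtain F :: "(nat \<Rightarrow> nat) set" and f where F: "seqclosed F" and f: "cont_on F T f" and B: "f ` F = B"
    using B unfolding baire_image_def by blast
  define F' where "F' = {z \<in> F. f z \<in> C}"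
  have "seqclosed F'"
  proof (rule seqclosedI)
    fix z assume z: "\<And>n. \<exists>x\<in>F'. pre x n = pre z n"
    have zF: "z \<in> F" by (rule seqclosedD[OF F]) (use z in \<open>auto simp: F'_def\<close>)
    have "f z \<in> C"
    proof (rule ccontr)
      assume "f z \<notin> C"
      then have "f z \<in> topspace T - C" using cont_on_topspace[OF f zF] by simp
      moreover have "openin T (topspace T - C)" using C by blast
      ultimately obtain n where "\<And>x. x \<in> F \<Longrightarrow> pre x n = pre z n \<Longrightarrow> f x \<in> topspace T - C"
        using cont_onD[OF f zF] by blast
      then show False using z[of n] unfolding F'_def by blast
    qed
    with zF show "z \<in> F'" by (simp add: F'_def)
  qed
  moreover have "cont_on F' T f" by (rule cont_on_subset[OF f]) (auto simp: F'_def)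
  moreover have "f ` F' = B \<inter> C" using B unfolding F'_def by blast
  ultimately show ?thesis unfolding baire_image_def by blast
qed

lemma pre_Suc_shift: "pre x (Suc n) = pre z (Suc n) \<longleftrightarrow> x 0 = z 0 \<and> pre (x \<circ> Suc) n = pre (z \<circ> Suc) n"
  unfolding pre_eq_iff by (simp add: All_less_Suc2)

text \<open>The first entry of the parameter selects the set of the family.\<close>

lemma baire_image_UN:
  assumes "\<And>k::nat. baire_image T (B k)" shows "baire_image T (\<Union>k. B k)"
proof -
  have "\<forall>k. \<exists>p :: (nat \<Rightarrow> nat) set \<times> _. seqclosed (fst p) \<and> cont_on (fst p) T (snd p) \<and> snd p ` fst p = B k"
    using assms unfolding baire_image_def by auto
  then obtain p :: "nat \<Rightarrow> (nat \<Rightarrow> nat) set \<times> _" where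
    p: "\<And>k. seqclosed (fst (p k)) \<and> cont_on (fst (p k)) T (snd (p k)) \<and> snd (p k) ` fst (p k) = B k" by metis
  define F where "F k = fst (p k)" for k
  define f where "f k = snd (p k)" for k
  have F: "\<And>k. seqclosed (F k)" and f: "\<And>k. cont_on (F k) T (f k)" and B: "\<And>k. f k ` F k = B k"
    using p by (auto simp: F_def f_def)
  define G where "G = {x :: nat \<Rightarrow> nat. x \<circ> Suc \<in> F (x 0)}"
  define g where "g x = f (x 0) (x \<circ> Suc)" for x
  have "seqclosed G"
  proof (rule seqclosedI)
    fix z assume z: "\<And>n. \<exists>x\<in>G. pre x n = pre z n"
    have "z \<circ> Suc \<in> F (z 0)"
    proof (rule seqclosedD[OF F])
      fix n
      show "\<exists>x\<in>F (z 0). pre x n = pre (z \<circ> Suc) n"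
        using z[of "Suc n"] unfolding G_def pre_Suc_shift by force
    qed
    then show "z \<in> G" by (simp add: G_def)
  qed
  moreover have "cont_on G T g"
  proof (rule cont_onI)
    fix z assume z: "z \<in> G"
    then have zF: "z \<circ> Suc \<in> F (z 0)" by (simp add: G_def)
    show "g z \<in> topspace T" unfolding g_def by (rule cont_on_topspace[OF f zF])
    fix V assume "openin T V" "g z \<in> V"
    then obtain n where n: "\<And>x. x \<in> F (z 0) \<Longrightarrow> pre x n = pre (z \<circ> Suc) n \<Longrightarrow> f (z 0) x \<in> V"
      using cont_onD[OF f zF] unfolding g_def by blast
    show "\<exists>n. \<forall>x\<in>G. pre x n = pre z n \<longrightarrow> g x \<in> V"
    proof (intro exI[of _ "Suc n"] ballI impI)
      fix x assume "x \<in> G" "pre x (Suc n) = pre z (Suc n)"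
      then show "g x \<in> V" using n[of "x \<circ> Suc"] unfolding pre_Suc_shift G_def g_def by simp
    qed
  qed
  moreover have "g ` G = (\<Union>k. B k)"
  proof (rule set_eqI, rule iffI)
    fix y assume "y \<in> g ` G"
    then show "y \<in> (\<Union>k. B k)" using B unfolding G_def g_def by blast
  next
    fix y assume "y \<in> (\<Union>k. B k)"
    then obtain k x where x: "x \<in> F k" "y = f k x" using B by blast
    define z where "z = case_nat k x"
    have "z 0 = k" "z \<circ> Suc = x" by (auto simp: z_def)
    then have "z \<in> G" "g z = y" using x by (auto simp: G_def g_def)
    then show "y \<in> g ` G" by blast
  qed
  ultimately show ?thesis unfolding baire_image_def by blast
qed

text \<open>One sequence codes a sequence of sequences by means of a pairing function.\<close>

definition column :: "(nat \<Rightarrow> nat) \<Rightarrow> nat \<Rightarrow> nat \<Rightarrow> nat" where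
  "column z k i = z (prod_encode (k, i))"

lemma column_pre: "\<exists>m. \<forall>m'\<ge>m. \<forall>x. pre x m' = pre z m' \<longrightarrow> pre (column x k) n = pre (column z k) n"
proof -
  have "finite ((\<lambda>i. prod_encode (k, i)) ` {..<n})" by simp
  then obtain m where m: "\<And>i. i < n \<Longrightarrow> prod_encode (k, i) < m"
    unfolding finite_nat_set_iff_bounded by auto
  show ?thesis
    by (rule exI[of _ m]) (use m in \<open>fastforce simp: pre_eq_iff column_def\<close>)
qed

lemma column_surj: "\<exists>z. \<forall>k. column z k = x k"
  by (rule exI[of _ "\<lambda>n. case prod_decode n of (k, i) \<Rightarrow> x k i"]) (auto simp: column_def)

lemma column_closed:
  assumes "seqclosed F" and z: "\<And>n. \<exists>x. column x k \<in> F \<and> pre x n = pre z n"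
  shows "column z k \<in> F"
proof (rule seqclosedD[OF assms(1)])
  fix n
  obtain m where m: "\<forall>m'\<ge>m. \<forall>x. pre x m' = pre z m' \<longrightarrow> pre (column x k) n = pre (column z k) n"
    using column_pre by blast
  then show "\<exists>x\<in>F. pre x n = pre (column z k) n" using z[of m] by blast
qed

lemma cont_on_column:
  assumes f: "cont_on F T f" shows "cont_on {z. column z k \<in> F} T (\<lambda>z. f (column z k))"
proof (rule cont_onI)
  fix z assume z: "z \<in> {z. column z k \<in> F}"
  then show "f (column z k) \<in> topspace T" using cont_on_topspace[OF f] by simp
  fix V assume "openin T V" "f (column z k) \<in> V"
  then obtain n where n: "\<And>x. x \<in> F \<Longrightarrow> pre x n = pre (column z k) n \<Longrightarrow> f x \<in> V"
    using cont_onD[OF f, of "column z k" V] z by blast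
  obtain m where "\<forall>m'\<ge>m. \<forall>x. pre x m' = pre z m' \<longrightarrow> pre (column x k) n = pre (column z k) n"
    using column_pre by blast
  then show "\<exists>n. \<forall>x\<in>{z. column z k \<in> F}. pre x n = pre z n \<longrightarrow> f (column x k) \<in> V"
    by (intro exI[of _ m]) (use n in auto)
qed

text \<open>A parameter for the intersection consists of parameters for all the sets that
have the same image; in a Hausdorff space this is a closed condition.\<close>

lemma baire_image_INT:
  assumes haus: "Hausdorff_space T" and "\<And>k::nat. baire_image T (B k)"
  shows "baire_image T (\<Inter>k. B k)"
proof -
  have "\<forall>k. \<exists>p :: (nat \<Rightarrow> nat) set \<times> _. seqclosed (fst p) \<and> cont_on (fst p) T (snd p) \<and> snd p ` fst p = B k"
    using assms unfolding baire_image_def by auto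
  then obtain p :: "nat \<Rightarrow> (nat \<Rightarrow> nat) set \<times> _" where
    p: "\<And>k. seqclosed (fst (p k)) \<and> cont_on (fst (p k)) T (snd (p k)) \<and> snd (p k) ` fst (p k) = B k" by metis
  define F where "F k = fst (p k)" for k
  define f where "f k = snd (p k)" for k
  have F: "\<And>k. seqclosed (F k)" and f: "\<And>k. cont_on (F k) T (f k)" and B: "\<And>k. f k ` F k = B k"
    using p by (auto simp: F_def f_def)
  define G where "G = {z. (\<forall>k. column z k \<in> F k) \<and> (\<forall>k. f k (column z k) = f 0 (column z 0))}"
  define g where "g z = f 0 (column z 0)" for z
  have "seqclosed G"
  proof (rule seqclosedI)
    fix z assume z: "\<And>n. \<exists>x\<in>G. pre x n = pre z n"
    have zF: "column z k \<in> F k" for k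
      by (rule column_closed[OF F]) (use z in \<open>unfold G_def, blast\<close>)
    have "f k (column z k) = f 0 (column z 0)" for k
    proof (rule ccontr)
      assume "f k (column z k) \<noteq> f 0 (column z 0)"
      moreover have "f k (column z k) \<in> topspace T" "f 0 (column z 0) \<in> topspace T"
        using cont_on_topspace[OF f zF] by auto
      ultimately obtain U V where UV: "openin T U" "openin T V" "f k (column z k) \<in> U" "f 0 (column z 0) \<in> V" "disjnt U V"
        using haus unfolding Hausdorff_space_def by blast
      obtain n1 where n1: "\<And>x. x \<in> {z. column z k \<in> F k} \<Longrightarrow> pre x n1 = pre z n1 \<Longrightarrow> f k (column x k) \<in> U"
        using cont_onD[OF cont_on_column[OF f] _ UV(1), of z k k] zF UV(3) by blast
      obtain n2 where n2: "\<And>x. x \<in> {z. column z 0 \<in> F 0} \<Longrightarrow> pre x n2 = pre z n2 \<Longrightarrow> f 0 (column x 0) \<in> V"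
        using cont_onD[OF cont_on_column[OF f] _ UV(2), of z 0 0] zF UV(4) by blast
      obtain x where x: "x \<in> G" "pre x (max n1 n2) = pre z (max n1 n2)" using z by blast
      then have "pre x n1 = pre z n1" "pre x n2 = pre z n2" by (auto simp: pre_eq_iff)
      then have "f k (column x k) \<in> U" "f 0 (column x 0) \<in> V" using n1 n2 x(1) by (auto simp: G_def)
      moreover have "f k (column x k) = f 0 (column x 0)" using x(1) by (simp add: G_def)
      ultimately show False using UV(5) by (simp add: disjnt_iff)
    qed
    with zF show "z \<in> G" by (simp add: G_def)
  qed
  moreover have "cont_on G T g"
    unfolding g_def by (rule cont_on_subset[OF cont_on_column[OF f[of 0], of 0]]) (auto simp: G_def)
  moreover have "g ` G = (\<Inter>k. B k)"
  proof (rule set_eqI, rule iffI)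
    fix y assume "y \<in> g ` G"
    then obtain z where z: "z \<in> G" "y = f 0 (column z 0)" unfolding g_def by blast
    have "y \<in> B k" for k
    proof -
      have "f k (column z k) = f 0 (column z 0)" "column z k \<in> F k" using z(1) unfolding G_def by blast+
      then show ?thesis using B[of k] z(2) by (metis imageI)
    qed
    then show "y \<in> (\<Inter>k. B k)" by blast
  next
    fix y assume "y \<in> (\<Inter>k. B k)"
    then have "\<forall>k. y \<in> f k ` F k" unfolding B by simp
    then have "\<forall>k. \<exists>x\<in>F k. f k x = y" by (metis imageE)
    then obtain x where x: "\<And>k. x k \<in> F k" "\<And>k. f k (x k) = y" by metis
    obtain z where z: "\<And>k. column z k = x k" using column_surj by metis
    then have "z \<in> G" "g z = y" using x by (auto simp: G_def g_def)
    then show "y \<in> g ` G" by blast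
  qed
  ultimately show ?thesis unfolding baire_image_def by blast
qed

lemma baire_image_prod:
  assumes "baire_image T B" "baire_image T' B'"
  shows "baire_image (prod_topology T T') (B \<times> B')"
proof -
  obtain F :: "(nat \<Rightarrow> nat) set" and f where F: "seqclosed F" and f: "cont_on F T f" and B: "f ` F = B"
    using assms(1) unfolding baire_image_def by blast
  obtain F' :: "(nat \<Rightarrow> nat) set" and f' where F': "seqclosed F'" and f': "cont_on F' T' f'" and B': "f' ` F' = B'"
    using assms(2) unfolding baire_image_def by blast
  define G where "G = {z. column z 0 \<in> F \<and> column z 1 \<in> F'}"
  define g where "g z = (f (column z 0), f' (column z 1))" for z
  have "seqclosed G"
  proof (rule seqclosedI)
    fix z assume z: "\<And>n. \<exists>x\<in>G. pre x n = pre z n"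
    have "column z 0 \<in> F" by (rule column_closed[OF F]) (use z in \<open>unfold G_def, blast\<close>)
    moreover have "column z 1 \<in> F'" by (rule column_closed[OF F']) (use z in \<open>unfold G_def, blast\<close>)
    ultimately show "z \<in> G" by (simp add: G_def)
  qed
  moreover have "cont_on G (prod_topology T T') g"
  proof (rule cont_onI)
    fix z assume z: "z \<in> G"
    then show "g z \<in> topspace (prod_topology T T')"
      using cont_on_topspace[OF f] cont_on_topspace[OF f'] by (simp add: G_def g_def)
    fix V assume V: "openin (prod_topology T T') V" "g z \<in> V"
    have "\<forall>x y. (x, y) \<in> V \<longrightarrow> (\<exists>U U'. openin T U \<and> openin T' U' \<and> x \<in> U \<and> y \<in> U' \<and> U \<times> U' \<subseteq> V)"
      using V(1) by (simp only: openin_prod_topology_alt)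
    then obtain U U' where U: "openin T U" "openin T' U'" "f (column z 0) \<in> U" "f' (column z 1) \<in> U'" "U \<times> U' \<subseteq> V"
      using V(2) unfolding g_def by meson
    obtain n1 where n1: "\<And>x. x \<in> {z. column z 0 \<in> F} \<Longrightarrow> pre x n1 = pre z n1 \<Longrightarrow> f (column x 0) \<in> U"
      using cont_onD[OF cont_on_column[OF f, of 0] _ U(1), of z] z U(3) unfolding G_def by blast
    obtain n2 where n2: "\<And>x. x \<in> {z. column z 1 \<in> F'} \<Longrightarrow> pre x n2 = pre z n2 \<Longrightarrow> f' (column x 1) \<in> U'"
      using cont_onD[OF cont_on_column[OF f', of 1] _ U(2), of z] z U(4) unfolding G_def by blast
    show "\<exists>n. \<forall>x\<in>G. pre x n = pre z n \<longrightarrow> g x \<in> V"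
    proof (intro exI[of _ "max n1 n2"] ballI impI)
      fix x assume x: "x \<in> G" "pre x (max n1 n2) = pre z (max n1 n2)"
      then have "pre x n1 = pre z n1" "pre x n2 = pre z n2" by (auto simp: pre_eq_iff)
      then have "f (column x 0) \<in> U" "f' (column x 1) \<in> U'" using n1 n2 x(1) by (auto simp: G_def)
      then show "g x \<in> V" using U(5) by (auto simp: g_def)
    qed
  qed
  moreover have "g ` G = B \<times> B'"
  proof (rule set_eqI, rule iffI)
    fix y assume "y \<in> g ` G"
    then show "y \<in> B \<times> B'" using B B' unfolding G_def g_def by blast
  next
    fix y assume "y \<in> B \<times> B'"
    then obtain a b where ab: "a \<in> F" "b \<in> F'" "y = (f a, f' b)" using B B' by blast
    obtain z where z: "\<And>k. column z k = (if k = 0 then a else b)" using column_surj[of "\<lambda>k. if k = 0 then a else b"] by metis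
    then have "z \<in> G" "g z = y" using ab by (auto simp: G_def g_def)
    then show "y \<in> g ` G" by blast
  qed
  ultimately show ?thesis unfolding baire_image_def by blast
qed

text \<open>The sets that are images together with their complements form a \<open>\<sigma>\<close>-algebra. It contains the open
sets, because open sets of metrizable spaces are $F_\sigma$.\<close>

lemma baire_image_Borel:
  assumes met: "metrizable_space T" and top: "baire_image T (topspace T)" and B: "Borel_in T B"
  shows "baire_image T B"
proof -
  have haus: "Hausdorff_space T" using met by (rule metrizable_imp_Hausdorff_space)
  have closed: "baire_image T C" if "closedin T C" for C
    using baire_image_closed[OF top that] closedin_subset[OF that] by (simp add: Int_absorb1)
  have "B \<in> sigma_sets (topspace T) {U. openin T U}" using B by (simp add: Borel_in_def)
  then have "baire_image T B \<and> baire_image T (topspace T - B)"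
  proof (induction rule: sigma_sets.induct)
    case (Basic U)
    then have U: "openin T U" by simp
    obtain C :: "nat \<Rightarrow> _" where C: "\<And>n. closedin T (C n)" "(\<Union>n. C n) = U"
      using open_imp_fsigma_in[OF met U] unfolding fsigma_in_ascending by auto
    have "baire_image T U" using baire_image_UN[of T C] closed C by auto
    moreover have "baire_image T (topspace T - U)" using closed U by blast
    ultimately show ?case by simp
  next
    case Empty
    then show ?case using closed[of "{}"] top by simp
  next
    case (Compl a)
    have "a \<subseteq> topspace T" using Compl(1) by (intro sigma_sets_into_sp[of "{U. openin T U}"]) (auto dest: openin_subset)
    then show ?case using Compl(2) by (simp add: double_diff)
  next
    case (Union a)
    have "topspace T - (\<Union>i. a i) = (\<Inter>i. topspace T - a i)" by blast
    then show ?case using baire_image_UN[of T a] baire_image_INT[OF haus, of "\<lambda>i. topspace T - a i"] Union by simp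
  qed
  then show ?thesis ..
qed

section \<open>The Hurewicz dichotomy\<close>

text \<open>Remove from \<open>F\<close> all cylinders whose image can be separated from \<open>R\<close> by an $F_\sigma$ set. As \<open>R\<close>
is not $G_\delta$, something remains, and the image of each remaining piece accumulates at points
of \<open>R\<close>. So one can start with a point \<open>p\<close> of \<open>R\<close> and a cylinder \<open>v\<close> whose image accumulates
at \<open>p\<close>, and use the successive digits of \<open>\<alpha>\<close> as instructions: the digit 0 means to stay, and
the digit 1 to move to a smaller cylinder with image very close to \<open>p\<close> and to a point of \<open>R\<close> at
which that image accumulates. If the digit 1 occurs finitely often, the result is a point
of \<open>R\<close>; otherwise it is a value of the given map, so not in \<open>R\<close>.\<close>

lemma hurewicz:
  fixes F :: "(nat \<Rightarrow> nat) set" and T :: "'a topology"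
  assumes met: "metrizable_space T" and F: "seqclosed F" and f: "cont_on F T f"
    and image: "f ` F = topspace T - R" and R: "R \<subseteq> topspace T" "\<not> gdelta_in T R"
  obtains \<phi> where "continuous_map cantor T \<phi>" "\<And>\<alpha>. \<phi> \<alpha> \<in> R \<longleftrightarrow> \<alpha> \<in> CC"
proof -
  obtain M d where "Metric_space M d" and T: "T = Metric_space.mtopology M d"
    using met unfolding metrizable_space_def by blast
  interpret Metric_space M d by fact
  have top: "topspace T = M" by (simp add: T)
  define sep where "sep = countably_covered (\<lambda>C. closedin T C \<and> C \<inter> R = {})"
  define G where "G = {v. sep (f ` (F \<inter> cyl v))}"
  have sepG: "sep (\<Union>v\<in>G. f ` (F \<inter> cyl v))" 
    unfolding sep_def by (rule countably_covered_UN) (auto simp: G_def sep_def)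
  \<comment> \<open>The part of \<open>F\<close> that is nowhere separated from \<open>R\<close>.\<close>
  define F' where "F' = {z \<in> F. \<forall>n. pre z n \<notin> G}"
  have cover: "f ` (F \<inter> B) \<subseteq> (\<Union>v\<in>G. f ` (F \<inter> cyl v)) \<union> f ` (F' \<inter> B)" for B
  proof
    fix y assume "y \<in> f ` (F \<inter> B)"
    then obtain z where z: "z \<in> F" "z \<in> B" "y = f z" by blast
    show "y \<in> (\<Union>v\<in>G. f ` (F \<inter> cyl v)) \<union> f ` (F' \<inter> B)"
    proof (cases "z \<in> F'")
      case True
      then show ?thesis using z by blast
    next
      case False
      then obtain n where "pre z n \<in> G" using z(1) unfolding F'_def by blast
      moreover have "y \<in> f ` (F \<inter> cyl (pre z n))" using z by simp
      ultimately show ?thesis by blast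
    qed
  qed
  have F'closed: "seqclosed F'"
  proof (rule seqclosedI)
    fix z assume z: "\<And>n. \<exists>x\<in>F'. pre x n = pre z n"
    have "z \<in> F" by (rule seqclosedD[OF F]) (use z in \<open>auto simp: F'_def\<close>)
    moreover have "pre z n \<notin> G" for n
    proof -
      obtain x where x: "x \<in> F'" "pre x n = pre z n" using z by blast
      have "pre x n \<notin> G" using x(1) unfolding F'_def by simp
      then show ?thesis using x(2) by simp
    qed
    ultimately show "z \<in> F'" by (simp add: F'_def)
  qed
  define Cl where "Cl v = T closure_of (f ` (F' \<inter> cyl v))" for v
  have Cl_mono: "Cl (v @ w) \<subseteq> Cl v" for v w
    unfolding Cl_def using cyl_append_subset[of v w] by (intro closure_of_mono) blast
  have fM: "f z \<in> M" if "z \<in> F'" for z using cont_on_topspace[OF f, of z] that top by (simp add: F'_def)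
  have fCl: "f z \<in> Cl v" if "z \<in> F'" "z \<in> cyl v" for z v
  proof -
    have "f ` (F' \<inter> cyl v) \<subseteq> topspace T" using fM top by auto
    then show ?thesis unfolding Cl_def using closure_of_subset that by blast
  qed
  have "F' \<noteq> {}"
  proof
    assume "F' = {}"
    then have "f ` F \<subseteq> (\<Union>v\<in>G. f ` (F \<inter> cyl v))" using cover[of UNIV] by simp
    then have "sep (f ` F)" using sepG unfolding sep_def by (rule countably_covered_subset[rotated])
    then obtain \<C> where \<C>: "countable \<C>" "\<forall>C\<in>\<C>. closedin T C \<and> C \<inter> R = {}" "f ` F \<subseteq> \<Union>\<C>"
      unfolding sep_def countably_covered_def by meson
    have "\<Union>\<C> \<subseteq> topspace T - R" using \<C>(2) closedin_subset by blast
    then have "\<Union>\<C> = topspace T - R" using \<C>(3) image by simp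
    then have "fsigma_in T (topspace T - R)"
      unfolding fsigma_in_def union_of_def using \<C>(1,2) by (intro exI[of _ \<C>]) auto
    then show False using R by (simp add: gdelta_in_fsigma_in)
  qed
  have dense: "\<exists>p\<in>R. p \<in> Cl (pre z n)" if z: "z \<in> F'" for z n
  proof (rule ccontr)
    assume "\<not> (\<exists>p\<in>R. p \<in> Cl (pre z n))"
    then have "Cl (pre z n) \<inter> R = {}" by blast
    then have "sep (Cl (pre z n))" unfolding Cl_def sep_def by (intro countably_covered_self) simp
    with sepG have "sep ((\<Union>v\<in>G. f ` (F \<inter> cyl v)) \<union> Cl (pre z n))"
      unfolding sep_def by (rule countably_covered_Un)
    moreover have "f ` (F' \<inter> cyl (pre z n)) \<subseteq> Cl (pre z n)" using fCl by auto
    then have "f ` (F \<inter> cyl (pre z n)) \<subseteq> (\<Union>v\<in>G. f ` (F \<inter> cyl v)) \<union> Cl (pre z n)"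
      using cover[of "cyl (pre z n)"] by (meson Un_mono order_refl order_trans)
    ultimately have "sep (f ` (F \<inter> cyl (pre z n)))" unfolding sep_def by (rule countably_covered_subset)
    then show False using z by (simp add: F'_def G_def)
  qed
  define Inv where "Inv s \<longleftrightarrow> snd s \<in> R \<and> snd s \<in> Cl (fst s)" for s :: "nat list \<times> 'a"
  define Next where "Next n s s' \<longleftrightarrow> Inv s' \<and> (\<exists>w. w \<noteq> [] \<and> fst s' = fst s @ w) \<and>
      (\<forall>x\<in>F' \<inter> cyl (fst s'). d (snd s) (f x) \<le> (1/2) ^ n)" for n and s s' :: "nat list \<times> 'a"
  have "\<exists>s'. Next n s s'" if "Inv s" for n s
  proof -
    obtain v p where s: "s = (v, p)" by (cases s)
    have p: "p \<in> R" "p \<in> Cl v" using that by (auto simp: Inv_def s)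
    have "0 < (1/2 :: real) ^ n" by simp
    then have "\<exists>y\<in>f ` (F' \<inter> cyl v). y \<in> mball p ((1/2) ^ n)"
      using p(2) unfolding Cl_def T metric_closure_of by blast
    then obtain z where z: "z \<in> F'" "z \<in> cyl v" "f z \<in> mball p ((1/2) ^ n)" by blast
    have zF: "z \<in> F" using z(1) by (simp add: F'_def)
    have "openin T (mball p ((1/2) ^ n))" by (simp add: T)
    then obtain m where m: "\<And>x. x \<in> F \<Longrightarrow> pre x m = pre z m \<Longrightarrow> f x \<in> mball p ((1/2) ^ n)"
      using cont_onD[OF f zF _ z(3)] by blast
    define l where "l = max m (Suc (length v))"
    obtain w where w: "pre z l = v @ w" using pre_extends[OF z(2), of l] unfolding l_def by (auto simp: le_max_iff_disj)
    have "length (pre z l) > length v" by (simp add: l_def)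
    then have "w \<noteq> []" unfolding w by auto
    obtain p' where p': "p' \<in> R" "p' \<in> Cl (pre z l)" using dense[OF z(1)] by blast
    have "d p (f x) \<le> (1/2) ^ n" if x: "x \<in> F' \<inter> cyl (pre z l)" for x
    proof -
      have "pre x m = pre z m" using x by (auto simp: cyl_pre_iff pre_eq_iff l_def)
      then have "f x \<in> mball p ((1/2) ^ n)" using m x by (auto simp: F'_def)
      then show ?thesis by simp
    qed
    then have "Next n s (pre z l, p')"
      unfolding Next_def Inv_def s using p' w \<open>w \<noteq> []\<close> by auto
    then show ?thesis by blast
  qed
  then have "\<forall>n s. \<exists>s'. Inv s \<longrightarrow> Next n s s'" by blast
  then obtain nxt where nxt: "\<And>n s. Inv s \<Longrightarrow> Next n s (nxt n s)" by metis
  obtain s0 where s0: "Inv s0"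
  proof -
    obtain z where "z \<in> F'" using \<open>F' \<noteq> {}\<close> by blast
    then obtain p where "p \<in> R" "p \<in> Cl (pre z 0)" using dense by blast
    then show thesis by (intro that[of "([], p)"]) (simp add: Inv_def)
  qed
  define st where "st \<alpha> = rec_nat s0 (\<lambda>n s. if \<alpha> n then nxt n s else s)" for \<alpha> :: "nat \<Rightarrow> bool"
  have st_0: "st \<alpha> 0 = s0" for \<alpha> by (simp add: st_def)
  have st_Suc: "st \<alpha> (Suc n) = (if \<alpha> n then nxt n (st \<alpha> n) else st \<alpha> n)" for \<alpha> n by (simp add: st_def)
  have Inv: "Inv (st \<alpha> n)" for \<alpha> n
    by (induction n) (use s0 nxt in \<open>auto simp: st_0 st_Suc Next_def\<close>)
  have st_cong: "st \<alpha> n = st \<beta> n" if "pre \<alpha> n = pre \<beta> n" for \<alpha> \<beta> n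
    using that by (induction n) (auto simp: st_0 st_Suc pre_Suc)
  have ext: "\<exists>w. fst (st \<alpha> (Suc n)) = fst (st \<alpha> n) @ w" for \<alpha> n
    using nxt[OF Inv[of \<alpha> n], of n] by (auto simp: st_Suc Next_def)
  have Cl_decr: "Cl (fst (st \<alpha> m)) \<subseteq> Cl (fst (st \<alpha> n))" if "n \<le> m" for \<alpha> n m
    using that
  proof (induction rule: dec_induct)
    case (step m)
    then show ?case using ext[of \<alpha> m] Cl_mono by (metis order_trans)
  qed simp
  have const: "st \<alpha> m = st \<alpha> n" if "n \<le> m" "\<And>i. n \<le> i \<Longrightarrow> i < m \<Longrightarrow> \<not> \<alpha> i" for \<alpha> n m
    using that by (induction rule: dec_induct) (auto simp: st_Suc)
  have "\<exists>x. (\<forall>n. x \<in> Cl (fst (st \<alpha> n))) \<and> (x \<in> R \<longleftrightarrow> \<alpha> \<in> CC) \<and>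
      (\<forall>n. (\<forall>i\<ge>n. \<not> \<alpha> i) \<longrightarrow> x = snd (st \<alpha> n))" for \<alpha>
  proof (cases "\<alpha> \<in> CC")
    case True
    then have "finite {n. \<alpha> n}" by (simp add: CC_def)
    then obtain j where "\<forall>i\<in>{n. \<alpha> n}. i < j"
      unfolding finite_nat_set_iff_bounded by (rule exE)
    then have j: "\<not> \<alpha> i" if "j \<le> i" for i using that by auto
    have eq: "st \<alpha> n = st \<alpha> j" if "\<And>i. n \<le> i \<Longrightarrow> \<not> \<alpha> i" for n
      using const[of n "max n j" \<alpha>] const[of j "max n j" \<alpha>] that j by simp
    have "snd (st \<alpha> j) \<in> Cl (fst (st \<alpha> n))" for n
    proof -
      have "st \<alpha> (max n j) = st \<alpha> j" by (rule const) (use j in auto)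
      then have "snd (st \<alpha> j) \<in> Cl (fst (st \<alpha> (max n j)))" using Inv[of \<alpha> j] by (simp add: Inv_def)
      then show ?thesis using Cl_decr[of n "max n j" \<alpha>] by auto
    qed
    moreover have "snd (st \<alpha> j) \<in> R" using Inv[of \<alpha> j] by (simp add: Inv_def)
    ultimately show ?thesis using True eq by (intro exI[of _ "snd (st \<alpha> j)"]) auto
  next
    case False
    then have inf: "infinite {n. \<alpha> n}" by (simp add: CC_def)
    have "\<exists>k. i < length (fst (st \<alpha> k))" for i
    proof (induction i)
      case 0
      obtain n where "\<alpha> n" using inf by (metis (mono_tags) empty_Collect_eq finite.emptyI)
      then have "length (fst (st \<alpha> (Suc n))) > 0"
        using nxt[OF Inv[of \<alpha> n], of n] by (auto simp: st_Suc Next_def)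
      then show ?case by blast
    next
      case (Suc i)
      then obtain k where k: "i < length (fst (st \<alpha> k))" by blast
      obtain n where n: "k \<le> n" "\<alpha> n" using inf unfolding infinite_nat_iff_unbounded_le by blast
      have "length (fst (st \<alpha> k)) \<le> length (fst (st \<alpha> n))"
        using n(1)
      proof (induction rule: dec_induct)
        case (step m)
        then show ?case using ext[of \<alpha> m] by auto
      qed simp
      moreover have "length (fst (st \<alpha> n)) < length (fst (st \<alpha> (Suc n)))"
        using nxt[OF Inv[of \<alpha> n], of n] n(2) by (auto simp: st_Suc Next_def)
      ultimately have "Suc i < length (fst (st \<alpha> (Suc n)))" using k by linarith
      then show ?case by blast
    qed
    then obtain z where z: "\<And>k. z \<in> cyl (fst (st \<alpha> k))"
      using increasing_lists_limit[of "\<lambda>k. fst (st \<alpha> k)", OF ext] by metis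
    have ne: "F' \<inter> cyl (fst (st \<alpha> k)) \<noteq> {}" for k
      using Inv[of \<alpha> k] unfolding Inv_def Cl_def by auto
    have "z \<in> F'"
    proof (rule seqclosedD[OF F'closed])
      fix n
      obtain k where "n < length (fst (st \<alpha> k))" using \<open>\<And>i. \<exists>k. i < length (fst (st \<alpha> k))\<close> by blast
      moreover obtain x where "x \<in> F'" "x \<in> cyl (fst (st \<alpha> k))" using ne by blast
      moreover have "z \<in> cyl (fst (st \<alpha> k))" by (rule z)
      ultimately show "\<exists>x\<in>F'. pre x n = pre z n"
        by (intro bexI[of _ x]) (auto simp: pre_eq_iff cyl_iff_nth)
    qed
    then have "f z \<notin> R" using image by (auto simp: F'_def)
    moreover have "\<forall>n. f z \<in> Cl (fst (st \<alpha> n))" using fCl[OF \<open>z \<in> F'\<close> z] by blast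
    moreover have "\<not> (\<forall>i\<ge>n. \<not> \<alpha> i)" for n using inf unfolding infinite_nat_iff_unbounded_le by blast
    ultimately show ?thesis using False by (intro exI[of _ "f z"]) auto
  qed
  then obtain \<phi> where \<phi>Cl: "\<And>\<alpha> n. \<phi> \<alpha> \<in> Cl (fst (st \<alpha> n))" and \<phi>R: "\<And>\<alpha>. \<phi> \<alpha> \<in> R \<longleftrightarrow> \<alpha> \<in> CC"
    and \<phi>const: "\<And>\<alpha> n. (\<forall>i\<ge>n. \<not> \<alpha> i) \<Longrightarrow> \<phi> \<alpha> = snd (st \<alpha> n)" by metis
  have \<phi>M: "\<phi> \<alpha> \<in> M" for \<alpha> using \<phi>Cl[of \<alpha> 0] closure_of_subset_topspace[of T] top unfolding Cl_def by blast
  have sM: "snd (st \<alpha> n) \<in> M" for \<alpha> n using Inv[of \<alpha> n] R(1) top by (auto simp: Inv_def)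
  have close: "d (snd (st \<alpha> n)) (\<phi> \<alpha>) \<le> (1/2) ^ n" for \<alpha> n
  proof (cases "\<forall>i\<ge>n. \<not> \<alpha> i")
    case True
    then show ?thesis using \<phi>const[OF True] sM[of \<alpha> n] by simp
  next
    case False
    define j where "j = (LEAST i. n \<le> i \<and> \<alpha> i)"
    have j: "n \<le> j" "\<alpha> j" using LeastI_ex[of "\<lambda>i. n \<le> i \<and> \<alpha> i"] False unfolding j_def by auto
    have least: "\<not> \<alpha> i" if "n \<le> i" "i < j" for i using not_less_Least[of i "\<lambda>i. n \<le> i \<and> \<alpha> i"] that unfolding j_def by blast
    have eq: "st \<alpha> j = st \<alpha> n" by (rule const) (use j least in auto)
    have nx: "Next j (st \<alpha> n) (st \<alpha> (Suc j))" using nxt[OF Inv[of \<alpha> j], of j] j(2) eq by (simp add: st_Suc)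
    have "f ` (F' \<inter> cyl (fst (st \<alpha> (Suc j)))) \<subseteq> mcball (snd (st \<alpha> n)) ((1/2) ^ j)"
      using nx sM fM unfolding Next_def by auto
    then have "Cl (fst (st \<alpha> (Suc j))) \<subseteq> mcball (snd (st \<alpha> n)) ((1/2) ^ j)"
      unfolding Cl_def T by (intro closure_of_minimal) auto
    then have "d (snd (st \<alpha> n)) (\<phi> \<alpha>) \<le> (1/2) ^ j" using \<phi>Cl[of \<alpha> "Suc j"] by auto
    also have "\<dots> \<le> (1/2) ^ n" using j(1) by (intro power_decreasing) auto
    finally show ?thesis .
  qed
  have "cont_on UNIV T \<phi>"
  proof (rule cont_onI)
    show "\<phi> \<alpha> \<in> topspace T" for \<alpha> using \<phi>M top by simp
    fix \<alpha> V assume "openin T V" "\<phi> \<alpha> \<in> V"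
    then obtain r where r: "r > 0" "mball (\<phi> \<alpha>) r \<subseteq> V" unfolding T openin_mtopology by blast
    obtain n where n: "(1/2 :: real) ^ n < r / 2" using real_arch_pow_inv[of "r/2" "1/2"] r(1) by auto
    have "\<phi> \<beta> \<in> V" if "pre \<beta> n = pre \<alpha> n" for \<beta>
    proof -
      have "st \<beta> n = st \<alpha> n" using st_cong that by blast
      then have "d (\<phi> \<alpha>) (\<phi> \<beta>) \<le> (1/2) ^ n + (1/2) ^ n"
        using triangle[OF \<phi>M sM \<phi>M, of \<alpha> \<beta> \<alpha> n] close[of \<alpha> n] close[of \<beta> n] commute by (smt (verit))
      then have "d (\<phi> \<alpha>) (\<phi> \<beta>) < r" using n by linarith
      then show ?thesis using r(2) \<phi>M by auto
    qed
    then show "\<exists>n. \<forall>x\<in>UNIV. pre x n = pre \<alpha> n \<longrightarrow> \<phi> x \<in> V" by blast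
  qed
  then show thesis using that \<phi>R by (simp add: cantor_eq_seqtop continuous_map_seqtop)
qed

section \<open>Analytic spaces and Borel subsets of Cantor space\<close>

text \<open>Points are coded by rapidly converging sequences in a countable dense set; that the distance of
consecutive terms is at most a given bound is a closed condition.\<close>

lemma Polish_baire_image:
  assumes "Polish_topology T" shows "baire_image T (topspace T)"
proof -
  obtain M d where "Metric_space M d" and compl: "Metric_space.mcomplete M d" and T: "T = Metric_space.mtopology M d"
    using assms unfolding Polish_topology_def completely_metrizable_space_def by blast
  interpret Metric_space M d by fact
  have top: "topspace T = M" by (simp add: T)
  obtain C where C: "countable C" "C \<subseteq> M" "T closure_of C = M"
    using assms unfolding Polish_topology_def separable_space_def top by blast
  show ?thesis
  proof (cases "C = {}")
    case True
    then have "M = {}" using C(3) by simp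
    then show ?thesis unfolding baire_image_def top
      by (intro exI[of _ "{}"] exI[of _ undefined]) (auto simp: seqclosed_def cont_on_def)
  next
    case False
    define q where "q = from_nat_into C"
    have qM: "q n \<in> M" for n using from_nat_into[OF False, of n] C(2) unfolding q_def by blast
    have near: "\<exists>n. d (q n) p < e" if p: "p \<in> M" and e: "e > 0" for p e
    proof -
      have "p \<in> T closure_of C" using C(3) p by simp
      then obtain y where y: "y \<in> C" "y \<in> mball p e" using e unfolding T metric_closure_of by blast
      then obtain n where "y = q n"
        using from_nat_into_surj[OF C(1)] unfolding q_def by metis
      then show ?thesis using y(2) commute by (intro exI[of _ n]) auto
    qed
    define F where "F = {x. \<forall>n. d (q (x n)) (q (x (Suc n))) \<le> (1/2) ^ n}"
    have steps: "d (q (x n)) (q (x (n + k))) \<le> 2 * (1/2) ^ n - 2 * (1/2) ^ (n + k)" if "x \<in> F" for x n k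
    proof (induction k)
      case 0
      then show ?case by (simp add: qM)
    next
      case (Suc k)
      have "d (q (x n)) (q (x (n + Suc k))) \<le> d (q (x n)) (q (x (n + k))) + d (q (x (n + k))) (q (x (Suc (n + k))))"
        using triangle[OF qM qM qM] by simp
      also have "\<dots> \<le> (2 * (1/2) ^ n - 2 * (1/2) ^ (n + k)) + (1/2) ^ (n + k)"
        using Suc that unfolding F_def by (intro add_mono) auto
      finally show ?case by simp
    qed
    have steps': "d (q (x n)) (q (x m)) \<le> 2 * (1/2) ^ n" if "x \<in> F" "n \<le> m" for x n m
    proof -
      have "d (q (x n)) (q (x m)) \<le> 2 * (1/2) ^ n - 2 * (1/2) ^ m"
        using steps[OF that(1), of n "m - n"] that(2) by simp
      moreover have "0 \<le> (1/2 :: real) ^ m" by simp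
      ultimately show ?thesis by linarith
    qed
    have small: "\<exists>n. 4 * (1/2) ^ n < e" if e: "e > 0" for e :: real
    proof -
      obtain n where "(1/2 :: real) ^ n < e / 4" using real_arch_pow_inv[of "e/4" "1/2"] e by auto
      then show ?thesis by (intro exI[of _ n]) linarith
    qed
    have "\<exists>l\<in>M. \<forall>n. d (q (x n)) l \<le> 2 * (1/2) ^ n" if x: "x \<in> F" for x
    proof -
      have "MCauchy (\<lambda>n. q (x n))"
        unfolding MCauchy_def
      proof (intro conjI allI impI)
        show "range (\<lambda>n. q (x n)) \<subseteq> M" using qM by blast
        fix e :: real assume "e > 0"
        then obtain N where N: "4 * (1/2) ^ N < e" using small by blast
        have "d (q (x n)) (q (x n')) < e" if "N \<le> n" "N \<le> n'" for n n'
        proof -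
          have "d (q (x n)) (q (x n')) \<le> d (q (x n)) (q (x N)) + d (q (x N)) (q (x n'))"
            using triangle[OF qM qM qM] by simp
          moreover have "d (q (x n)) (q (x N)) = d (q (x N)) (q (x n))" by (rule commute)
          ultimately have "d (q (x n)) (q (x n')) \<le> 4 * (1/2) ^ N"
            using steps'[OF x that(1)] steps'[OF x that(2)] by linarith
          then show ?thesis using N by linarith
        qed
        then show "\<exists>N. \<forall>n n'. N \<le> n \<longrightarrow> N \<le> n' \<longrightarrow> d (q (x n)) (q (x n')) < e" by blast
      qed
      then obtain l where l: "limitin mtopology (\<lambda>n. q (x n)) l sequentially"
        using compl unfolding mcomplete_def by blast
      then have lM: "l \<in> M" and lim: "\<And>e. e > 0 \<Longrightarrow> \<exists>N. \<forall>n\<ge>N. d (q (x n)) l < e"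
        unfolding limit_metric_sequentially by (simp, meson)
      have "d (q (x n)) l \<le> 2 * (1/2) ^ n" for n
      proof (rule field_le_epsilon)
        fix e :: real assume "e > 0"
        then obtain N where N: "\<forall>m\<ge>N. d (q (x m)) l < e" using lim by blast
        have "d (q (x n)) l \<le> d (q (x n)) (q (x (max n N))) + d (q (x (max n N))) l"
          using triangle[OF qM qM lM] by simp
        moreover have "d (q (x (max n N))) l < e" using N by simp
        moreover have "d (q (x n)) (q (x (max n N))) \<le> 2 * (1/2) ^ n" by (rule steps'[OF x]) simp
        ultimately show "d (q (x n)) l \<le> 2 * (1/2) ^ n + e" by linarith
      qed
      with lM show ?thesis by blast
    qed
    then have "\<forall>x. \<exists>l. x \<in> F \<longrightarrow> l \<in> M \<and> (\<forall>n. d (q (x n)) l \<le> 2 * (1/2) ^ n)" by blast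
    then obtain g where g: "\<And>x. x \<in> F \<Longrightarrow> g x \<in> M \<and> (\<forall>n. d (q (x n)) (g x) \<le> 2 * (1/2) ^ n)" by metis
    have "seqclosed F"
    proof (rule seqclosedI)
      fix z assume z: "\<And>n. \<exists>x\<in>F. pre x n = pre z n"
      have "d (q (z n)) (q (z (Suc n))) \<le> (1/2) ^ n" for n
      proof -
        obtain x where x: "x \<in> F" "pre x (Suc (Suc n)) = pre z (Suc (Suc n))" using z by blast
        then have "x n = z n" "x (Suc n) = z (Suc n)" unfolding pre_eq_iff by auto
        moreover have "d (q (x n)) (q (x (Suc n))) \<le> (1/2) ^ n" using x(1) unfolding F_def by blast
        ultimately show ?thesis by simp
      qed
      then show "z \<in> F" by (simp add: F_def)
    qed
    moreover have "cont_on F T g"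
    proof (rule cont_onI)
      show "g z \<in> topspace T" if "z \<in> F" for z using g that top by simp
      fix z V assume z: "z \<in> F" and V: "openin T V" "g z \<in> V"
      then obtain r where r: "r > 0" "mball (g z) r \<subseteq> V" unfolding T openin_mtopology by blast
      obtain n where n: "4 * (1/2) ^ n < r" using small[OF r(1)] by blast
      have "g x \<in> V" if x: "x \<in> F" "pre x (Suc n) = pre z (Suc n)" for x
      proof -
        have "x n = z n" using x(2) unfolding pre_eq_iff by simp
        then have "d (q (z n)) (g x) \<le> 2 * (1/2) ^ n" using g[OF x(1)] by metis
        moreover have "d (q (z n)) (g z) \<le> 2 * (1/2) ^ n" using g[OF z] by blast
        moreover have "d (g z) (g x) \<le> d (g z) (q (z n)) + d (q (z n)) (g x)"
          using g[OF z] g[OF x(1)] qM by (intro triangle) auto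
        moreover have "d (g z) (q (z n)) = d (q (z n)) (g z)" by (rule commute)
        ultimately have "d (g z) (g x) < r" using n by linarith
        then show ?thesis using r(2) g[OF z] g[OF x(1)] by auto
      qed
      then show "\<exists>n. \<forall>x\<in>F. pre x n = pre z n \<longrightarrow> g x \<in> V" by blast
    qed
    moreover have "g ` F = M"
    proof (rule set_eqI, rule iffI)
      fix p assume "p \<in> g ` F"
      then show "p \<in> M" using g by blast
    next
      fix p assume p: "p \<in> M"
      have "\<forall>n. \<exists>k. d (q k) p < (1/2) ^ n / 2" by (intro allI near[OF p]) simp
      then obtain x where x: "\<And>n. d (q (x n)) p < (1/2) ^ n / 2" by metis
      have "d (q (x n)) (q (x (Suc n))) \<le> (1/2) ^ n" for n
      proof -
        have "d (q (x n)) (q (x (Suc n))) \<le> d (q (x n)) p + d p (q (x (Suc n)))"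
          using triangle[OF qM p qM] by simp
        moreover have "d p (q (x (Suc n))) = d (q (x (Suc n))) p" by (rule commute)
        moreover have "d (q (x (Suc n))) p < (1/2) ^ n / 2 / 2" using x[of "Suc n"] by simp
        moreover have "0 < (1/2 :: real) ^ n" by simp
        ultimately show ?thesis using x[of n] by linarith
      qed
      then have xF: "x \<in> F" by (simp add: F_def)
      have gM: "g x \<in> M" using g[OF xF] by blast
      have "d p (g x) = 0"
      proof (rule ccontr)
        assume "d p (g x) \<noteq> 0"
        then have "d p (g x) > 0" using nonneg[of p "g x"] by linarith
        then obtain n where n: "4 * (1/2) ^ n < d p (g x)" using small by blast
        have "d p (g x) \<le> d p (q (x n)) + d (q (x n)) (g x)" using triangle[OF p qM gM] by simp
        moreover have "d p (q (x n)) = d (q (x n)) p" by (rule commute)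
        moreover have "d (q (x n)) (g x) \<le> 2 * (1/2) ^ n" using g[OF xF] by blast
        moreover have "0 < (1/2 :: real) ^ n" by simp
        ultimately show False using n x[of n] by linarith
      qed
      then have "p = g x" using zero[OF p gM] by simp
      then show "p \<in> g ` F" using xF by blast
    qed
    ultimately show ?thesis unfolding baire_image_def top by blast
  qed
qed

lemma analytic_space_baire_image:
  assumes "analytic_space X" shows "baire_image X (topspace X)"
proof -
  obtain P :: "(nat \<Rightarrow> real) topology" and A where A: "analytic_in P A" "X homeomorphic_space subtopology P A"
    using assms unfolding analytic_space_def by blast
  obtain Y :: "(nat \<Rightarrow> real) topology" and g where Y: "Polish_topology Y" "continuous_map Y P g" "g ` topspace Y = A"
    and AP: "A \<subseteq> topspace P" using A(1) unfolding analytic_in_def by blast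
  obtain h where h: "homeomorphic_map (subtopology P A) X h"
    using A(2) by (metis homeomorphic_space homeomorphic_space_sym)
  have "continuous_map Y (subtopology P A) g" using Y by (auto simp: continuous_map_in_subtopology)
  then have "baire_image (subtopology P A) (g ` topspace Y)"
    using baire_image_map[OF Polish_baire_image[OF Y(1)]] by blast
  then have "baire_image X (h ` g ` topspace Y)"
    using baire_image_map homeomorphic_imp_continuous_map[OF h] by blast
  moreover have "h ` g ` topspace Y = topspace X"
    using homeomorphic_imp_surjective_map[OF h] Y(3) AP by (simp add: Int_absorb1)
  ultimately show ?thesis by simp
qed

lemma metrizable_cantor: "metrizable_space cantor"
  by (simp add: cantor_def metrizable_space_product_topology metrizable_space_discrete_topology)

lemma baire_image_cantor: "baire_image cantor UNIV"
proof -
  define f where "f z = (\<lambda>i. z i \<noteq> 0)" for z :: "nat \<Rightarrow> nat"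
  have "cont_on UNIV cantor f"
  proof (rule cont_onI)
    fix z V assume "openin cantor V" "f z \<in> V"
    then obtain n where n: "cyl (pre (f z) n) \<subseteq> V" unfolding cantor_eq_seqtop openin_seqtop by blast
    have "f x \<in> V" if "pre x n = pre z n" for x
    proof -
      have "f x \<in> cyl (pre (f z) n)" using that unfolding cyl_pre_iff pre_eq_iff f_def by simp
      then show ?thesis using n by blast
    qed
    then show "\<exists>n. \<forall>x\<in>UNIV. pre x n = pre z n \<longrightarrow> f x \<in> V" by blast
  qed simp
  moreover have "f ` UNIV = UNIV"
  proof -
    have "y = f (\<lambda>i. if y i then 1 else 0)" for y by (auto simp: f_def)
    then show ?thesis by blast
  qed
  moreover have "seqclosed (UNIV :: (nat \<Rightarrow> nat) set)" by (simp add: seqclosed_def)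
  ultimately show ?thesis unfolding baire_image_def by blast
qed

lemma openin_cantor_cyl: "openin cantor (cyl u)"
  unfolding cantor_eq_seqtop openin_seqtop by (metis cyl_pre_length order_refl)

lemma cont_on_cantorD:
  assumes "cont_on F cantor a" "z \<in> F" shows "\<exists>n. a ` (F \<inter> cyl (pre z n)) \<subseteq> cyl (pre (a z) N)"
  using assms openin_cantor_cyl[of "pre (a z) N"] unfolding cont_on_def by simp

lemma nowhere_dense_singleton: "nowhere_dense {x :: nat \<Rightarrow> bool}"
  unfolding nowhere_dense_def
proof
  fix u
  have "x \<notin> cyl (u @ [\<not> x (length u)])" by (auto simp: cyl_iff_nth)
  then show "\<exists>w. cyl (u @ w) \<inter> {x} = {}" by blast
qed

lemma countable_meagre: "countable N \<Longrightarrow> meagre (N :: (nat \<Rightarrow> bool) set)"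
  using countably_covered_UN[of N nowhere_dense "\<lambda>x. {x}"] countably_covered_self[of nowhere_dense, OF nowhere_dense_singleton] by simp

text \<open>A Borel set is a continuous image of a closed subset of Baire space, so that
\<open>category_uniformization\<close> applies to the two coordinates of such a parametrization.\<close>

lemma Borel_locally_countable_tame:
  assumes A: "Borel_in (prod_topology cantor cantor) A"
    and vert: "\<And>x. countable {y. (x, y) \<in> A}" and hor: "\<And>y. countable {x. (x, y) \<in> A}"
  shows "tame A"
proof -
  have "baire_image (prod_topology cantor cantor) A"
  proof (rule baire_image_Borel[OF _ _ A])
    show "metrizable_space (prod_topology cantor cantor)"
      using metrizable_cantor by (simp add: metrizable_space_prod_topology)
    show "baire_image (prod_topology cantor cantor) (topspace (prod_topology cantor cantor))"
      using baire_image_prod[OF baire_image_cantor baire_image_cantor] by simp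
  qed
  then obtain F :: "(nat \<Rightarrow> nat) set" and f where F: "seqclosed F"
    and f: "cont_on F (prod_topology cantor cantor) f" and im: "f ` F = A"
    unfolding baire_image_def by blast
  define a where "a = fst \<circ> f"
  define b where "b = snd \<circ> f"
  have ca: "cont_on F cantor a" unfolding a_def by (rule cont_on_compose[OF f continuous_map_fst])
  have cb: "cont_on F cantor b" unfolding b_def by (rule cont_on_compose[OF f continuous_map_snd])
  have ab: "(a z, b z) \<in> A" if "z \<in> F" for z using im that by (auto simp: a_def b_def)
  have "tame ((\<lambda>z. (a z, b z)) ` F)"
  proof (rule category_uniformization[OF F])
    show "\<exists>n. a ` (F \<inter> cyl (pre z n)) \<subseteq> cyl (pre (a z) N)" if "z \<in> F" for z N
      using cont_on_cantorD[OF ca that] .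
    show "\<exists>n. b ` (F \<inter> cyl (pre z n)) \<subseteq> cyl (pre (b z) N)" if "z \<in> F" for z N
      using cont_on_cantorD[OF cb that] .
    show "countable {b z |z. z \<in> F \<and> a z = x}" for x
      by (rule countable_subset[OF _ vert[of x]]) (use ab in auto)
    show "meagre {a z |z. z \<in> F \<and> b z = y}" for y
      by (rule countably_covered_subset[OF countable_meagre[OF hor[of y]]]) (use ab in auto)
  qed
  then show ?thesis using im by (simp add: a_def b_def)
qed

text \<open>The Baire property in a localized form, which suits induction over Borel sets: the
condition is symmetric under complements, and if no set of a countable family is
comeagre in any smaller cylinder, then the union of the family is meagre.\<close>

lemma Borel_locally_meagre_or_comeagre:
  assumes B: "Borel_in cantor B"
  shows "\<exists>w. meagre (B \<inter> cyl (u @ w)) \<or> meagre (cyl (u @ w) - B)"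
proof -
  have "B \<in> sigma_sets (topspace cantor) {U. openin cantor U}" using B by (simp add: Borel_in_def)
  then have "\<forall>u. \<exists>w. meagre (B \<inter> cyl (u @ w)) \<or> meagre (cyl (u @ w) - B)"
  proof (induction rule: sigma_sets.induct)
    case (Basic U)
    show ?case
    proof
      fix u
      show "\<exists>w. meagre (U \<inter> cyl (u @ w)) \<or> meagre (cyl (u @ w) - U)"
      proof (cases "U \<inter> cyl u = {}")
        case True
        then show ?thesis by (intro exI[of _ "[]"]) simp
      next
        case False
        then obtain x where x: "x \<in> U" "x \<in> cyl u" by blast
        obtain n where n: "cyl (pre x n) \<subseteq> U"
          using Basic x(1) unfolding cantor_eq_seqtop by (auto simp: openin_seqtop)
        obtain w where w: "pre x (max n (length u)) = u @ w"
          using pre_extends[OF x(2), of "max n (length u)"] by auto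
        have "cyl (u @ w) \<subseteq> U" using n cyl_pre_antimono[of n "max n (length u)" x] w by auto
        then have "cyl (u @ w) - U = {}" by blast
        then show ?thesis by (metis countably_covered_empty)
      qed
    qed
  next
    case Empty
    then show ?case by simp
  next
    case (Compl a)
    have "(topspace cantor - a) \<inter> cyl v = cyl v - a" "cyl v - (topspace cantor - a) = a \<inter> cyl v" for v
      by auto
    then show ?case using Compl(2) by metis
  next
    case (Union a)
    show ?case
    proof
      fix u
      show "\<exists>w. meagre (\<Union> (range a) \<inter> cyl (u @ w)) \<or> meagre (cyl (u @ w) - \<Union> (range a))"
      proof (cases "\<exists>i w. meagre (cyl (u @ w) - a i)")
        case True
        then obtain i w where "meagre (cyl (u @ w) - a i)" by blast
        then have "meagre (cyl (u @ w) - \<Union> (range a))" by (rule countably_covered_subset) blast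
        then show ?thesis by blast
      next
        case False
        have "meagre (a i \<inter> cyl u)" for i
        proof (rule meagre_local)
          fix v
          obtain w where "meagre (a i \<inter> cyl ((u @ v) @ w)) \<or> meagre (cyl ((u @ v) @ w) - a i)"
            using Union(2) by blast
          then show "\<exists>w. meagre (a i \<inter> cyl (u @ v @ w))" using False by auto
        qed
        then have "meagre (\<Union>i. a i \<inter> cyl u)" by (rule countably_covered_UN_nat)
        then have "meagre (\<Union> (range a) \<inter> cyl (u @ []))" by (rule countably_covered_subset) auto
        then show ?thesis by blast
      qed
    qed
  qed
  then show ?thesis by blast
qed

section \<open>Normal forms on Cantor space\<close>

definition dense_below :: "(nat \<Rightarrow> bool) set \<Rightarrow> bool list \<Rightarrow> bool" where
  "dense_below D s \<longleftrightarrow> (\<forall>w. D \<inter> cyl (s @ w) \<noteq> {})"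

lemma dense_belowD: "dense_below D s \<Longrightarrow> \<exists>d\<in>D. d \<in> cyl (s @ w)"
  unfolding dense_below_def by blast

lemma dense_below_append: "dense_below D s \<Longrightarrow> dense_below D (s @ w)"
  by (simp add: dense_below_def)

lemma nowhere_dense_Un: "nowhere_dense A \<Longrightarrow> nowhere_dense B \<Longrightarrow> nowhere_dense (A \<union> B)"
  unfolding nowhere_dense_def
proof
  fix u assume A: "\<forall>u. \<exists>w. cyl (u @ w) \<inter> A = {}" and B: "\<forall>u. \<exists>w. cyl (u @ w) \<inter> B = {}"
  obtain w where w: "cyl (u @ w) \<inter> A = {}" using A by blast
  obtain w' where w': "cyl ((u @ w) @ w') \<inter> B = {}" using B by blast
  have "cyl (u @ (w @ w')) \<inter> (A \<union> B) = {}"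
    using w w' cyl_append_subset[of "u @ w" w'] by auto
  then show "\<exists>w. cyl (u @ w) \<inter> (A \<union> B) = {}" by blast
qed

lemma nowhere_dense_finite: "finite E \<Longrightarrow> nowhere_dense (E :: (nat \<Rightarrow> bool) set)"
proof (induction E rule: finite_induct)
  case (insert x F)
  then show ?case using nowhere_dense_Un[OF nowhere_dense_singleton[of x]] by simp
qed (rule nowhere_dense_empty)

lemma dense_below_Diff_nowhere_dense:
  assumes "dense_below D s" "nowhere_dense N" shows "dense_below (D - N) s"
  unfolding dense_below_def
proof
  fix w
  obtain w' where "cyl ((s @ w) @ w') \<inter> N = {}" using assms(2) unfolding nowhere_dense_def by blast
  moreover obtain d where "d \<in> D" "d \<in> cyl (s @ w @ w')" using dense_belowD[OF assms(1)] by blast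
  ultimately show "(D - N) \<inter> cyl (s @ w) \<noteq> {}" using cyl_append_subset[of "s @ w" w'] by auto
qed

text \<open>A set that is dense in a cylinder is not a finite union of nowhere dense sets.\<close>

lemma dense_below_finite_cover:
  assumes "finite I" "dense_below D s" and cover: "\<And>d. d \<in> D \<Longrightarrow> d \<in> cyl s \<Longrightarrow> \<exists>i\<in>I. d \<in> A i"
  shows "\<exists>i\<in>I. \<exists>w. dense_below (D \<inter> A i) (s @ w)"
proof (rule ccontr)
  assume contra: "\<not> (\<exists>i\<in>I. \<exists>w. dense_below (D \<inter> A i) (s @ w))"
  have "\<exists>w. \<forall>i\<in>I. D \<inter> A i \<inter> cyl (s @ w) = {}"
    using \<open>finite I\<close> contra
  proof (induction I rule: finite_induct)
    case (insert i I)
    then obtain w where w: "\<forall>i\<in>I. D \<inter> A i \<inter> cyl (s @ w) = {}" by auto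
    have "\<not> dense_below (D \<inter> A i) (s @ w)" using insert.prems by blast
    then obtain w' where "D \<inter> A i \<inter> cyl (s @ w @ w') = {}" unfolding dense_below_def by auto
    moreover have "cyl (s @ w @ w') \<subseteq> cyl (s @ w)" using cyl_append_subset[of "s @ w" w'] by simp
    ultimately have "\<forall>i\<in>insert i I. D \<inter> A i \<inter> cyl (s @ w @ w') = {}" using w by blast
    then show ?case by blast
  qed simp
  then obtain w where w: "\<forall>i\<in>I. D \<inter> A i \<inter> cyl (s @ w) = {}" by blast
  obtain d where d: "d \<in> D" "d \<in> cyl (s @ w)" using dense_belowD[OF assms(2)] by blast
  then obtain i where "i \<in> I" "d \<in> A i" using cover cyl_append_subset by blast
  then show False using w d by blast
qed

text \<open>If \<open>D0\<close> itself does not allow to choose further unrelated points forever, some finite set \<open>E\<close>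
obstructs it. Then one \<open>e \<in> E\<close> and one \<open>i\<close> are such that the points \<open>d\<close> with \<open>(d, e) \<in> L i\<close> are
somewhere dense, and these points are pairwise unrelated by assumption.\<close>

lemma independent_selection:
  assumes I: "finite I" and dense: "dense_below D0 s"
    and sym: "\<And>x y. (x, y) \<in> (\<Union>i\<in>I. L i) \<Longrightarrow> (y, x) \<in> (\<Union>i\<in>I. L i)"
    and indep: "\<And>i e d d'. i \<in> I \<Longrightarrow> e \<in> D0 \<Longrightarrow> d \<in> D0 \<Longrightarrow> d' \<in> D0 \<Longrightarrow> d \<noteq> e \<Longrightarrow> d' \<noteq> e \<Longrightarrow> d \<noteq> d' \<Longrightarrow>
      (d, e) \<in> L i \<Longrightarrow> (d', e) \<in> L i \<Longrightarrow> (d, d') \<notin> (\<Union>i\<in>I. L i)"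
  obtains D w where "D \<subseteq> D0" "\<And>E w'. finite E \<Longrightarrow> E \<subseteq> D \<Longrightarrow>
    \<exists>d\<in>D \<inter> cyl ((s @ w) @ w'). \<forall>e\<in>E. d \<noteq> e \<and> (d, e) \<notin> (\<Union>i\<in>I. L i) \<and> (e, d) \<notin> (\<Union>i\<in>I. L i)"
proof -
  define K where "K = (\<Union>i\<in>I. L i)"
  define sel where "sel D u \<longleftrightarrow> (\<forall>E w'. finite E \<longrightarrow> E \<subseteq> D \<longrightarrow>
    (\<exists>d\<in>D \<inter> cyl (u @ w'). \<forall>e\<in>E. d \<noteq> e \<and> (d, e) \<notin> K \<and> (e, d) \<notin> K))" for D u
  have "\<exists>D w. D \<subseteq> D0 \<and> sel D (s @ w)"
  proof (cases "sel D0 s")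
    case True
    then show ?thesis by (intro exI[of _ D0] exI[of _ "[]"]) simp
  next
    case False
    then obtain E w1 where E: "finite E" "E \<subseteq> D0"
      and "\<not> (\<exists>d\<in>D0 \<inter> cyl (s @ w1). \<forall>e\<in>E. d \<noteq> e \<and> (d, e) \<notin> K \<and> (e, d) \<notin> K)"
      unfolding sel_def by meson
    then have bad: "\<exists>e\<in>E. d = e \<or> (d, e) \<in> K \<or> (e, d) \<in> K" if "d \<in> D0" "d \<in> cyl (s @ w1)" for d
      using that by auto
    define D1 where "D1 = D0 - E"
    have dense1: "dense_below D1 (s @ w1)"
      unfolding D1_def using dense nowhere_dense_finite[OF E(1)] by (intro dense_below_Diff_nowhere_dense dense_below_append)
    have "\<exists>p\<in>E \<times> I. \<exists>w. dense_below (D1 \<inter> {d. (d, fst p) \<in> L (snd p)}) ((s @ w1) @ w)"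
    proof (rule dense_below_finite_cover[OF _ dense1])
      show "finite (E \<times> I)" using E(1) I by simp
      fix d assume d: "d \<in> D1" "d \<in> cyl (s @ w1)"
      then obtain e where e: "e \<in> E" "(d, e) \<in> K \<or> (e, d) \<in> K" using bad unfolding D1_def by blast
      then have "(d, e) \<in> K" using sym unfolding K_def by blast
      then obtain i where "i \<in> I" "(d, e) \<in> L i" unfolding K_def by blast
      then show "\<exists>p\<in>E \<times> I. d \<in> {d. (d, fst p) \<in> L (snd p)}" using e(1) by (intro bexI[of _ "(e, i)"]) auto
    qed
    then obtain e i w2 where e: "e \<in> E" "i \<in> I" and
      dense2: "dense_below (D1 \<inter> {d. (d, e) \<in> L i}) ((s @ w1) @ w2)" by auto
    define D where "D = D1 \<inter> {d. (d, e) \<in> L i}"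
    have ind: "(d, d') \<notin> K" if "d \<in> D" "d' \<in> D" "d \<noteq> d'" for d d'
      unfolding K_def
    proof (rule indep)
      show "i \<in> I" "e \<in> D0" using e E(2) by auto
      show "d \<in> D0" "d' \<in> D0" "d \<noteq> e" "d' \<noteq> e" "(d, e) \<in> L i" "(d', e) \<in> L i" "d \<noteq> d'"
        using that e unfolding D_def D1_def by auto
    qed
    have "sel D (s @ w1 @ w2)"
      unfolding sel_def
    proof (intro allI impI)
      fix E' w' assume E': "finite E'" "E' \<subseteq> D"
      have "dense_below (D - E') ((s @ w1) @ w2)"
        using dense_below_Diff_nowhere_dense[OF dense2 nowhere_dense_finite[OF E'(1)]] unfolding D_def .
      then obtain d where d: "d \<in> D - E'" "d \<in> cyl (((s @ w1) @ w2) @ w')" using dense_belowD by blast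
      then show "\<exists>d\<in>D \<inter> cyl ((s @ w1 @ w2) @ w'). \<forall>e\<in>E'. d \<noteq> e \<and> (d, e) \<notin> K \<and> (e, d) \<notin> K"
        using ind E'(2) by (intro bexI[of _ d]) auto
    qed
    moreover have "D \<subseteq> D0" unfolding D_def D1_def by auto
    ultimately show ?thesis by (intro exI[of _ D] exI[of _ "w1 @ w2"]) simp
  qed
  then show thesis using that unfolding sel_def K_def by blast
qed

lemma CC_dense: "dense_below CC s"
  unfolding dense_below_def
proof
  fix w
  have "finite {n. n < length (s @ w) \<and> (s @ w) ! n}" by simp
  then have "(\<lambda>n. n < length (s @ w) \<and> (s @ w) ! n) \<in> CC \<inter> cyl (s @ w)"
    by (auto simp: CC_def cyl_iff_nth)
  then show "CC \<inter> cyl (s @ w) \<noteq> {}" by blast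
qed

lemma countable_CC: "countable CC"
proof -
  have "countable (Collect ` CC)"
    by (rule countable_subset[OF _ countable_Collect_finite]) (auto simp: CC_def)
  moreover have "inj_on Collect CC" by (auto simp: inj_on_def)
  ultimately show ?thesis using countable_image_inj_on by blast
qed

lemma meagre_CC: "meagre CC"
  by (rule countable_meagre[OF countable_CC])

text \<open>With the identity added to a tame relation, the maps produced by thinning become injective.\<close>

lemma thin_Id: "thin (Id :: ((nat \<Rightarrow> bool) \<times> (nat \<Rightarrow> bool)) set)"
  unfolding thin_def
proof (intro allI)
  fix y :: "nat \<Rightarrow> bool" and u
  obtain w where w: "cyl (u @ w) \<inter> {y} = {}" using nowhere_dense_singleton[of y] unfolding nowhere_dense_def by blast
  have "cyl (u @ w) \<times> cyl (pre y (length (u @ w))) \<inter> Id = {}"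
  proof -
    have "x \<notin> cyl (pre y (length (u @ w)))" if x: "x \<in> cyl (u @ w)" for x
    proof
      assume "x \<in> cyl (pre y (length (u @ w)))"
      then have "pre y (length (u @ w)) = u @ w" using cyl_pre_length[OF x] by (simp add: cyl_pre_iff)
      then have "y \<in> cyl (u @ w)" by (simp add: cyl_def)
      then show False using w by blast
    qed
    then show ?thesis by auto
  qed
  then show "\<exists>w m. cyl (u @ w) \<times> cyl (pre y m) \<inter> Id = {}" by blast
qed

text \<open>The form in which thinning is applied. Symmetry of \<open>K\<close> settles the pairs with one coordinate
in \<open>CC\<close>, and avoiding the meagre set \<open>CC \<union> N\<close>, which is tame as a relation on the first
coordinate, makes the copy of a generic point generic again.\<close>

lemma thinning_CC:
  assumes D: "D \<subseteq> CC" and K: "tame K" and sym: "\<And>x y. (x, y) \<in> K \<Longrightarrow> (y, x) \<in> K" and N: "meagre N"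
    and sel: "\<And>E w. finite E \<Longrightarrow> E \<subseteq> D \<Longrightarrow> \<exists>d\<in>D \<inter> cyl (s @ w). \<forall>e\<in>E. (d, e) \<notin> K"
  obtains \<psi> where "continuous_map cantor cantor \<psi>" "\<And>x. \<psi> x \<in> CC \<longleftrightarrow> x \<in> CC" "range \<psi> \<subseteq> cyl s"
    "\<And>x. x \<in> CC \<Longrightarrow> \<psi> x \<in> D" "\<And>x. x \<notin> CC \<Longrightarrow> \<psi> x \<notin> N" "\<And>x y. x \<noteq> y \<Longrightarrow> (\<psi> x, \<psi> y) \<notin> K"
proof -
  define M where "M = K \<union> (CC \<union> N) \<times> UNIV"
  have "tame M"
    unfolding M_def by (intro countably_covered_Un K tame_meagre meagre_CC N)
  then obtain \<psi> where cont: "\<And>\<alpha> n. \<psi> ` cyl (pre \<alpha> n) \<subseteq> cyl (pre (\<psi> \<alpha>) n)"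
    and ran: "range \<psi> \<subseteq> cyl s" and psiD: "\<psi> ` CC \<subseteq> D"
    and psiM: "\<And>\<alpha> \<beta>. \<alpha> \<notin> CC \<Longrightarrow> \<alpha> \<noteq> \<beta> \<Longrightarrow> (\<psi> \<alpha>, \<psi> \<beta>) \<notin> M"
    and psiK: "\<And>\<alpha> \<beta>. \<alpha> \<in> CC \<Longrightarrow> \<beta> \<in> CC \<Longrightarrow> \<alpha> \<noteq> \<beta> \<Longrightarrow> (\<psi> \<alpha>, \<psi> \<beta>) \<notin> K"
  proof (rule thinning[of M D s K])
    fix E w assume "finite E" "E \<subseteq> D"
    then obtain d where "d \<in> D \<inter> cyl (s @ w)" "\<forall>e\<in>E. (d, e) \<notin> K" using sel by blast
    then show "\<exists>d\<in>D \<inter> cyl (s @ w). \<forall>e\<in>E. (d, e) \<notin> K \<and> (e, d) \<notin> K" using sym by blast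
  qed blast
  have off: "\<psi> x \<notin> CC \<union> N" if "x \<notin> CC" for x
  proof -
    obtain y where "x \<noteq> y" by (metis (full_types) fun_upd_same)
    then show ?thesis using psiM[OF that, of y] unfolding M_def by blast
  qed
  show thesis
  proof
    have "cont_on UNIV cantor \<psi>"
    proof (rule cont_onI)
      fix z V assume "openin cantor V" "\<psi> z \<in> V"
      then obtain n where n: "cyl (pre (\<psi> z) n) \<subseteq> V" unfolding cantor_eq_seqtop openin_seqtop by blast
      have "\<psi> x \<in> V" if "pre x n = pre z n" for x
      proof -
        have "x \<in> cyl (pre z n)" using that by (simp add: cyl_pre_iff)
        then show ?thesis using n cont[where \<alpha> = z and n = n] by blast
      qed
      then show "\<exists>n. \<forall>x\<in>UNIV. pre x n = pre z n \<longrightarrow> \<psi> x \<in> V" by blast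
    qed simp
    then show "continuous_map cantor cantor \<psi>" by (simp add: cantor_eq_seqtop continuous_map_seqtop)
    show "range \<psi> \<subseteq> cyl s" by (rule ran)
    show "\<psi> x \<in> CC \<longleftrightarrow> x \<in> CC" for x using psiD D off by blast
    show "\<psi> x \<in> D" if "x \<in> CC" for x using psiD that by blast
    show "\<psi> x \<notin> N" if "x \<notin> CC" for x using off that by blast
    show "(\<psi> x, \<psi> y) \<notin> K" if "x \<noteq> y" for x y
    proof (cases "x \<in> CC")
      case True
      then show ?thesis using psiK[of x y] psiM[of y x] that sym unfolding M_def by blast
    next
      case False
      then show ?thesis using psiM[of x y] that unfolding M_def by blast
    qed
  qed
qed

text \<open>This refinement of the dense set has to precede the selection of an independent one,
because the freedom to choose independent points is not inherited by dense subsets.\<close>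

lemma normalize_unary:
  assumes "finite J" and "\<And>j. j \<in> J \<Longrightarrow> Borel_in cantor (B j)"
  shows "\<exists>D s. D \<subseteq> CC \<and> dense_below D s \<and> (\<forall>j\<in>J. (D \<subseteq> B j \<or> D \<inter> B j = {}) \<and>
    (meagre (B j \<inter> cyl s) \<or> meagre (cyl s - B j)))"
  using assms
proof (induction J rule: finite_induct)
  case empty
  show ?case using CC_dense by blast
next
  case (insert j J)
  then obtain D s where D: "D \<subseteq> CC" "dense_below D s"
    and J: "\<And>j. j \<in> J \<Longrightarrow> (D \<subseteq> B j \<or> D \<inter> B j = {}) \<and> (meagre (B j \<inter> cyl s) \<or> meagre (cyl s - B j))"
    by auto
  obtain w where w: "meagre (B j \<inter> cyl (s @ w)) \<or> meagre (cyl (s @ w) - B j)"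
    using Borel_locally_meagre_or_comeagre insert.prems by blast
  have "\<exists>b\<in>UNIV. \<exists>w'. dense_below (D \<inter> (if b then B j else - B j)) ((s @ w) @ w')"
    by (rule dense_below_finite_cover) (use dense_below_append[OF D(2)] in auto)
  then obtain b w' where b: "dense_below (D \<inter> (if b then B j else - B j)) ((s @ w) @ w')" by blast
  define D' where "D' = D \<inter> (if b then B j else - B j)"
  have sub: "meagre (B k \<inter> cyl (s @ w @ w')) \<or> meagre (cyl (s @ w @ w') - B k)"
    if "meagre (B k \<inter> cyl t) \<or> meagre (cyl t - B k)" "cyl (s @ w @ w') \<subseteq> cyl t" for k t
  proof -
    have "B k \<inter> cyl (s @ w @ w') \<subseteq> B k \<inter> cyl t" "cyl (s @ w @ w') - B k \<subseteq> cyl t - B k"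
      using that(2) by auto
    then show ?thesis using that(1) countably_covered_subset by metis
  qed
  have "\<forall>k\<in>insert j J. (D' \<subseteq> B k \<or> D' \<inter> B k = {}) \<and>
      (meagre (B k \<inter> cyl (s @ w @ w')) \<or> meagre (cyl (s @ w @ w') - B k))"
  proof
    fix k assume "k \<in> insert j J"
    then consider "k = j" | "k \<in> J" by blast
    then show "(D' \<subseteq> B k \<or> D' \<inter> B k = {}) \<and>
      (meagre (B k \<inter> cyl (s @ w @ w')) \<or> meagre (cyl (s @ w @ w') - B k))"
    proof cases
      case 1
      have "cyl (s @ w @ w') \<subseteq> cyl (s @ w)" using cyl_append_subset[of "s @ w" w'] by simp
      then show ?thesis using sub[of k "s @ w"] w 1 unfolding D'_def by auto
    next
      case 2
      have "cyl (s @ w @ w') \<subseteq> cyl s" by (rule cyl_append_subset)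
      then show ?thesis using sub[of k s] J[OF 2] unfolding D'_def by blast
    qed
  qed
  moreover have "D' \<subseteq> CC" using D(1) unfolding D'_def by blast
  moreover have "dense_below D' (s @ w @ w')" using b unfolding D'_def by simp
  ultimately show ?case by blast
qed

text \<open>The assumption on triples says that two points of \<open>CC\<close> with a common neighbour, in the
same way \<open>i\<close>, are unrelated. For the relations considered below this is where
acyclicity enters.\<close>

lemma normalize:
  fixes L :: "'i \<Rightarrow> ((nat \<Rightarrow> bool) \<times> (nat \<Rightarrow> bool)) set" and B :: "'j \<Rightarrow> (nat \<Rightarrow> bool) set"
  assumes I: "finite I" and J: "finite J" and tame: "\<And>i. i \<in> I \<Longrightarrow> tame (L i)"
    and sym: "\<And>x y. (x, y) \<in> (\<Union>i\<in>I. L i) \<Longrightarrow> (y, x) \<in> (\<Union>i\<in>I. L i)"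
    and indep: "\<And>i e d d'. i \<in> I \<Longrightarrow> e \<in> CC \<Longrightarrow> d \<in> CC \<Longrightarrow> d' \<in> CC \<Longrightarrow> d \<noteq> e \<Longrightarrow> d' \<noteq> e \<Longrightarrow> d \<noteq> d' \<Longrightarrow>
      (d, e) \<in> L i \<Longrightarrow> (d', e) \<in> L i \<Longrightarrow> (d, d') \<notin> (\<Union>i\<in>I. L i)"
    and Borel: "\<And>j. j \<in> J \<Longrightarrow> Borel_in cantor (B j)"
  obtains \<psi> where "continuous_map cantor cantor \<psi>" "inj \<psi>" "\<And>x. \<psi> x \<in> CC \<longleftrightarrow> x \<in> CC"
    "\<And>i x y. i \<in> I \<Longrightarrow> x \<noteq> y \<Longrightarrow> (\<psi> x, \<psi> y) \<notin> L i"
    "\<And>j. j \<in> J \<Longrightarrow> \<exists>i<4. \<psi> -` B j = Sset i"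
proof -
  define K where "K = (\<Union>i\<in>I. L i)"
  obtain D0 s0 where D0: "D0 \<subseteq> CC" "dense_below D0 s0" and
    unary: "\<And>j. j \<in> J \<Longrightarrow> (D0 \<subseteq> B j \<or> D0 \<inter> B j = {}) \<and> (meagre (B j \<inter> cyl s0) \<or> meagre (cyl s0 - B j))"
    using normalize_unary[OF J, of B] Borel by blast
  have indep0: "(d, d') \<notin> (\<Union>i\<in>I. L i)"
    if "i \<in> I" "e \<in> D0" "d \<in> D0" "d' \<in> D0" "d \<noteq> e" "d' \<noteq> e" "d \<noteq> d'" "(d, e) \<in> L i" "(d', e) \<in> L i" for i e d d'
    using indep[of i e d d'] that D0(1) by blast
  obtain D w where D: "D \<subseteq> D0" and sel: "\<And>E w'. finite E \<Longrightarrow> E \<subseteq> D \<Longrightarrow>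
    \<exists>d\<in>D \<inter> cyl ((s0 @ w) @ w'). \<forall>e\<in>E. d \<noteq> e \<and> (d, e) \<notin> K \<and> (e, d) \<notin> K"
  proof (rule independent_selection[OF I D0(2)])
    show "(y, x) \<in> (\<Union>i\<in>I. L i)" if "(x, y) \<in> (\<Union>i\<in>I. L i)" for x y using that by (rule sym)
    show "(d, d') \<notin> (\<Union>i\<in>I. L i)"
      if "i \<in> I" "e \<in> D0" "d \<in> D0" "d' \<in> D0" "d \<noteq> e" "d' \<noteq> e" "d \<noteq> d'" "(d, e) \<in> L i" "(d', e) \<in> L i" for i e d d'
      using that by (rule indep0)
  qed (auto simp: K_def)
  \<comment> \<open>The exceptional generic points of the \<open>j\<close>-th diagonal part.\<close>
  define N where "N j = (if meagre (B j \<inter> cyl s0) then B j \<inter> cyl s0 else cyl s0 - B j)" for j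
  define NJ where "NJ = (\<Union>j\<in>J. N j)"
  define KI where "KI = K \<union> Id"
  have "tame K" unfolding K_def using I tame by (intro countably_covered_UN) (auto intro: countable_finite)
  then have tK: "tame KI"
    using countably_covered_self[of thin, OF thin_Id] unfolding KI_def by (rule countably_covered_Un)
  have mN: "meagre NJ"
    unfolding NJ_def using J unary by (intro countably_covered_UN) (auto simp: N_def intro: countable_finite)
  have symK: "(y, x) \<in> KI" if "(x, y) \<in> KI" for x y using sym that unfolding KI_def K_def by blast
  have DC: "D \<subseteq> CC" using D D0(1) by blast
  have sel': "\<exists>d\<in>D \<inter> cyl ((s0 @ w) @ w'). \<forall>e\<in>E. (d, e) \<notin> KI" if "finite E" "E \<subseteq> D" for E w'
    using sel[OF that, of w'] by (auto simp: KI_def)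
  obtain \<psi> where \<psi>: "continuous_map cantor cantor \<psi>" "\<And>x. \<psi> x \<in> CC \<longleftrightarrow> x \<in> CC" "range \<psi> \<subseteq> cyl (s0 @ w)"
    and rational: "\<And>x. x \<in> CC \<Longrightarrow> \<psi> x \<in> D" and NJ: "\<And>x. x \<notin> CC \<Longrightarrow> \<psi> x \<notin> NJ"
    and KI: "\<And>x y. x \<noteq> y \<Longrightarrow> (\<psi> x, \<psi> y) \<notin> KI"
    using thinning_CC[OF DC tK symK mN sel'] by blast
  have generic: "\<forall>j\<in>J. \<psi> x \<notin> N j" if "x \<notin> CC" for x using NJ[OF that] by (simp add: NJ_def)
  have notKI: "(\<psi> x, \<psi> y) \<notin> K \<union> Id" if "x \<noteq> y" for x y using KI[OF that] by (simp add: KI_def)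
  show thesis
  proof
    show "continuous_map cantor cantor \<psi>" by (rule \<psi>(1))
    show "inj \<psi>" using notKI unfolding inj_on_def by auto
    show "\<psi> x \<in> CC \<longleftrightarrow> x \<in> CC" for x by (rule \<psi>(2))
    show "(\<psi> x, \<psi> y) \<notin> L i" if "i \<in> I" "x \<noteq> y" for i x y
      using notKI[OF that(2)] that(1) unfolding K_def by blast
    show "\<exists>i<4. \<psi> -` B j = Sset i" if j: "j \<in> J" for j
    proof -
      have s0: "\<psi> x \<in> cyl s0" for x using \<psi>(3) cyl_append_subset by blast
      have off: "(\<forall>x. x \<notin> CC \<longrightarrow> \<psi> x \<in> B j) \<or> (\<forall>x. x \<notin> CC \<longrightarrow> \<psi> x \<notin> B j)"
      proof (cases "meagre (B j \<inter> cyl s0)")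
        case True
        then have "N j = B j \<inter> cyl s0" by (simp add: N_def)
        then show ?thesis using generic s0 j by auto
      next
        case False
        then have "N j = cyl s0 - B j" by (simp add: N_def)
        then show ?thesis using generic s0 j by auto
      qed
      have on: "(\<forall>x\<in>CC. \<psi> x \<in> B j) \<or> (\<forall>x\<in>CC. \<psi> x \<notin> B j)"
        using unary[OF j] rational D by fast
      have S: "Sset 0 = CC" "Sset 1 = {}" "Sset 2 = - CC" "Sset 3 = UNIV" by (auto simp: Sset_def)
      consider "\<forall>x. x \<notin> CC \<longrightarrow> \<psi> x \<in> B j" "\<forall>x\<in>CC. \<psi> x \<in> B j" | "\<forall>x. x \<notin> CC \<longrightarrow> \<psi> x \<in> B j" "\<forall>x\<in>CC. \<psi> x \<notin> B j"
        | "\<forall>x. x \<notin> CC \<longrightarrow> \<psi> x \<notin> B j" "\<forall>x\<in>CC. \<psi> x \<in> B j" | "\<forall>x. x \<notin> CC \<longrightarrow> \<psi> x \<notin> B j" "\<forall>x\<in>CC. \<psi> x \<notin> B j"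
        using off on by blast
      then show ?thesis
      proof cases
        case 1
        then have "\<psi> -` B j = Sset 3" unfolding S by blast
        then show ?thesis by (intro exI[of _ 3]) simp
      next
        case 2
        then have "\<psi> -` B j = Sset 2" unfolding S by blast
        then show ?thesis by (intro exI[of _ 2]) simp
      next
        case 3
        then have "\<psi> -` B j = Sset 0" unfolding S by blast
        then show ?thesis by (intro exI[of _ 0]) simp
      next
        case 4
        then have "\<psi> -` B j = Sset 1" unfolding S by blast
        then show ?thesis by (intro exI[of _ 1]) simp
      qed
    qed
  qed
qed

section \<open>Embedding injective configurations\<close>

lemma Borel_in_preimage:
  assumes B: "Borel_in Y B" and f: "continuous_map X Y f"
  shows "Borel_in X {x \<in> topspace X. f x \<in> B}"
proof -
  have "B \<in> sigma_sets (topspace Y) {U. openin Y U}" using B by (simp add: Borel_in_def)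
  then have "{x \<in> topspace X. f x \<in> B} \<in> sigma_sets (topspace X) {U. openin X U}"
  proof (induction rule: sigma_sets.induct)
    case (Basic U)
    then show ?case using openin_continuous_map_preimage[OF f] by (intro sigma_sets.Basic) auto
  next
    case Empty
    then show ?case by (simp add: sigma_sets.Empty)
  next
    case (Compl a)
    have "{x \<in> topspace X. f x \<in> topspace Y - a} = topspace X - {x \<in> topspace X. f x \<in> a}"
      using continuous_map_funspace[OF f] by auto
    then show ?case using sigma_sets.Compl[OF Compl(2)] by simp
  next
    case (Union a)
    have "{x \<in> topspace X. f x \<in> \<Union> (range a)} = (\<Union>i. {x \<in> topspace X. f x \<in> a i})" by blast
    then show ?case using sigma_sets.Union[OF Union(2)] by simp
  qed
  then show ?thesis by (simp add: Borel_in_def)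
qed

lemma Borel_in_Un: "Borel_in X A \<Longrightarrow> Borel_in X B \<Longrightarrow> Borel_in X (A \<union> B)"
  unfolding Borel_in_def by (rule sigma_sets_Un)

lemma Borel_in_converse:
  assumes "Borel_in (prod_topology X X) R" shows "Borel_in (prod_topology X X) (R\<inverse>)"
proof -
  have c: "continuous_map (prod_topology X X) (prod_topology X X) (\<lambda>p. (snd p, fst p))"
    by (intro continuous_map_pairedI continuous_map_fst continuous_map_snd)
  have "{U. openin (prod_topology X X) U} \<subseteq> Pow (topspace (prod_topology X X))"
    using openin_subset by blast
  from sigma_sets_into_sp[OF this, of R] have "R \<subseteq> topspace X \<times> topspace X"
    using assms unfolding Borel_in_def by simp
  then have "{p \<in> topspace (prod_topology X X). (snd p, fst p) \<in> R} = R\<inverse>" by auto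
  then show ?thesis using Borel_in_preimage[OF assms c] by simp
qed

lemma symmetrization_iff: "(x, y) \<in> symmetrization R \<longleftrightarrow> (x, y) \<in> R \<or> (y, x) \<in> R"
  by (auto simp: symmetrization_def)

lemma locally_countable_symmetrization:
  assumes "locally_countable R" shows "locally_countable (symmetrization R)"
proof -
  have "{y. (x, y) \<in> symmetrization R} = {y. (x, y) \<in> R} \<union> {y. (y, x) \<in> R}" for x
    by (auto simp: symmetrization_iff)
  moreover have "{x. (x, y) \<in> symmetrization R} = {x. (x, y) \<in> R} \<union> {x. (y, x) \<in> R}" for y
    by (auto simp: symmetrization_iff)
  ultimately show ?thesis using assms unfolding locally_countable_def by simp
qed

lemma no_cycle_list:
  assumes "path_acyclic S" "distinct xs" "length xs \<ge> 3"
    "\<And>i. Suc i < length xs \<Longrightarrow> (xs ! i, xs ! Suc i) \<in> S" "(last xs, hd xs) \<in> S"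
  shows False
proof -
  define n where "n = length xs - 1"
  have "inj_on (\<lambda>i. xs ! i) {..n}" using assms(2,3) by (auto simp: inj_on_def n_def nth_eq_iff_index_eq)
  moreover have "\<forall>i<n. (xs ! i, xs ! Suc i) \<in> S" using assms(4) by (auto simp: n_def)
  moreover have "(xs ! n, xs ! 0) \<in> S"
  proof -
    have "xs \<noteq> []" using assms(3) by auto
    then show ?thesis using assms(5) by (simp add: n_def last_conv_nth hd_conv_nth)
  qed
  moreover have "n \<ge> 2" using assms(3) by (simp add: n_def)
  ultimately show False using assms(1) unfolding path_acyclic_def by blast
qed

lemma no_cycle_3:
  assumes "path_acyclic S" "distinct [a, b, c]" "(a, b) \<in> S" "(b, c) \<in> S" "(c, a) \<in> S" shows False
  by (rule no_cycle_list[OF assms(1,2)]) (use assms(3-) in \<open>auto simp: less_Suc_eq numeral_eq_Suc\<close>)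

lemma no_cycle_4:
  assumes "path_acyclic S" "distinct [a, b, c, d]" "(a, b) \<in> S" "(b, c) \<in> S" "(c, d) \<in> S" "(d, a) \<in> S"
  shows False
  by (rule no_cycle_list[OF assms(1,2)]) (use assms(3-) in \<open>auto simp: less_Suc_eq numeral_eq_Suc\<close>)

lemma no_cycle_5:
  assumes "path_acyclic S" "distinct [a, b, c, d, e]" "(a, b) \<in> S" "(b, c) \<in> S" "(c, d) \<in> S" "(d, e) \<in> S"
    "(e, a) \<in> S"
  shows False
  by (rule no_cycle_list[OF assms(1,2)]) (use assms(3-) in \<open>auto simp: less_Suc_eq numeral_eq_Suc\<close>)

lemma c_embI:
  assumes "continuous_map X Y f" "inj_on f (topspace X)"
    "\<And>x y. x \<in> topspace X \<Longrightarrow> y \<in> topspace X \<Longrightarrow> (x, y) \<in> A \<longleftrightarrow> (f x, f y) \<in> B"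
    "A \<subseteq> topspace X \<times> topspace X"
  shows "(X, A) \<sqsubseteq>\<^sub>c (Y, B)"
  unfolding c_emb_def c_reduction_def using assms by (intro exI[of _ f]) auto

lemma Sset_simps: "Sset 0 = CC" "Sset (Suc 0) = {}" "Sset 2 = - CC" "Sset 3 = UNIV"
  by (auto simp: Sset_def)

lemma uncountable_Compl_CC: "uncountable (- CC)"
proof
  assume "countable (- CC)"
  then have "countable (CC \<union> - CC)" using countable_CC by (rule countable_Un[rotated])
  then have "countable (cyl [] :: (nat \<Rightarrow> bool) set)" by (simp add: Compl_partition)
  then show False using countable_meagre cyl_not_meagre by blast
qed

lemma less_4_cases: "(i :: nat) < 4 \<Longrightarrow> i = 0 \<or> i = 1 \<or> i = 2 \<or> i = 3"
  by auto

lemma CC_ne: "CC \<noteq> {}" "CC \<noteq> UNIV" "CC \<noteq> - CC"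
proof -
  show "CC \<noteq> {}" using CC_dense[of "[]"] unfolding dense_below_def by blast
  have "(- CC) \<noteq> {}" using uncountable_Compl_CC by (metis countable_empty)
  then show "CC \<noteq> UNIV" by blast
  show "CC \<noteq> - CC" using \<open>CC \<noteq> {}\<close> by blast
qed

lemma Sset_inject: "i < 4 \<Longrightarrow> j < 4 \<Longrightarrow> Sset i = Sset j \<Longrightarrow> i = j"
  using CC_ne by (auto dest!: less_4_cases simp: Sset_def)

lemma countable_Sset: "i < 4 \<Longrightarrow> countable (Sset i) \<Longrightarrow> i = 0 \<or> i = 1"
proof -
  assume i: "i < 4" and c: "countable (Sset i)"
  have "\<not> - CC \<subseteq> Sset i" using c uncountable_Compl_CC countable_subset by blast
  then show ?thesis using less_4_cases[OF i] by (auto simp: Sset_simps)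
qed

lemma one_cons_inject: "one_cons \<alpha> = one_cons \<beta> \<longleftrightarrow> \<alpha> = \<beta>"
  unfolding one_cons_def by (metis nat.case(2) ext)

lemma one_cons_ne_zeros: "one_cons \<alpha> \<noteq> zeros" "zeros \<noteq> one_cons \<alpha>"
  unfolding one_cons_def zeros_def by (metis nat.case(1))+

lemma range_one_cons: "range one_cons = {\<alpha>. \<alpha> 0}"
proof
  have "\<alpha> = one_cons (\<alpha> \<circ> Suc)" if "\<alpha> 0" for \<alpha>
    using that by (auto simp: one_cons_def fun_eq_iff split: nat.split)
  then show "{\<alpha>. \<alpha> 0} \<subseteq> range one_cons" by blast
  show "range one_cons \<subseteq> {\<alpha>. \<alpha> 0}" by (auto simp: one_cons_def)
qed

lemma topspace_SS: "topspace SS = {zeros} \<union> range one_cons"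
  unfolding range_one_cons by (simp add: SS_def)

lemma SS_cases:
  assumes "x \<in> topspace SS" obtains "x = zeros" | \<alpha> where "x = one_cons \<alpha>"
  using assms unfolding topspace_SS by blast

text \<open>The setting for the embedding results: all that is assumed of the given relation except that it is
not $G_\delta$.\<close>

locale acyclic_relation =
  fixes X :: "'a topology" and R :: "('a \<times> 'a) set"
  assumes analytic: "analytic_space X" and R_sub: "R \<subseteq> topspace X \<times> topspace X"
    and Borel: "Borel_in (prod_topology X X) R" and loc: "locally_countable R" and acyc: "s_acyclic R"
begin

abbreviation S :: "('a \<times> 'a) set" where "S \<equiv> symmetrization R"

lemma S_acyclic: "path_acyclic S" using acyc by (simp add: s_acyclic_def)

lemma S_sym: "(x, y) \<in> S \<Longrightarrow> (y, x) \<in> S" by (auto simp: symmetrization_iff)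

lemma metX: "metrizable_space X" using analytic by (simp add: analytic_space_def)

lemma hausX: "Hausdorff_space X" using metX by (rule metrizable_imp_Hausdorff_space)

lemma pullback_Borel:
  assumes "continuous_map Z X p" "continuous_map Z X q"
  shows "Borel_in Z {x \<in> topspace Z. (p x, q x) \<in> R}"
  using Borel_in_preimage[OF Borel continuous_map_pairedI[OF assms]] by simp

lemma pullback_Borel_cantor:
  assumes "continuous_map cantor X p" "continuous_map cantor X q"
  shows "Borel_in cantor {x. (p x, q x) \<in> R}"
  using pullback_Borel[OF assms] by simp

lemma pullback_tame:
  assumes p: "continuous_map cantor X p" "inj p" and q: "continuous_map cantor X q" "inj q"
  shows "tame {(x, y). (p x, q y) \<in> S}"
proof (rule Borel_locally_countable_tame)
  have BS: "Borel_in (prod_topology X X) S"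
    unfolding symmetrization_def using Borel Borel_in_converse by (blast intro: Borel_in_Un)
  have "continuous_map (prod_topology cantor cantor) (prod_topology X X) (\<lambda>z. ((p \<circ> fst) z, (q \<circ> snd) z))"
    using p q by (intro continuous_map_pairedI continuous_map_compose[OF continuous_map_fst] continuous_map_compose[OF continuous_map_snd])
  from Borel_in_preimage[OF BS this]
  show "Borel_in (prod_topology cantor cantor) {(x, y). (p x, q y) \<in> S}"
    by (simp add: case_prod_beta')
  have cS: "locally_countable S" using loc by (rule locally_countable_symmetrization)
  show "countable {y. (x, y) \<in> {(x, y). (p x, q y) \<in> S}}" for x
  proof -
    have "countable {z. (p x, z) \<in> S}" using cS by (simp add: locally_countable_def)
    then have "countable (q -` {z. (p x, z) \<in> S})" using countable_image_inj_on[of q] q(2)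
      by (metis countable_subset image_vimage_subset inj_on_subset subset_UNIV)
    then show ?thesis by (simp add: vimage_def)
  qed
  show "countable {x. (x, y) \<in> {(x, y). (p x, q y) \<in> S}}" for y
  proof -
    have "countable {z. (z, q y) \<in> S}" using cS by (simp add: locally_countable_def)
    then have "countable (p -` {z. (z, q y) \<in> S})" using countable_image_inj_on[of p] p(2)
      by (metis countable_subset image_vimage_subset inj_on_subset subset_UNIV)
    then show ?thesis by (simp add: vimage_def)
  qed
qed

text \<open>Two adjacent points with a common neighbour would form a triangle with it.\<close>

lemma embed_diagonal:
  assumes f: "continuous_map cantor X f" "inj f" and loops: "\<And>x. (f x, f x) \<in> R \<longleftrightarrow> x \<in> CC"
  shows "(cantor, {(x, x) | x. x \<in> CC}) \<sqsubseteq>\<^sub>c (X, R)"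
proof -
  define L where "L = (\<lambda>_ :: unit. {(x, y). (f x, f y) \<in> S})"
  obtain \<psi> where \<psi>: "continuous_map cantor cantor \<psi>" "inj \<psi>" "\<And>x. \<psi> x \<in> CC \<longleftrightarrow> x \<in> CC"
    and off: "\<And>i x y. i \<in> UNIV \<Longrightarrow> x \<noteq> y \<Longrightarrow> (\<psi> x, \<psi> y) \<notin> L i"
  proof (rule normalize[of UNIV "{} :: unit set" L "\<lambda>_. {}"])
    show "tame (L i)" for i unfolding L_def by (rule pullback_tame[OF f f])
    show "(y, x) \<in> (\<Union>i\<in>UNIV. L i)" if "(x, y) \<in> (\<Union>i\<in>UNIV. L i)" for x y
      using that S_sym by (auto simp: L_def)
    show "(d, d') \<notin> (\<Union>i\<in>UNIV. L i)" if "d \<noteq> e" "d' \<noteq> e" "d \<noteq> d'" "(d, e) \<in> L i" "(d', e) \<in> L i" for i e d d'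
    proof
      assume "(d, d') \<in> (\<Union>i\<in>UNIV. L i)"
      then have "(f d, f d') \<in> S" "(f d, f e) \<in> S" "(f d', f e) \<in> S" using that(4,5) by (auto simp: L_def)
      moreover have "distinct [f d, f d', f e]" using that(1-3) f(2) by (auto simp: inj_eq)
      ultimately show False using no_cycle_3[OF S_acyclic, of "f d" "f d'" "f e"] S_sym by blast
    qed
  qed auto
  show ?thesis
  proof (rule c_embI[of _ _ "f \<circ> \<psi>"])
    show "continuous_map cantor X (f \<circ> \<psi>)" by (rule continuous_map_compose[OF \<psi>(1) f(1)])
    show "inj_on (f \<circ> \<psi>) (topspace cantor)" using f(2) \<psi>(2) by (simp add: inj_compose)
    show "(x, y) \<in> {(x, x) | x. x \<in> CC} \<longleftrightarrow> ((f \<circ> \<psi>) x, (f \<circ> \<psi>) y) \<in> R" for x y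
    proof (cases "x = y")
      case True
      then show ?thesis using loops[of "\<psi> y"] \<psi>(3)[of y] by auto
    next
      case False
      then have "(f (\<psi> x), f (\<psi> y)) \<notin> S" using off[of "()" x y] by (auto simp: L_def)
      then show ?thesis using False by (auto simp: symmetrization_iff)
    qed
  qed auto
qed

text \<open>Here two disjoint sheets are joined by the matching between \<open>f False x\<close> and \<open>f True x\<close>, for
\<open>x\<close> in \<open>CC\<close>. If \<open>d\<close> and \<open>d'\<close> in \<open>CC\<close> have a common neighbour \<open>p\<close>, then with the
matching edges the four points over \<open>d\<close> and \<open>d'\<close> and the point \<open>p\<close> form a path,
so any further edge between the points over \<open>d\<close> and those over \<open>d'\<close> closes a cycle of length at most five.\<close>

lemma embed_double:
  fixes f :: "bool \<Rightarrow> (nat \<Rightarrow> bool) \<Rightarrow> 'a"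
  assumes f: "\<And>\<epsilon>. continuous_map cantor X (f \<epsilon>)" and inj: "\<And>\<epsilon> \<eta> x y. f \<epsilon> x = f \<eta> y \<Longrightarrow> \<epsilon> = \<eta> \<and> x = y"
    and edges: "\<And>x. (f False x, f True x) \<in> R \<longleftrightarrow> x \<in> CC"
  shows "(cantor, {(x, x) | x. x \<in> CC}) \<sqsubseteq>\<^sub>c (X, R) \<or> (\<exists>t\<in>PP. (DD, RR t) \<sqsubseteq>\<^sub>c (X, R))"
proof -
  define L where "L = (\<lambda>(\<epsilon>, \<eta>). {(x, y). (f \<epsilon> x, f \<eta> y) \<in> S})"
  define B where "B = (\<lambda>(\<epsilon>, \<eta>). {x. (f \<epsilon> x, f \<eta> x) \<in> R})"
  have finj: "inj (f \<epsilon>)" for \<epsilon> using inj by (auto simp: inj_def)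
  have fne: "f \<epsilon> x \<noteq> f \<eta> y" if "\<epsilon> \<noteq> \<eta> \<or> x \<noteq> y" for \<epsilon> \<eta> x y using inj that by blast
  have matching: "(f \<epsilon> x, f (\<not> \<epsilon>) x) \<in> S" if "x \<in> CC" for \<epsilon> x
    using edges[of x] that by (cases \<epsilon>) (auto simp: symmetrization_iff)
  obtain \<psi> where \<psi>: "continuous_map cantor cantor \<psi>" "inj \<psi>" "\<And>x. \<psi> x \<in> CC \<longleftrightarrow> x \<in> CC"
    and off: "\<And>i x y. i \<in> UNIV \<Longrightarrow> x \<noteq> y \<Longrightarrow> (\<psi> x, \<psi> y) \<notin> L i"
    and diag: "\<And>j. j \<in> UNIV \<Longrightarrow> \<exists>i<4. \<psi> -` B j = Sset i"
  proof (rule normalize[of UNIV UNIV L B])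
    show "tame (L i)" for i unfolding L_def by (cases i) (simp, rule pullback_tame[OF f finj f finj])
    show "(y, x) \<in> (\<Union>i\<in>UNIV. L i)" if xy: "(x, y) \<in> (\<Union>i\<in>UNIV. L i)" for x y
    proof -
      obtain i where "(x, y) \<in> L i" using xy by blast
      moreover obtain \<epsilon> \<eta> where "i = (\<epsilon>, \<eta>)" by (cases i)
      ultimately have "(f \<epsilon> x, f \<eta> y) \<in> S" by (simp add: L_def)
      then have "(y, x) \<in> L (\<eta>, \<epsilon>)" using S_sym by (auto simp: L_def)
      then show ?thesis by blast
    qed
    show "Borel_in cantor (B j)" for j unfolding B_def by (cases j) (simp add: pullback_Borel_cantor[OF f f])
    show "(d, d') \<notin> (\<Union>i\<in>UNIV. L i)" if "d \<in> CC" "d' \<in> CC" "d \<noteq> e" "d' \<noteq> e" "d \<noteq> d'" "(d, e) \<in> L i" "(d', e) \<in> L i"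
      for i e d d'
    proof
      assume "(d, d') \<in> (\<Union>i\<in>UNIV. L i)"
      then obtain \<alpha> \<beta> where ab: "(f \<alpha> d, f \<beta> d') \<in> S" by (auto simp: L_def)
      obtain \<epsilon> \<eta> where i: "i = (\<epsilon>, \<eta>)" by (cases i)
      define p where "p = f \<eta> e"
      have p: "(f \<epsilon> d, p) \<in> S" "(f \<epsilon> d', p) \<in> S" using that(6,7) by (auto simp: L_def i p_def)
      have m: "(f \<epsilon> d, f (\<not> \<epsilon>) d) \<in> S" "(f \<epsilon> d', f (\<not> \<epsilon>) d') \<in> S" using matching that(1,2) by auto
      have dist: "distinct [f (\<not> \<epsilon>) d, f \<epsilon> d, p, f \<epsilon> d', f (\<not> \<epsilon>) d']"
        using that(3-5) fne unfolding p_def by simp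
      consider "\<alpha> = \<epsilon>" "\<beta> = \<epsilon>" | "\<alpha> = \<epsilon>" "\<beta> = (\<not> \<epsilon>)" | "\<alpha> = (\<not> \<epsilon>)" "\<beta> = \<epsilon>" | "\<alpha> = (\<not> \<epsilon>)" "\<beta> = (\<not> \<epsilon>)"
        by blast
      then show False
      proof cases
        case 1
        then show False using no_cycle_3[OF S_acyclic, of "f \<epsilon> d" p "f \<epsilon> d'"] dist p ab S_sym by simp
      next
        case 2
        then show False
          using no_cycle_4[OF S_acyclic, of "f \<epsilon> d" p "f \<epsilon> d'" "f (\<not> \<epsilon>) d'"] dist p ab m S_sym by simp
      next
        case 3
        then show False
          using no_cycle_4[OF S_acyclic, of "f (\<not> \<epsilon>) d" "f \<epsilon> d" p "f \<epsilon> d'"] dist p ab m S_sym by simp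
      next
        case 4
        then show False
          using no_cycle_5[OF S_acyclic dist] p ab m S_sym by simp
      qed
    qed
  qed auto
  have "\<forall>j. \<exists>i. i < 4 \<and> \<psi> -` B j = Sset i" using diag by blast
  then obtain T where T: "\<And>j. T j < 4 \<and> \<psi> -` B j = Sset (T j)" by metis
  define t where "t \<epsilon> \<eta> = T (\<epsilon>, \<eta>)" for \<epsilon> \<eta>
  have t4: "t \<epsilon> \<eta> < 4" for \<epsilon> \<eta> using T by (simp add: t_def)
  have t: "(f \<epsilon> (\<psi> x), f \<eta> (\<psi> x)) \<in> R \<longleftrightarrow> x \<in> Sset (t \<epsilon> \<eta>)" for \<epsilon> \<eta> x
  proof -
    have "x \<in> \<psi> -` B (\<epsilon>, \<eta>) \<longleftrightarrow> x \<in> Sset (t \<epsilon> \<eta>)" using T unfolding t_def by simp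
    then show ?thesis by (simp add: B_def)
  qed
  have off': "(f \<epsilon> (\<psi> x), f \<eta> (\<psi> y)) \<notin> R" if "x \<noteq> y" for \<epsilon> \<eta> x y
    using off[of "(\<epsilon>, \<eta>)" x y] that by (auto simp: L_def symmetrization_iff)
  have "Sset (t False True) = Sset 0" using t[of False _ True] edges \<psi>(3) by (auto simp: Sset_simps)
  then have t01: "t False True = 0" using Sset_inject t4 by simp
  have embed: "(DD, RR t') \<sqsubseteq>\<^sub>c (X, R)" if t': "\<And>\<epsilon> \<eta>. t' \<epsilon> \<eta> = t (\<epsilon> \<noteq> b) (\<eta> \<noteq> b)" for t' b
  proof (rule c_embI[of _ _ "\<lambda>(\<epsilon>, x). f (\<epsilon> \<noteq> b) (\<psi> x)"])
    show "continuous_map DD X (\<lambda>(\<epsilon>, x). f (\<epsilon> \<noteq> b) (\<psi> x))"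
      unfolding continuous_map_def
    proof (intro conjI allI impI)
      have "f \<epsilon> (\<psi> x) \<in> topspace X" for \<epsilon> x using continuous_map_funspace[OF f] by auto
      then show "(\<lambda>(\<epsilon>, x). f (\<epsilon> \<noteq> b) (\<psi> x)) \<in> topspace DD \<rightarrow> topspace X" by auto
      fix U assume U: "openin X U"
      have o: "openin cantor {x. f \<epsilon> (\<psi> x) \<in> U}" for \<epsilon>
        using openin_continuous_map_preimage[OF continuous_map_compose[OF \<psi>(1) f] U] by simp
      show "openin DD {x \<in> topspace DD. (case x of (\<epsilon>, x) \<Rightarrow> f (\<epsilon> \<noteq> b) (\<psi> x)) \<in> U}"
        unfolding DD_def openin_prod_topology_alt
      proof (intro allI impI)
        fix \<epsilon> x assume a: "(\<epsilon>, x) \<in> {x \<in> topspace (prod_topology (discrete_topology UNIV) cantor). (case x of (\<epsilon>, x) \<Rightarrow> f (\<epsilon> \<noteq> b) (\<psi> x)) \<in> U}"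
        show "\<exists>V W. openin (discrete_topology UNIV) V \<and> openin cantor W \<and> \<epsilon> \<in> V \<and> x \<in> W \<and>
          V \<times> W \<subseteq> {x \<in> topspace (prod_topology (discrete_topology UNIV) cantor). (case x of (\<epsilon>, x) \<Rightarrow> f (\<epsilon> \<noteq> b) (\<psi> x)) \<in> U}"
          by (intro exI[of _ "{\<epsilon>}"] exI[of _ "{x. f (\<epsilon> \<noteq> b) (\<psi> x) \<in> U}"]) (use a o in auto)
      qed
    qed
    show "inj_on (\<lambda>(\<epsilon>, x). f (\<epsilon> \<noteq> b) (\<psi> x)) (topspace DD)"
    proof (rule inj_onI)
      fix p q assume eq: "(case p of (\<epsilon>, x) \<Rightarrow> f (\<epsilon> \<noteq> b) (\<psi> x)) = (case q of (\<epsilon>, x) \<Rightarrow> f (\<epsilon> \<noteq> b) (\<psi> x))"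
      obtain \<epsilon> x \<eta> y where pq: "p = (\<epsilon>, x)" "q = (\<eta>, y)" by (cases p, cases q) auto
      have "f (\<epsilon> \<noteq> b) (\<psi> x) = f (\<eta> \<noteq> b) (\<psi> y)" using eq by (simp add: pq)
      from inj[OF this] show "p = q" using \<psi>(2) by (auto simp: pq inj_eq)
    qed
    show "(p, q) \<in> RR t' \<longleftrightarrow> ((case p of (\<epsilon>, x) \<Rightarrow> f (\<epsilon> \<noteq> b) (\<psi> x)), (case q of (\<epsilon>, x) \<Rightarrow> f (\<epsilon> \<noteq> b) (\<psi> x))) \<in> R" for p q
    proof -
      obtain \<epsilon> x \<eta> y where pq: "p = (\<epsilon>, x)" "q = (\<eta>, y)" by (cases p, cases q) auto
      show ?thesis
      proof (cases "x = y")
        case True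
        then show ?thesis using t[of "\<epsilon> \<noteq> b" x "\<eta> \<noteq> b"] unfolding pq RR_def t' by auto
      next
        case False
        then show ?thesis using off' unfolding pq RR_def by auto
      qed
    qed
    show "RR t' \<subseteq> topspace DD \<times> topspace DD" by (auto simp: DD_def)
  qed
  show ?thesis
  proof (cases "t False False = 0 \<or> t True True = 0")
    case True
    then obtain \<epsilon> where e: "t \<epsilon> \<epsilon> = 0" by auto
    have "(cantor, {(x, x) | x. x \<in> CC}) \<sqsubseteq>\<^sub>c (X, R)"
    proof (rule embed_diagonal[of "f \<epsilon> \<circ> \<psi>"])
      show "continuous_map cantor X (f \<epsilon> \<circ> \<psi>)" by (rule continuous_map_compose[OF \<psi>(1) f])
      show "inj (f \<epsilon> \<circ> \<psi>)" using finj \<psi>(2) by (rule inj_compose)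
      show "((f \<epsilon> \<circ> \<psi>) x, (f \<epsilon> \<circ> \<psi>) x) \<in> R \<longleftrightarrow> x \<in> CC" for x using t[of \<epsilon> x \<epsilon>] e by (simp add: Sset_simps)
    qed
    then show ?thesis ..
  next
    case ne: False
    show ?thesis
    proof (cases "t True False = 0 \<longrightarrow> t False False \<le> t True True")
      case True
      then have "t \<in> PP" using ne t4 t01 by (auto simp: PP_def tables_def)
      then show ?thesis using embed[of t False] by auto
    next
      case False
      \<comment> \<open>Exchange the two sheets.\<close>
      define t' where "t' \<epsilon> \<eta> = t (\<not> \<epsilon>) (\<not> \<eta>)" for \<epsilon> \<eta>
      have "t' \<in> PP" using False ne t4 t01 by (auto simp: PP_def tables_def t'_def)
      then show ?thesis using embed[of t' True] by (auto simp: t'_def)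
    qed
  qed
qed

text \<open>All points \<open>f x\<close> with \<open>x\<close> in \<open>CC\<close> are neighbours of \<open>p\<close>, so no two of them are related. The
edges between \<open>p\<close> and the sheet are countably many in either direction, and a countable
\<open>Sset i\<close> is \<open>CC\<close> or empty.\<close>

lemma embed_star:
  assumes f: "continuous_map cantor X f" "inj f" and p: "p \<in> topspace X" "p \<notin> range f"
    and edges: "(\<forall>x. (p, f x) \<in> R \<longleftrightarrow> x \<in> CC) \<or> (\<forall>x. (f x, p) \<in> R \<longleftrightarrow> x \<in> CC)"
  shows "(cantor, {(x, x) | x. x \<in> CC}) \<sqsubseteq>\<^sub>c (X, R) \<or> (\<exists>t\<in>PPa. (SS, RRa t) \<sqsubseteq>\<^sub>c (X, R))"
proof -
  define L where "L = (\<lambda>_ :: unit. {(x, y). (f x, f y) \<in> S})"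
  define P where "P = (\<lambda>b x. if b then f x else p)"
  define B where "B = (\<lambda>(\<epsilon>, \<eta>). {x. (P \<epsilon> x, P \<eta> x) \<in> R})"
  have Pc: "continuous_map cantor X (P b)" for b
    using f(1) p(1) by (cases b) (simp_all add: P_def)
  have pS: "(p, f x) \<in> S" if "x \<in> CC" for x using edges that by (auto simp: symmetrization_iff)
  obtain \<psi> where \<psi>: "continuous_map cantor cantor \<psi>" "inj \<psi>" "\<And>x. \<psi> x \<in> CC \<longleftrightarrow> x \<in> CC"
    and off: "\<And>i x y. i \<in> UNIV \<Longrightarrow> x \<noteq> y \<Longrightarrow> (\<psi> x, \<psi> y) \<notin> L i"
    and diag: "\<And>j. j \<in> UNIV \<Longrightarrow> \<exists>i<4. \<psi> -` B j = Sset i"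
  proof (rule normalize[of UNIV UNIV L B])
    show "tame (L i)" for i unfolding L_def by (rule pullback_tame[OF f f])
    show "(y, x) \<in> (\<Union>i\<in>UNIV. L i)" if "(x, y) \<in> (\<Union>i\<in>UNIV. L i)" for x y
      using that S_sym by (auto simp: L_def)
    show "Borel_in cantor (B j)" for j unfolding B_def by (cases j) (simp add: pullback_Borel_cantor[OF Pc Pc])
    show "(d, d') \<notin> (\<Union>i\<in>UNIV. L i)" if "d \<in> CC" "d' \<in> CC" "d \<noteq> d'" for d d'
    proof
      assume "(d, d') \<in> (\<Union>i\<in>UNIV. L i)"
      then have "(f d, f d') \<in> S" by (auto simp: L_def)
      moreover have "distinct [p, f d, f d']" using that(3) f(2) p(2) by (auto simp: inj_eq)
      ultimately show False using no_cycle_3[OF S_acyclic] pS[OF that(1)] pS[OF that(2)] S_sym by blast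
    qed
  qed auto
  have "\<forall>j. \<exists>i. i < 4 \<and> \<psi> -` B j = Sset i" using diag by blast
  then obtain T where T: "\<And>j. T j < 4 \<and> \<psi> -` B j = Sset (T j)" by metis
  define t where "t \<epsilon> \<eta> = (if \<epsilon> \<or> \<eta> then T (\<epsilon>, \<eta>) else if (p, p) \<in> R then 1 else 0)" for \<epsilon> \<eta>
  have t4: "t \<epsilon> \<eta> < 4" for \<epsilon> \<eta> using T by (simp add: t_def)
  have t: "(P \<epsilon> (\<psi> x), P \<eta> (\<psi> x)) \<in> R \<longleftrightarrow> x \<in> Sset (t \<epsilon> \<eta>)" if "\<epsilon> \<or> \<eta>" for \<epsilon> \<eta> x
  proof -
    have "x \<in> \<psi> -` B (\<epsilon>, \<eta>) \<longleftrightarrow> x \<in> Sset (t \<epsilon> \<eta>)" using T that unfolding t_def by simp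
    then show ?thesis by (simp add: B_def)
  qed
  have off': "(f (\<psi> x), f (\<psi> y)) \<notin> R" if "x \<noteq> y" for x y
    using off[of "()" x y] that by (auto simp: L_def symmetrization_iff)
  have count: "countable (h -` A)" if "countable A" "inj h" for h :: "(nat \<Rightarrow> bool) \<Rightarrow> 'a" and A
    using countable_image_inj_on[of h] that by (metis countable_subset image_vimage_subset inj_on_subset subset_UNIV)
  have fpsi: "inj (f \<circ> \<psi>)" using f(2) \<psi>(2) by (rule inj_compose)
  have c01: "countable (Sset (t False True))"
  proof -
    have "countable {z. (p, z) \<in> R}" using loc by (simp add: locally_countable_def)
    from count[OF this fpsi] have "countable {x. (p, f (\<psi> x)) \<in> R}" by (simp add: vimage_def)
    then show ?thesis using t[of False True] by (simp add: P_def)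
  qed
  have c10: "countable (Sset (t True False))"
  proof -
    have "countable {z. (z, p) \<in> R}" using loc by (simp add: locally_countable_def)
    from count[OF this fpsi] have "countable {x. (f (\<psi> x), p) \<in> R}" by (simp add: vimage_def)
    then show ?thesis using t[of True False] by (simp add: P_def)
  qed
  have t0: "t False True = 0 \<or> t True False = 0"
    using edges
  proof
    assume "\<forall>x. (p, f x) \<in> R \<longleftrightarrow> x \<in> CC"
    then have "Sset (t False True) = Sset 0" using t[of False True] \<psi>(3) by (auto simp: P_def Sset_simps)
    then show ?thesis using Sset_inject t4 by simp
  next
    assume "\<forall>x. (f x, p) \<in> R \<longleftrightarrow> x \<in> CC"
    then have "Sset (t True False) = Sset 0" using t[of True False] \<psi>(3) by (auto simp: P_def Sset_simps)
    then show ?thesis using Sset_inject t4 by simp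
  qed
  show ?thesis
  proof (cases "t True True = 0")
    case True
    have "(cantor, {(x, x) | x. x \<in> CC}) \<sqsubseteq>\<^sub>c (X, R)"
    proof (rule embed_diagonal[of "f \<circ> \<psi>"])
      show "continuous_map cantor X (f \<circ> \<psi>)" by (rule continuous_map_compose[OF \<psi>(1) f(1)])
      show "inj (f \<circ> \<psi>)" by (rule fpsi)
      show "((f \<circ> \<psi>) x, (f \<circ> \<psi>) x) \<in> R \<longleftrightarrow> x \<in> CC" for x
        using t[of True True x] True by (simp add: Sset_simps P_def)
    qed
    then show ?thesis ..
  next
    case False
    have tP: "t \<in> PPa"
      unfolding PPa_def tables_def
      using False t4 t0 countable_Sset[OF t4 c01] countable_Sset[OF t4 c10] by (auto simp: t_def)
    define g where "g z = (if z 0 then f (\<psi> (z \<circ> Suc)) else p)" for z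
    have g_one: "g (one_cons \<alpha>) = f (\<psi> \<alpha>)" for \<alpha> by (simp add: g_def one_cons_def comp_def)
    have g_zeros: "g zeros = p" by (simp add: g_def zeros_def)
    have fp: "f x \<noteq> p" "p \<noteq> f x" for x using p(2) by auto
    have "(SS, RRa t) \<sqsubseteq>\<^sub>c (X, R)"
    proof (rule c_embI[of _ _ g])
      have "cont_on UNIV X g"
      proof (rule cont_onI)
        show "g z \<in> topspace X" for z
          using p(1) continuous_map_funspace[OF f(1)] by (auto simp: g_def)
        fix z V assume V: "openin X V" "g z \<in> V"
        show "\<exists>n. \<forall>x\<in>UNIV. pre x n = pre z n \<longrightarrow> g x \<in> V"
        proof (cases "z 0")
          case True
          have "cont_on UNIV X (f \<circ> \<psi>)"
            using continuous_map_compose[OF \<psi>(1) f(1)] unfolding cantor_eq_seqtop continuous_map_seqtop .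
          then obtain n where n: "\<And>x. pre x n = pre (z \<circ> Suc) n \<Longrightarrow> (f \<circ> \<psi>) x \<in> V"
            using cont_onD[of UNIV X "f \<circ> \<psi>" "z \<circ> Suc" V] V True by (auto simp: g_def)
          have "g x \<in> V" if "pre x (Suc n) = pre z (Suc n)" for x
            using that n[of "x \<circ> Suc"] True unfolding pre_Suc_shift g_def by simp
          then show ?thesis by blast
        next
          case False
          have "g x \<in> V" if "pre x (Suc 0) = pre z (Suc 0)" for x
            using that False V unfolding pre_Suc_shift g_def by simp
          then show ?thesis by blast
        qed
      qed
      then show "continuous_map SS X g"
        unfolding SS_def by (intro continuous_map_from_subtopology) (simp add: cantor_eq_seqtop continuous_map_seqtop)
      show "inj_on g (topspace SS)"
        unfolding topspace_SS inj_on_def using f(2) \<psi>(2) fp by (auto simp: g_one g_zeros inj_eq)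
      show "RRa t \<subseteq> topspace SS \<times> topspace SS" unfolding topspace_SS by (auto simp: RRa_def)
      fix x y assume "x \<in> topspace SS" "y \<in> topspace SS"
      then consider "x = zeros" "y = zeros" | \<beta> where "x = zeros" "y = one_cons \<beta>"
        | \<alpha> where "x = one_cons \<alpha>" "y = zeros" | \<alpha> \<beta> where "x = one_cons \<alpha>" "y = one_cons \<beta>"
        unfolding topspace_SS by blast
      then show "(x, y) \<in> RRa t \<longleftrightarrow> (g x, g y) \<in> R"
      proof cases
        case 1
        then show ?thesis by (simp add: RRa_def one_cons_ne_zeros g_zeros t_def)
      next
        case 2
        then show ?thesis using t[of False True \<beta>] by (simp add: RRa_def one_cons_ne_zeros one_cons_inject g_zeros g_one P_def)
      next
        case 3
        then show ?thesis using t[of True False \<alpha>] by (simp add: RRa_def one_cons_ne_zeros one_cons_inject g_zeros g_one P_def)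
      next
        case 4
        show ?thesis
        proof (cases "\<alpha> = \<beta>")
          case True
          then show ?thesis using 4 t[of True True \<alpha>] by (simp add: RRa_def one_cons_ne_zeros one_cons_inject g_one P_def)
        next
          case False
          then show ?thesis using 4 off'[of \<alpha> \<beta>] by (auto simp: RRa_def one_cons_ne_zeros one_cons_inject g_one)
        qed
      qed
    qed
    then show ?thesis using tP by blast
  qed
qed

end

section \<open>From a non-$G_\delta$ relation to an injective configuration\<close>

text \<open>The canonical homeomorphism onto the cylinder of \<open>s\<close>, used to replace a cylinder by the
whole Cantor space.\<close>

definition shift :: "bool list \<Rightarrow> (nat \<Rightarrow> bool) \<Rightarrow> nat \<Rightarrow> bool" where
  "shift s x i = (if i < length s then s ! i else x (i - length s))"

lemma shift_in_cyl: "shift s x \<in> cyl s"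
  by (simp add: cyl_iff_nth shift_def)

lemma shift_surj: "x \<in> cyl (s @ u) \<Longrightarrow> \<exists>y\<in>cyl u. x = shift s y"
proof -
  assume x: "x \<in> cyl (s @ u)"
  define y where "y i = x (i + length s)" for i
  have "x = shift s y"
    using x by (auto simp: fun_eq_iff shift_def y_def cyl_iff_nth nth_append)
  moreover have "y \<in> cyl u"
    using x by (auto simp: y_def cyl_iff_nth nth_append dest: spec[of _ "_ + length s"])
  ultimately show ?thesis by blast
qed

lemma shift_CC: "shift s x \<in> CC \<longleftrightarrow> x \<in> CC"
proof
  assume "x \<in> CC"
  then have fin: "finite ((\<lambda>i. i + length s) ` {n. x n})" by (simp add: CC_def)
  have "{n. shift s x n} \<subseteq> {..<length s} \<union> (\<lambda>i. i + length s) ` {n. x n}"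
  proof
    fix n assume n: "n \<in> {n. shift s x n}"
    show "n \<in> {..<length s} \<union> (\<lambda>i. i + length s) ` {n. x n}"
    proof (cases "n < length s")
      case False
      then have "x (n - length s)" "n = (n - length s) + length s" using n by (auto simp: shift_def)
      then show ?thesis by blast
    qed simp
  qed
  then show "shift s x \<in> CC" unfolding CC_def using fin finite_subset by blast
next
  assume "shift s x \<in> CC"
  then have fin: "finite {n. shift s x n}" by (simp add: CC_def)
  have "(\<lambda>i. i + length s) ` {n. x n} \<subseteq> {n. shift s x n}" by (auto simp: shift_def)
  then have "finite ((\<lambda>i. i + length s) ` {n. x n})" using fin finite_subset by blast
  then show "x \<in> CC" unfolding CC_def by (simp add: finite_image_iff inj_on_def)
qed

lemma continuous_shift: "continuous_map cantor cantor (shift s)"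
  unfolding cantor_eq_seqtop continuous_map_seqtop
proof (rule cont_onI)
  fix z :: "nat \<Rightarrow> bool" and V assume "openin seqtop V" "shift s z \<in> V"
  then obtain n where n: "cyl (pre (shift s z) n) \<subseteq> V" unfolding openin_seqtop by blast
  have "shift s x \<in> V" if "pre x n = pre z n" for x
  proof -
    have "shift s x \<in> cyl (pre (shift s z) n)" using that by (auto simp: cyl_pre_iff pre_eq_iff shift_def)
    then show ?thesis using n by blast
  qed
  then show "\<exists>n. \<forall>x\<in>UNIV. pre x n = pre z n \<longrightarrow> shift s x \<in> V" by blast
qed simp

definition nowhere_constant :: "((nat \<Rightarrow> bool) \<Rightarrow> 'a) \<Rightarrow> bool" where
  "nowhere_constant f \<longleftrightarrow> (\<forall>u. \<exists>x\<in>cyl u. \<exists>y\<in>cyl u. f x \<noteq> f y)"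

lemma cantor_nbhd:
  assumes "continuous_map cantor T f" "openin T V" "f z \<in> V"
  obtains n where "f ` cyl (pre z n) \<subseteq> V"
proof -
  have "cont_on UNIV T f" using assms(1) by (simp add: cantor_eq_seqtop continuous_map_seqtop)
  then have "\<exists>n. f ` (UNIV \<inter> cyl (pre z n)) \<subseteq> V" using assms(2,3) unfolding cont_on_def by blast
  then show thesis using that by auto
qed

text \<open>This is the reason why nowhere constant maps can be made injective.\<close>

lemma thin_fibres:
  assumes haus: "Hausdorff_space T" and f: "continuous_map cantor T f" and nc: "nowhere_constant f"
  shows "thin {(x, y). f x = f y}"
  unfolding thin_def
proof (intro allI)
  fix y u
  obtain x where x: "x \<in> cyl u" "f x \<noteq> f y" using nc unfolding nowhere_constant_def by metis
  have "f x \<in> topspace T" "f y \<in> topspace T" using continuous_map_funspace[OF f] by auto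
  then obtain U V where UV: "openin T U" "openin T V" "f x \<in> U" "f y \<in> V" "disjnt U V"
    using haus x(2) unfolding Hausdorff_space_def by blast
  obtain n where n: "f ` cyl (pre x n) \<subseteq> U" using cantor_nbhd[OF f UV(1,3)] by blast
  obtain m where m: "f ` cyl (pre y m) \<subseteq> V" using cantor_nbhd[OF f UV(2,4)] by blast
  obtain w where w: "pre x (max n (length u)) = u @ w"
    using pre_extends[OF x(1), of "max n (length u)"] by auto
  have "f x' \<noteq> f y'" if "x' \<in> cyl (u @ w)" "y' \<in> cyl (pre y m)" for x' y'
  proof -
    have "x' \<in> cyl (pre x n)" using that(1) cyl_pre_antimono[of n "max n (length u)" x] w by auto
    then have "f x' \<in> U" "f y' \<in> V" using n m that(2) by auto
    then show ?thesis using UV(5) unfolding disjnt_iff by metis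
  qed
  then show "\<exists>w m. cyl (u @ w) \<times> cyl (pre y m) \<inter> {(x, y). f x = f y} = {}" by blast
qed

lemma thin_section: "thin Q \<Longrightarrow> nowhere_dense {x. (x, y) \<in> Q}"
  unfolding thin_def nowhere_dense_def using pre_in_cyl[of y] by blast

lemma nowhere_dense_UN: "finite I \<Longrightarrow> (\<And>i. i \<in> I \<Longrightarrow> nowhere_dense (A i)) \<Longrightarrow> nowhere_dense (\<Union>i\<in>I. A i)"
  by (induction I rule: finite_induct) (auto intro: nowhere_dense_Un nowhere_dense_empty)

text \<open>A thin relation has nowhere dense sections, so the fibres of \<open>f\<close> and \<open>g\<close> through finitely many points
do not cover the dense set \<open>CC\<close>, and thinning applies to the union of the two fibre relations.\<close>

lemma injectivize:
  assumes haus: "Hausdorff_space T" and f: "continuous_map cantor T f" "nowhere_constant f"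
    and g: "continuous_map cantor T g" "nowhere_constant g"
  obtains \<psi> where "continuous_map cantor cantor \<psi>" "\<And>x. \<psi> x \<in> CC \<longleftrightarrow> x \<in> CC" "inj (f \<circ> \<psi>)" "inj (g \<circ> \<psi>)"
proof -
  define K where "K = {(x, y). f x = f y} \<union> {(x, y). g x = g y}"
  have tf: "thin {(x, y). f x = f y}" by (rule thin_fibres[OF haus f])
  have tg: "thin {(x, y). g x = g y}" by (rule thin_fibres[OF haus g])
  have K: "tame K" unfolding K_def
    using countably_covered_Un[OF countably_covered_self[of thin, OF tf] countably_covered_self[of thin, OF tg]] .
  have sym: "(y, x) \<in> K" if "(x, y) \<in> K" for x y using that by (auto simp: K_def)
  have sel: "\<exists>d\<in>CC \<inter> cyl ([] @ w). \<forall>e\<in>E. (d, e) \<notin> K" if "finite E" for E w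
  proof -
    define N where "N = (\<Union>e\<in>E. {x. (x, e) \<in> {(x, y). f x = f y}} \<union> {x. (x, e) \<in> {(x, y). g x = g y}})"
    have "nowhere_dense N" unfolding N_def using that tf tg by (intro nowhere_dense_UN nowhere_dense_Un thin_section)
    then have "dense_below (CC - N) []" by (rule dense_below_Diff_nowhere_dense[OF CC_dense])
    then obtain d where d: "d \<in> CC - N" "d \<in> cyl ([] @ w)" using dense_belowD by blast
    have "\<forall>e\<in>E. f d \<noteq> f e \<and> g d \<noteq> g e" using d(1) unfolding N_def by auto
    then show ?thesis using d by (intro bexI[of _ d]) (auto simp: K_def)
  qed
  obtain \<psi> where \<psi>: "continuous_map cantor cantor \<psi>" "\<And>x. \<psi> x \<in> CC \<longleftrightarrow> x \<in> CC"
    and notK: "\<And>x y. x \<noteq> y \<Longrightarrow> (\<psi> x, \<psi> y) \<notin> K"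
  proof (rule thinning_CC[of CC K "{}" "[]"])
    show "meagre {}" by (rule countably_covered_empty)
  qed (use K sym sel in auto)
  show thesis
  proof (rule that[OF \<psi>])
    show "inj (f \<circ> \<psi>)" using notK unfolding inj_on_def K_def by auto
    show "inj (g \<circ> \<psi>)" using notK unfolding inj_on_def K_def by auto
  qed
qed

lemma constant_on_cyl_or_nowhere_constant:
  obtains (const) u c where "\<And>x. x \<in> cyl u \<Longrightarrow> f x = c" | (nowhere) "nowhere_constant f"
proof (cases "nowhere_constant f")
  case False
  then obtain u where u: "\<And>x y. x \<in> cyl u \<Longrightarrow> y \<in> cyl u \<Longrightarrow> f x = f y" unfolding nowhere_constant_def by blast
  obtain x0 :: "nat \<Rightarrow> bool" where "x0 \<in> cyl u" using cyl_nonempty by blast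
  then show thesis using u const[of u "f x0"] by blast
qed (rule nowhere)

lemma cyl_meets_CC: "\<exists>x\<in>cyl u. x \<in> CC" "\<exists>x\<in>cyl u. x \<notin> CC"
proof -
  show "\<exists>x\<in>cyl u. x \<in> CC" using dense_belowD[OF CC_dense, of u "[]"] by auto
  show "\<exists>x\<in>cyl u. x \<notin> CC"
  proof (rule ccontr)
    assume "\<not> (\<exists>x\<in>cyl u. x \<notin> CC)"
    then have "cyl u \<subseteq> CC" by blast
    then show False using meagre_CC countably_covered_subset cyl_not_meagre by blast
  qed
qed

lemma nowhere_constant_by_CC:
  assumes "\<And>x y. f x = f y \<Longrightarrow> x \<in> CC \<Longrightarrow> y \<in> CC" shows "nowhere_constant f"
  unfolding nowhere_constant_def
proof
  fix u
  obtain x y where "x \<in> cyl u" "x \<in> CC" "y \<in> cyl u" "y \<notin> CC" using cyl_meets_CC by metis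
  then show "\<exists>x\<in>cyl u. \<exists>y\<in>cyl u. f x \<noteq> f y" using assms by blast
qed

context acyclic_relation
begin

lemma embed_diagonal_of_loops:
  assumes f: "continuous_map cantor X f" and loops: "\<And>x. (f x, f x) \<in> R \<longleftrightarrow> x \<in> CC"
  shows "(cantor, {(x, x) | x. x \<in> CC}) \<sqsubseteq>\<^sub>c (X, R)"
proof -
  have nc: "nowhere_constant f" by (rule nowhere_constant_by_CC) (metis loops)
  obtain \<psi> where \<psi>: "continuous_map cantor cantor \<psi>" "\<And>x. \<psi> x \<in> CC \<longleftrightarrow> x \<in> CC" "inj (f \<circ> \<psi>)"
    using injectivize[OF hausX f nc f nc] by blast
  show ?thesis
    by (rule embed_diagonal[of "f \<circ> \<psi>"]) (use \<psi> loops continuous_map_compose[OF \<psi>(1) f] in auto)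
qed

lemma embed_star_of_edges:
  assumes f: "continuous_map cantor X f" and p: "p \<in> topspace X" and ne: "\<And>x. f x \<noteq> p"
    and edges: "(\<forall>x. (p, f x) \<in> R \<longleftrightarrow> x \<in> CC) \<or> (\<forall>x. (f x, p) \<in> R \<longleftrightarrow> x \<in> CC)"
  shows "(cantor, {(x, x) | x. x \<in> CC}) \<sqsubseteq>\<^sub>c (X, R) \<or> (\<exists>t\<in>PPa. (SS, RRa t) \<sqsubseteq>\<^sub>c (X, R))"
proof -
  have nc: "nowhere_constant f" by (rule nowhere_constant_by_CC) (metis edges)
  obtain \<psi> where \<psi>: "continuous_map cantor cantor \<psi>" "\<And>x. \<psi> x \<in> CC \<longleftrightarrow> x \<in> CC" "inj (f \<circ> \<psi>)"
    using injectivize[OF hausX f nc f nc] by blast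
  show ?thesis
  proof (rule embed_star[of "f \<circ> \<psi>" p])
    show "continuous_map cantor X (f \<circ> \<psi>)" by (rule continuous_map_compose[OF \<psi>(1) f])
    show "inj (f \<circ> \<psi>)" by (rule \<psi>(3))
    show "p \<notin> range (f \<circ> \<psi>)" using ne by (auto simp: eq_commute)
    show "(\<forall>x. (p, (f \<circ> \<psi>) x) \<in> R \<longleftrightarrow> x \<in> CC) \<or> (\<forall>x. ((f \<circ> \<psi>) x, p) \<in> R \<longleftrightarrow> x \<in> CC)"
      using edges \<psi>(2) by auto
  qed (rule p)
qed

text \<open>The case distinction described at the beginning, for the two coordinates of the map
given by the Hurewicz dichotomy.\<close>

lemma embed_edges:
  assumes f: "continuous_map cantor X f" and g: "continuous_map cantor X g"
    and edges: "\<And>x. (f x, g x) \<in> R \<longleftrightarrow> x \<in> CC"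
  shows "(cantor, {(x, x) | x. x \<in> CC}) \<sqsubseteq>\<^sub>c (X, R) \<or> (\<exists>t\<in>PP. (DD, RR t) \<sqsubseteq>\<^sub>c (X, R)) \<or>
    (\<exists>t\<in>PPa. (SS, RRa t) \<sqsubseteq>\<^sub>c (X, R))"
proof (cases "\<forall>x. f x = g x")
  case True
  then show ?thesis using embed_diagonal_of_loops[OF f] edges by simp
next
  case False
  then obtain x where "f x \<noteq> g x" by blast
  moreover have "f x \<in> topspace X" "g x \<in> topspace X" using continuous_map_funspace[OF f] continuous_map_funspace[OF g] by auto
  ultimately obtain U V where UV: "openin X U" "openin X V" "f x \<in> U" "g x \<in> V" "disjnt U V"
    using hausX unfolding Hausdorff_space_def by blast
  obtain n where n: "f ` cyl (pre x n) \<subseteq> U" using cantor_nbhd[OF f UV(1,3)] by blast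
  obtain m where m: "g ` cyl (pre x m) \<subseteq> V" using cantor_nbhd[OF g UV(2,4)] by blast
  define s where "s = pre x (max n m)"
  have "cyl s \<subseteq> cyl (pre x n)" "cyl s \<subseteq> cyl (pre x m)" unfolding s_def by (intro cyl_pre_antimono, simp)+
  then have disj: "f (shift (s @ u) y) \<noteq> g (shift (s @ u) z)" for y z u
    using n m UV(5) shift_in_cyl[of "s @ u"] cyl_append_subset[of s u] unfolding disjnt_iff by blast
  have c: "continuous_map cantor X (\<lambda>x. f (shift v x))" "continuous_map cantor X (\<lambda>x. g (shift v x))" for v
    using continuous_map_compose[OF continuous_shift f] continuous_map_compose[OF continuous_shift g]
    by (auto simp: comp_def)
  have e: "(f (shift v x), g (shift v x)) \<in> R \<longleftrightarrow> x \<in> CC" for v x by (simp add: edges shift_CC)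
  have top: "f z \<in> topspace X" "g z \<in> topspace X" for z
    using continuous_map_funspace[OF f] continuous_map_funspace[OF g] by auto
  show ?thesis
  proof (cases rule: constant_on_cyl_or_nowhere_constant[of "\<lambda>x. f (shift s x)"])
    case (const u c)
    have fc: "f (shift (s @ u) y) = c" for y
    proof -
      obtain z where "z \<in> cyl u" "shift (s @ u) y = shift s z" using shift_surj[OF shift_in_cyl] by blast
      then show ?thesis using const by simp
    qed
    have "(cantor, {(x, x) | x. x \<in> CC}) \<sqsubseteq>\<^sub>c (X, R) \<or> (\<exists>t\<in>PPa. (SS, RRa t) \<sqsubseteq>\<^sub>c (X, R))"
    proof (rule embed_star_of_edges[of "\<lambda>x. g (shift (s @ u) x)" c])
      show "c \<in> topspace X" using top(1) fc by metis
      show "g (shift (s @ u) x) \<noteq> c" for x using disj fc by metis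
      show "(\<forall>x. (c, g (shift (s @ u) x)) \<in> R \<longleftrightarrow> x \<in> CC) \<or> (\<forall>x. (g (shift (s @ u) x), c) \<in> R \<longleftrightarrow> x \<in> CC)"
        using e[of "s @ u"] fc by simp
    qed (rule c)
    then show ?thesis by blast
  next
    case ncf: nowhere
    show ?thesis
    proof (cases rule: constant_on_cyl_or_nowhere_constant[of "\<lambda>x. g (shift s x)"])
      case (const u c)
      have gc: "g (shift (s @ u) y) = c" for y
      proof -
        obtain z where "z \<in> cyl u" "shift (s @ u) y = shift s z" using shift_surj[OF shift_in_cyl] by blast
        then show ?thesis using const by simp
      qed
      have "(cantor, {(x, x) | x. x \<in> CC}) \<sqsubseteq>\<^sub>c (X, R) \<or> (\<exists>t\<in>PPa. (SS, RRa t) \<sqsubseteq>\<^sub>c (X, R))"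
      proof (rule embed_star_of_edges[of "\<lambda>x. f (shift (s @ u) x)" c])
        show "c \<in> topspace X" using top(2) gc by metis
        show "f (shift (s @ u) x) \<noteq> c" for x using disj gc by metis
        show "(\<forall>x. (c, f (shift (s @ u) x)) \<in> R \<longleftrightarrow> x \<in> CC) \<or> (\<forall>x. (f (shift (s @ u) x), c) \<in> R \<longleftrightarrow> x \<in> CC)"
          using e[of "s @ u"] gc by simp
      qed (rule c)
      then show ?thesis by blast
    next
      case ncg: nowhere
      obtain \<psi> where \<psi>: "continuous_map cantor cantor \<psi>" "\<And>x. \<psi> x \<in> CC \<longleftrightarrow> x \<in> CC"
        "inj ((\<lambda>x. f (shift s x)) \<circ> \<psi>)" "inj ((\<lambda>x. g (shift s x)) \<circ> \<psi>)"
        using injectivize[OF hausX c(1)[of s] ncf c(2)[of s] ncg] by blast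
      define h where "h b x = (if b then g (shift s (\<psi> x)) else f (shift s (\<psi> x)))" for b x
      have "(cantor, {(x, x) | x. x \<in> CC}) \<sqsubseteq>\<^sub>c (X, R) \<or> (\<exists>t\<in>PP. (DD, RR t) \<sqsubseteq>\<^sub>c (X, R))"
      proof (rule embed_double[of h])
        show "continuous_map cantor X (h b)" for b
          using continuous_map_compose[OF \<psi>(1) c(1)[of s]] continuous_map_compose[OF \<psi>(1) c(2)[of s]]
          by (cases b) (simp_all add: h_def[abs_def] comp_def)
        show "\<epsilon> = \<eta> \<and> x = y" if eq: "h \<epsilon> x = h \<eta> y" for \<epsilon> \<eta> x y
        proof -
          have d: "f (shift s a) \<noteq> g (shift s b)" for a b using disj[of "[]"] by simp
          have "\<epsilon> = \<eta>" using eq d d[symmetric] by (cases \<epsilon>; cases \<eta>) (auto simp: h_def)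
          moreover have "x = y"
          proof (cases \<eta>)
            case True
            then show ?thesis using eq \<open>\<epsilon> = \<eta>\<close> injD[OF \<psi>(4), of x y] by (simp add: h_def)
          next
            case False
            then show ?thesis using eq \<open>\<epsilon> = \<eta>\<close> injD[OF \<psi>(3), of x y] by (simp add: h_def)
          qed
          ultimately show ?thesis ..
        qed
        show "(h False x, h True x) \<in> R \<longleftrightarrow> x \<in> CC" for x by (simp add: h_def e \<psi>(2))
      qed
      then show ?thesis by blast
    qed
  qed
qed

text \<open>The complement of \<open>R\<close> is Borel as well. So it is a continuous image of a closed subset of Baire space, which
is what the Hurewicz dichotomy asks for.\<close>

lemma embed_basis:
  assumes "\<not> gdelta_in (prod_topology X X) R"
  shows "(cantor, {(x, x) | x. x \<in> CC}) \<sqsubseteq>\<^sub>c (X, R) \<or> (\<exists>t\<in>PP. (DD, RR t) \<sqsubseteq>\<^sub>c (X, R)) \<or>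
    (\<exists>t\<in>PPa. (SS, RRa t) \<sqsubseteq>\<^sub>c (X, R))"
proof -
  let ?T = "prod_topology X X"
  have met: "metrizable_space ?T" using metX by (simp add: metrizable_space_prod_topology)
  have top: "baire_image ?T (topspace ?T)"
    using baire_image_prod[OF analytic_space_baire_image[OF analytic] analytic_space_baire_image[OF analytic]] by simp
  have "Borel_in ?T (topspace ?T - R)" using Borel unfolding Borel_in_def by (rule sigma_sets.Compl)
  then have "baire_image ?T (topspace ?T - R)" using baire_image_Borel[OF met top] by blast
  then obtain F :: "(nat \<Rightarrow> nat) set" and h where h: "seqclosed F" "cont_on F ?T h" "h ` F = topspace ?T - R"
    unfolding baire_image_def by blast
  have R: "R \<subseteq> topspace ?T" using R_sub by simp
  obtain \<phi> where \<phi>: "continuous_map cantor ?T \<phi>" "\<And>\<alpha>. \<phi> \<alpha> \<in> R \<longleftrightarrow> \<alpha> \<in> CC"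
    using hurewicz[OF met h R assms] by blast
  show ?thesis
  proof (rule embed_edges[of "fst \<circ> \<phi>" "snd \<circ> \<phi>"])
    show "continuous_map cantor X (fst \<circ> \<phi>)" "continuous_map cantor X (snd \<circ> \<phi>)"
      by (rule continuous_map_compose[OF \<phi>(1)], rule continuous_map_fst continuous_map_snd)+
    show "((fst \<circ> \<phi>) x, (snd \<circ> \<phi>) x) \<in> R \<longleftrightarrow> x \<in> CC" for x using \<phi>(2) by simp
  qed
qed

end

section \<open>The examples are pairwise incomparable\<close>

lemma gdelta_in_preimage:
  assumes f: "continuous_map X Y f" and G: "gdelta_in Y G"
  shows "gdelta_in X {x \<in> topspace X. f x \<in> G}"
proof -
  obtain C :: "nat \<Rightarrow> _" where C: "\<And>n. openin Y (C n)" "(\<Inter>n. C n) = G"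
    using G unfolding gdelta_in_descending by auto
  have "gdelta_in X (\<Inter>n. {x \<in> topspace X. f x \<in> C n})"
    using openin_continuous_map_preimage[OF f C(1)] by (intro gdelta_in_Inter) (auto intro: open_imp_gdelta_in)
  moreover have "(\<Inter>n. {x \<in> topspace X. f x \<in> C n}) = {x \<in> topspace X. f x \<in> G}"
    unfolding C(2)[symmetric] by auto
  ultimately show ?thesis by simp
qed

lemma closedin_cantor_singleton: "closedin cantor {x}"
  using metrizable_imp_Hausdorff_space[OF metrizable_cantor] closedin_Hausdorff_singleton by fastforce

lemma gdelta_Sset:
  assumes "i < 4" "i \<noteq> 0" shows "gdelta_in cantor (Sset i)"
proof -
  have "fsigma_in cantor (\<Union>((\<lambda>x. {x}) ` CC))"
    using countable_CC by (intro fsigma_in_Union) (auto intro: closed_imp_fsigma_in closedin_cantor_singleton)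
  then have CC: "fsigma_in cantor CC" by simp
  have "gdelta_in cantor (- CC)"
    unfolding gdelta_in_fsigma_in using CC by (simp add: Compl_eq_Diff_UNIV double_diff)
  moreover have "gdelta_in cantor UNIV" using gdelta_in_topspace[of cantor] by simp
  ultimately show ?thesis using less_4_cases[OF assms(1)] assms(2) by (auto simp: Sset_simps)
qed

text \<open>Otherwise the cylinder would be the union of the countable set \<open>CC\<close> and of countably many
closed sets that miss the dense set \<open>CC\<close>.\<close>

lemma CC_not_gdelta_on_cyl:
  assumes "gdelta_in cantor G" shows "\<exists>x\<in>cyl u. \<not> (x \<in> G \<longleftrightarrow> x \<in> CC)"
proof (rule ccontr)
  assume contra: "\<not> (\<exists>x\<in>cyl u. \<not> (x \<in> G \<longleftrightarrow> x \<in> CC))"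
  have "fsigma_in cantor (- G)" using assms unfolding gdelta_in_fsigma_in by (simp add: Compl_eq_Diff_UNIV)
  then obtain C :: "nat \<Rightarrow> _" where C: "\<And>n. closedin cantor (C n)" "(\<Union>n. C n) = - G"
    unfolding fsigma_in_ascending by auto
  have "nowhere_dense (C n \<inter> cyl u)" for n
    unfolding nowhere_dense_def
  proof
    fix v
    show "\<exists>w. cyl (v @ w) \<inter> (C n \<inter> cyl u) = {}"
    proof (cases "cyl v \<inter> cyl u = {}")
      case True
      then show ?thesis by (intro exI[of _ "[]"]) auto
    next
      case False
      then obtain w1 w2 where w: "v @ w1 = u @ w2"
        using cyl_comparable[of _ v u] by (metis append.right_neutral disjoint_iff)
      obtain d where d: "d \<in> CC" "d \<in> cyl (v @ w1)" using dense_belowD[OF CC_dense, of v w1] by blast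
      have "d \<in> cyl u" using d(2) unfolding w by (rule cyl_appendD)
      then have "d \<in> G" using contra d(1) by blast
      then have "d \<in> topspace cantor - C n" using C(2) by auto
      moreover have "openin cantor (topspace cantor - C n)" using C(1) by blast
      ultimately obtain k where k: "cyl (pre d k) \<subseteq> topspace cantor - C n"
        unfolding cantor_eq_seqtop openin_seqtop by blast
      have "d \<in> cyl v" using d(2) by (rule cyl_appendD)
      then obtain w3 where w3: "pre d (max k (length v)) = v @ w3"
        using pre_extends[of d v "max k (length v)"] by auto
      have "cyl (v @ w3) \<subseteq> cyl (pre d k)" unfolding w3[symmetric] by (rule cyl_pre_antimono) simp
      then show ?thesis using k by blast
    qed
  qed
  then have "meagre (\<Union>n. C n \<inter> cyl u)" by (intro countably_covered_UN_nat countably_covered_self)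
  then have "meagre ((\<Union>n. C n \<inter> cyl u) \<union> CC)" using meagre_CC by (rule countably_covered_Un)
  moreover have "cyl u \<subseteq> (\<Union>n. C n \<inter> cyl u) \<union> CC"
  proof
    fix x assume x: "x \<in> cyl u"
    show "x \<in> (\<Union>n. C n \<inter> cyl u) \<union> CC"
    proof (cases "x \<in> CC")
      case False
      then have "x \<in> - G" using contra x by blast
      then show ?thesis using x unfolding C(2)[symmetric] by blast
    qed simp
  qed
  ultimately show False using cyl_not_meagre countably_covered_subset by blast
qed

text \<open>All \<open>Sset i\<close> other than \<open>CC\<close> itself are $G_\delta$.\<close>

lemma CC_reduces_to_Sset:
  assumes g: "continuous_map cantor cantor g" and i: "i < 4"
    and red: "\<And>x. x \<in> cyl u \<Longrightarrow> x \<in> CC \<longleftrightarrow> g x \<in> Sset i"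
  shows "i = 0"
proof (rule ccontr)
  assume "i \<noteq> 0"
  then have "gdelta_in cantor {x \<in> topspace cantor. g x \<in> Sset i}"
    using gdelta_in_preimage[OF g gdelta_Sset[OF i]] by blast
  then show False using CC_not_gdelta_on_cyl[of _ u] red by fastforce
qed

lemma CC_eq_Sset_on_cyl:
  assumes "i < 4" "\<And>x. x \<in> cyl u \<Longrightarrow> x \<in> CC \<longleftrightarrow> x \<in> Sset i" shows "i = 0"
  using CC_reduces_to_Sset[OF continuous_map_id assms(1), of u] assms(2) by simp

lemma CC_not_constant_on_cyl: "\<exists>x\<in>cyl u. (x \<in> CC) \<noteq> b"
  using cyl_meets_CC[of u] by (cases b) auto

lemma Sset_iff: "i < 4 \<Longrightarrow> x \<in> Sset i \<longleftrightarrow> (if x \<in> CC then i = 0 \<or> i = 3 else i = 2 \<or> i = 3)"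
  by (auto dest!: less_4_cases simp: Sset_simps)

text \<open>Membership in \<open>Sset i\<close> depends only on membership in \<open>CC\<close>, and on a cylinder both alternatives
for the latter occur. So a map that preserves \<open>CC\<close> in both directions identifies the index.\<close>

lemma Sset_index_eq:
  assumes "i < 4" "j < 4" and CC: "\<And>x. x \<in> cyl u \<Longrightarrow> x \<in> CC \<longleftrightarrow> g x \<in> CC"
    and S: "\<And>x. x \<in> cyl u \<Longrightarrow> x \<in> Sset i \<longleftrightarrow> g x \<in> Sset j"
  shows "i = j"
proof -
  obtain x y where x: "x \<in> cyl u" "x \<in> CC" and y: "y \<in> cyl u" "y \<notin> CC" using cyl_meets_CC by metis
  have "(i = 0 \<or> i = 3) = (j = 0 \<or> j = 3)" using S[OF x(1)] CC[OF x(1)] x(2) assms(1,2) by (simp add: Sset_iff)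
  moreover have "(i = 2 \<or> i = 3) = (j = 2 \<or> j = 3)" using S[OF y(1)] CC[OF y(1)] y(2) assms(1,2) by (simp add: Sset_iff)
  ultimately show ?thesis using less_4_cases[OF assms(1)] less_4_cases[OF assms(2)] by auto
qed

lemma eq_on_cyl_by_CC:
  assumes T: "Hausdorff_space T" and f: "continuous_map cantor T f" and g: "continuous_map cantor T g"
    and eq: "\<And>x. x \<in> cyl u \<Longrightarrow> x \<in> CC \<Longrightarrow> f x = g x" and x: "x \<in> cyl u"
  shows "f x = g x"
proof (rule ccontr)
  assume "f x \<noteq> g x"
  moreover have "f x \<in> topspace T" "g x \<in> topspace T" using continuous_map_funspace[OF f] continuous_map_funspace[OF g] by auto
  ultimately obtain U V where UV: "openin T U" "openin T V" "f x \<in> U" "g x \<in> V" "disjnt U V"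
    using T unfolding Hausdorff_space_def by blast
  obtain n where n: "f ` cyl (pre x n) \<subseteq> U" using cantor_nbhd[OF f UV(1,3)] by blast
  obtain m where m: "g ` cyl (pre x m) \<subseteq> V" using cantor_nbhd[OF g UV(2,4)] by blast
  define k where "k = max (length u) (max n m)"
  obtain d where d: "d \<in> cyl (pre x k)" "d \<in> CC" using cyl_meets_CC(1) by blast
  have "cyl (pre x k) \<subseteq> cyl (pre x n)" "cyl (pre x k) \<subseteq> cyl (pre x m)" "cyl (pre x k) \<subseteq> cyl (pre x (length u))"
    unfolding k_def by (intro cyl_pre_antimono, simp)+
  then have "d \<in> cyl (pre x n)" "d \<in> cyl (pre x m)" "d \<in> cyl u"
    using d(1) cyl_pre_length[OF x] by auto
  then have "f d \<in> U" "g d \<in> V" "d \<in> cyl u" using n m by auto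
  then show False using eq d(2) UV(5) unfolding disjnt_iff by metis
qed

lemma locally_constant:
  fixes e :: "(nat \<Rightarrow> bool) \<Rightarrow> 'b"
  assumes "\<And>x. \<exists>n. \<forall>y\<in>cyl (pre x n). e y = e x"
  obtains w b where "\<And>x. x \<in> cyl (u @ w) \<Longrightarrow> e x = b"
proof -
  obtain x where x: "x \<in> cyl u" using cyl_nonempty by blast
  obtain n where n: "\<forall>y\<in>cyl (pre x n). e y = e x" using assms by blast
  obtain w where w: "pre x (max n (length u)) = u @ w" using pre_extends[OF x, of "max n (length u)"] by auto
  have "cyl (u @ w) \<subseteq> cyl (pre x n)" unfolding w[symmetric] by (rule cyl_pre_antimono) simp
  then show thesis using n by (intro that[of w "e x"]) blast
qed

lemma locally_constant_openin:
  assumes f: "continuous_map cantor T f" and "\<And>b :: bool. openin T {p \<in> topspace T. h p = b}"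
  obtains w b where "\<And>x. x \<in> cyl (u @ w) \<Longrightarrow> h (f x) = b"
proof (rule locally_constant[of "h \<circ> f" u])
  fix x
  have "f x \<in> {p \<in> topspace T. h p = h (f x)}" using continuous_map_funspace[OF f] by auto
  then obtain n where "f ` cyl (pre x n) \<subseteq> {p \<in> topspace T. h p = h (f x)}"
    using cantor_nbhd[OF f assms(2)] by blast
  then show "\<exists>n. \<forall>y\<in>cyl (pre x n). (h \<circ> f) y = (h \<circ> f) x" by (intro exI[of _ n]) auto
qed (use that in auto)

lemma openin_DD_fst: "openin DD {p \<in> topspace DD. fst p = b}"
  unfolding DD_def
  using openin_continuous_map_preimage[OF continuous_map_fst, of "discrete_topology UNIV" "{b}" cantor] by simp

lemma openin_SS_head: "openin SS {p \<in> topspace SS. p 0 = b}"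
proof -
  have "openin cantor {p \<in> topspace cantor. p 0 \<in> {b}}"
    unfolding cantor_def
    by (rule openin_continuous_map_preimage[OF continuous_map_product_projection]) auto
  then have "openin SS (topspace SS \<inter> {p. p 0 = b})"
    unfolding SS_def by (auto simp: openin_subtopology)
  then show ?thesis by (simp add: Collect_conj_eq)
qed

lemma topspace_DD [simp]: "topspace DD = UNIV"
  by (simp add: DD_def)

lemma continuous_map_DD_section: "continuous_map cantor DD (Pair b)"
proof -
  have "continuous_map cantor (prod_topology (discrete_topology UNIV) cantor) (\<lambda>x. (b, x))"
    by (intro continuous_map_pairedI) auto
  then show ?thesis by (simp add: DD_def)
qed

lemma continuous_map_DD_snd: "continuous_map DD cantor snd"
  unfolding DD_def by (rule continuous_map_snd)

lemma continuous_map_one_cons: "continuous_map cantor SS one_cons"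
proof -
  have "continuous_map cantor cantor one_cons"
    unfolding cantor_eq_seqtop continuous_map_seqtop
  proof (rule cont_onI)
    fix z :: "nat \<Rightarrow> bool" and V assume "openin seqtop V" "one_cons z \<in> V"
    then obtain n where n: "cyl (pre (one_cons z) n) \<subseteq> V" unfolding openin_seqtop by blast
    have "one_cons x \<in> V" if "pre x n = pre z n" for x
    proof -
      have "one_cons x \<in> cyl (pre (one_cons z) n)"
        using that by (auto simp: cyl_pre_iff pre_eq_iff one_cons_def split: nat.split)
      then show ?thesis using n by blast
    qed
    then show "\<exists>n. \<forall>x\<in>UNIV. pre x n = pre z n \<longrightarrow> one_cons x \<in> V" by blast
  qed simp
  then show ?thesis using range_one_cons unfolding SS_def by (auto simp: continuous_map_in_subtopology)
qed

lemma continuous_map_tail: "continuous_map cantor cantor (\<lambda>z. z \<circ> Suc)"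
  unfolding cantor_eq_seqtop continuous_map_seqtop
proof (rule cont_onI)
  fix z :: "nat \<Rightarrow> bool" and V assume "openin seqtop V" "z \<circ> Suc \<in> V"
  then obtain n where n: "cyl (pre (z \<circ> Suc) n) \<subseteq> V" unfolding openin_seqtop by blast
  have "x \<circ> Suc \<in> V" if "pre x (Suc n) = pre z (Suc n)" for x
    using that n unfolding pre_Suc_shift by (auto simp: cyl_pre_iff)
  then show "\<exists>n. \<forall>x\<in>UNIV. pre x n = pre z n \<longrightarrow> x \<circ> Suc \<in> V" by blast
qed simp

lemma continuous_map_SS_tail: "continuous_map SS cantor (\<lambda>z. z \<circ> Suc)"
  unfolding SS_def by (rule continuous_map_from_subtopology[OF continuous_map_tail])

lemma one_cons_tail: "z 0 \<Longrightarrow> one_cons (z \<circ> Suc) = z"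
  by (auto simp: one_cons_def fun_eq_iff split: nat.split)

lemma SS_head_False: "z \<in> topspace SS \<Longrightarrow> \<not> z 0 \<Longrightarrow> z = zeros"
  unfolding topspace_SS by (auto simp: one_cons_def)

lemma Hausdorff_cantor: "Hausdorff_space cantor"
  by (rule metrizable_imp_Hausdorff_space[OF metrizable_cantor])

lemma metrizable_SS: "metrizable_space SS"
  unfolding SS_def by (rule metrizable_space_subtopology[OF metrizable_cantor])

lemma Hausdorff_SS: "Hausdorff_space SS"
  by (rule metrizable_imp_Hausdorff_space[OF metrizable_SS])

lemma RR_iff: "((\<epsilon>, x), (\<eta>, y)) \<in> RR t \<longleftrightarrow> x = y \<and> x \<in> Sset (t \<epsilon> \<eta>)"
  by (auto simp: RR_def)

lemma RRa_simps:
  "(zeros, zeros) \<in> RRa t \<longleftrightarrow> t False False = 1"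
  "(zeros, one_cons \<beta>) \<in> RRa t \<longleftrightarrow> \<beta> \<in> Sset (t False True)"
  "(one_cons \<alpha>, zeros) \<in> RRa t \<longleftrightarrow> \<alpha> \<in> Sset (t True False)"
  "(one_cons \<alpha>, one_cons \<beta>) \<in> RRa t \<longleftrightarrow> \<alpha> = \<beta> \<and> \<alpha> \<in> Sset (t True True)"
  by (auto simp: RRa_def one_cons_ne_zeros one_cons_inject)

abbreviation DeltaCC :: "((nat \<Rightarrow> bool) \<times> (nat \<Rightarrow> bool)) set" where
  "DeltaCC \<equiv> {(x, x) | x. x \<in> CC}"

lemma c_leD:
  assumes "(X, A) \<le>\<^sub>c (Y, B)"
  obtains f where "continuous_map X Y f"
    "\<And>x y. x \<in> topspace X \<Longrightarrow> y \<in> topspace X \<Longrightarrow> (x, y) \<in> A \<longleftrightarrow> (f x, f y) \<in> B"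
  using assms unfolding c_le_def c_reduction_def by auto

text \<open>Loops go to loops, but on each sheet of \<open>RR t\<close> the set of loops is $G_\delta$.\<close>

lemma not_DeltaCC_le_RR:
  assumes t: "t \<in> PP" shows "\<not> (cantor, DeltaCC) \<le>\<^sub>c (DD, RR t)"
proof
  assume "(cantor, DeltaCC) \<le>\<^sub>c (DD, RR t)"
  then obtain f where f: "continuous_map cantor DD f"
    and red: "\<And>x y. x \<in> topspace cantor \<Longrightarrow> y \<in> topspace cantor \<Longrightarrow> (x, y) \<in> DeltaCC \<longleftrightarrow> (f x, f y) \<in> RR t"
    by (rule c_leD) blast
  obtain w b where b: "\<And>x. x \<in> cyl ([] @ w) \<Longrightarrow> fst (f x) = b"
    using locally_constant_openin[OF f openin_DD_fst] by metis
  have "t b b = 0"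
  proof (rule CC_reduces_to_Sset)
    show "continuous_map cantor cantor (snd \<circ> f)" by (rule continuous_map_compose[OF f continuous_map_DD_snd])
    show "t b b < 4" using t by (auto simp: PP_def tables_def)
    show "x \<in> CC \<longleftrightarrow> (snd \<circ> f) x \<in> Sset (t b b)" if "x \<in> cyl w" for x
    proof -
      have "f x = (b, snd (f x))" using b[of x] that by (simp add: prod_eq_iff)
      then show ?thesis using red[of x x] RR_iff[of b "snd (f x)" b "snd (f x)" t] by auto
    qed
  qed
  then show False using t by (cases b) (auto simp: PP_def)
qed

text \<open>The loops at outer points are given by \<open>Sset (t True True)\<close>, which is $G_\delta$, and a cylinder sent to the
centre consists either of loops or of none.\<close>

lemma not_DeltaCC_le_RRa:
  assumes t: "t \<in> PPa" shows "\<not> (cantor, DeltaCC) \<le>\<^sub>c (SS, RRa t)"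
proof
  assume "(cantor, DeltaCC) \<le>\<^sub>c (SS, RRa t)"
  then obtain f where f: "continuous_map cantor SS f"
    and red: "\<And>x y. x \<in> topspace cantor \<Longrightarrow> y \<in> topspace cantor \<Longrightarrow> (x, y) \<in> DeltaCC \<longleftrightarrow> (f x, f y) \<in> RRa t"
    by (rule c_leD) blast
  have fS: "f x \<in> topspace SS" for x using continuous_map_funspace[OF f] by auto
  obtain w b where b: "\<And>x. x \<in> cyl ([] @ w) \<Longrightarrow> (f x) 0 = b"
    using locally_constant_openin[where h = "\<lambda>p. p 0", OF f openin_SS_head] by metis
  show False
  proof (cases b)
    case True
    have "t True True = 0"
    proof (rule CC_reduces_to_Sset)
      show "continuous_map cantor cantor ((\<lambda>z. z \<circ> Suc) \<circ> f)"
        by (rule continuous_map_compose[OF f continuous_map_SS_tail])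
      show "t True True < 4" using t by (auto simp: PPa_def tables_def)
      show "x \<in> CC \<longleftrightarrow> ((\<lambda>z. z \<circ> Suc) \<circ> f) x \<in> Sset (t True True)" if "x \<in> cyl w" for x
      proof -
        have "one_cons (f x \<circ> Suc) = f x" using b[of x] that True by (intro one_cons_tail) simp
        then show ?thesis using red[of x x] RRa_simps(4)[of "f x \<circ> Suc" "f x \<circ> Suc" t] by auto
      qed
    qed
    then show False using t by (simp add: PPa_def)
  next
    case False
    have "f x = zeros" if "x \<in> cyl w" for x using SS_head_False[OF fS] b[of x] that False by simp
    then have "x \<in> CC \<longleftrightarrow> (zeros, zeros) \<in> RRa t" if "x \<in> cyl w" for x using red[of x x] that by auto
    then show False using CC_not_constant_on_cyl[of w "(zeros, zeros) \<in> RRa t"] by blast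
  qed
qed

text \<open>The two sheets would have the same image, since matched points are identified
over the dense set \<open>CC\<close>; then the edges between the sheets could not be distinguished from loops.\<close>

lemma not_RR_le_DeltaCC:
  assumes t: "t \<in> PP" shows "\<not> (DD, RR t) \<le>\<^sub>c (cantor, DeltaCC)"
proof
  assume "(DD, RR t) \<le>\<^sub>c (cantor, DeltaCC)"
  then obtain f where f: "continuous_map DD cantor f"
    and red: "\<And>p q. p \<in> topspace DD \<Longrightarrow> q \<in> topspace DD \<Longrightarrow> (p, q) \<in> RR t \<longleftrightarrow> (f p, f q) \<in> DeltaCC"
    by (rule c_leD) blast
  have c: "continuous_map cantor cantor (f \<circ> Pair b)" for b
    by (rule continuous_map_compose[OF continuous_map_DD_section f])
  have t01: "t False True = 0" using t by (simp add: PP_def)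
  have edge: "x \<in> CC \<longleftrightarrow> (f (False, x), f (True, x)) \<in> DeltaCC" for x
    using red[of "(False, x)" "(True, x)"] t01 by (simp add: RR_iff Sset_simps)
  have "(f \<circ> Pair False) x = (f \<circ> Pair True) x" for x
  proof (rule eq_on_cyl_by_CC[OF Hausdorff_cantor c c, of "[]"])
    show "(f \<circ> Pair False) z = (f \<circ> Pair True) z" if "z \<in> CC" for z using edge[of z] that by auto
  qed simp
  then have "x \<in> CC \<longleftrightarrow> x \<in> Sset (t False False)" for x
    using edge[of x] red[of "(False, x)" "(False, x)"] by (simp add: RR_iff)
  then have "t False False = 0" using t by (intro CC_eq_Sset_on_cyl[of _ "[]"]) (auto simp: PP_def tables_def)
  then show False using t by (simp add: PP_def)
qed

lemma RRa_edge:
  assumes "t \<in> PPa"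
  obtains "\<And>\<alpha>. (zeros, one_cons \<alpha>) \<in> RRa t \<longleftrightarrow> \<alpha> \<in> CC" | "\<And>\<alpha>. (one_cons \<alpha>, zeros) \<in> RRa t \<longleftrightarrow> \<alpha> \<in> CC"
  using assms unfolding PPa_def by (auto simp: RRa_simps Sset_simps)

text \<open>The edges at the centre distinguish points over \<open>CC\<close> from the others, so no reduction
is constant on a cylinder.\<close>

lemma RRa_not_constant:
  assumes t: "t \<in> PPa" and red: "\<And>x y. x \<in> topspace SS \<Longrightarrow> y \<in> topspace SS \<Longrightarrow> (x, y) \<in> RRa t \<longleftrightarrow> (f x, f y) \<in> B"
    and const: "\<And>\<alpha>. \<alpha> \<in> cyl u \<Longrightarrow> f (one_cons \<alpha>) = c"
  shows False
proof -
  have top: "zeros \<in> topspace SS" "\<And>\<alpha>. one_cons \<alpha> \<in> topspace SS" by (auto simp: topspace_SS)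
  show False
  proof (cases rule: RRa_edge[OF t])
    case 1
    have "\<alpha> \<in> CC \<longleftrightarrow> (f zeros, c) \<in> B" if "\<alpha> \<in> cyl u" for \<alpha>
      using 1[of \<alpha>] red[OF top(1) top(2)[of \<alpha>]] const[OF that] by simp
    then show False using CC_not_constant_on_cyl[of u "(f zeros, c) \<in> B"] by blast
  next
    case 2
    have "\<alpha> \<in> CC \<longleftrightarrow> (c, f zeros) \<in> B" if "\<alpha> \<in> cyl u" for \<alpha>
      using 2[of \<alpha>] red[OF top(2)[of \<alpha>] top(1)] const[OF that] by simp
    then show False using CC_not_constant_on_cyl[of u "(c, f zeros) \<in> B"] by blast
  qed
qed

text \<open>All neighbours of the centre go to the image of the centre. As they are dense in the outer part,
the reduction is constant.\<close>

lemma not_RRa_le_DeltaCC: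
  assumes t: "t \<in> PPa" shows "\<not> (SS, RRa t) \<le>\<^sub>c (cantor, DeltaCC)"
proof
  assume "(SS, RRa t) \<le>\<^sub>c (cantor, DeltaCC)"
  then obtain f where f: "continuous_map SS cantor f"
    and red: "\<And>p q. p \<in> topspace SS \<Longrightarrow> q \<in> topspace SS \<Longrightarrow> (p, q) \<in> RRa t \<longleftrightarrow> (f p, f q) \<in> DeltaCC"
    by (rule c_leD) blast
  have top: "zeros \<in> topspace SS" "\<And>\<alpha>. one_cons \<alpha> \<in> topspace SS" by (auto simp: topspace_SS)
  have "(f \<circ> one_cons) \<alpha> = (\<lambda>_. f zeros) \<alpha>" for \<alpha>
  proof (rule eq_on_cyl_by_CC[OF Hausdorff_cantor, of "f \<circ> one_cons" "\<lambda>_. f zeros" "[]"])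
    show "continuous_map cantor cantor (f \<circ> one_cons)" by (rule continuous_map_compose[OF continuous_map_one_cons f])
    show "(f \<circ> one_cons) x = f zeros" if "x \<in> CC" for x
      by (cases rule: RRa_edge[OF t]) (use that red[OF top(1) top(2)[of x]] red[OF top(2)[of x] top(1)] in auto)
  qed auto
  then have "f (one_cons \<alpha>) = f zeros" for \<alpha> by simp
  then show False
    by (rule RRa_not_constant[OF t, where f = f and B = DeltaCC and u = "[]" and c = "f zeros", rotated])
      (use red in auto)
qed

text \<open>Locally the image of each sheet is the centre or lies in the outer part of the star. The images of both
sheets cannot agree, as otherwise the loops on a sheet would be given by \<open>CC\<close>. If one
sheet goes to the centre, then a matching is mapped to a star.\<close>

lemma not_RR_le_RRa:
  assumes t: "t \<in> PP" shows "\<not> (DD, RR t) \<le>\<^sub>c (SS, RRa t')"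
proof
  assume "(DD, RR t) \<le>\<^sub>c (SS, RRa t')"
  then obtain f where f: "continuous_map DD SS f"
    and red: "\<And>p q. p \<in> topspace DD \<Longrightarrow> q \<in> topspace DD \<Longrightarrow> (p, q) \<in> RR t \<longleftrightarrow> (f p, f q) \<in> RRa t'"
    by (rule c_leD) blast
  define g where "g b = f \<circ> Pair b" for b
  have c: "continuous_map cantor SS (g b)" for b
    unfolding g_def by (rule continuous_map_compose[OF continuous_map_DD_section f])
  have gS: "g b x \<in> topspace SS" for b x using continuous_map_funspace[OF c] by auto
  have r: "x = y \<and> x \<in> Sset (t \<epsilon> \<eta>) \<longleftrightarrow> (g \<epsilon> x, g \<eta> y) \<in> RRa t'" for \<epsilon> \<eta> x y
    using red[of "(\<epsilon>, x)" "(\<eta>, y)"] by (simp add: RR_iff g_def)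
  have t01: "t False True = 0" using t by (simp add: PP_def)
  have edge: "x = y \<and> x \<in> CC \<longleftrightarrow> (g False x, g True y) \<in> RRa t'" for x y
    using r[of x y False True] t01 by (simp add: Sset_simps)
  obtain w0 b0 where b0: "\<And>x. x \<in> cyl ([] @ w0) \<Longrightarrow> (g False x) 0 = b0"
    using locally_constant_openin[where h = "\<lambda>p. p 0", OF c openin_SS_head] by metis
  obtain w1 b1 where b1: "\<And>x. x \<in> cyl (w0 @ w1) \<Longrightarrow> (g True x) 0 = b1"
    using locally_constant_openin[where h = "\<lambda>p. p 0", OF c openin_SS_head] by metis
  define u where "u = w0 @ w1"
  have head: "(g False x) 0 = b0" "(g True x) 0 = b1" if "x \<in> cyl u" for x
    using that b0 b1 cyl_append_subset[of w0 w1] unfolding u_def by auto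
  have noneq: False if "\<And>x. x \<in> cyl u \<Longrightarrow> g False x = g True x"
  proof -
    have "x \<in> CC \<longleftrightarrow> x \<in> Sset (t False False)" if "x \<in> cyl u" for x
      using edge[of x x] r[of x x False False] \<open>\<And>x. x \<in> cyl u \<Longrightarrow> g False x = g True x\<close>[OF that] by simp
    then have "t False False = 0" using t by (intro CC_eq_Sset_on_cyl[of _ u]) (auto simp: PP_def tables_def)
    then show False using t by (simp add: PP_def)
  qed
  have two: "\<exists>x y. x \<in> cyl u \<and> y \<in> cyl u \<and> x \<in> CC \<and> y \<in> CC \<and> x \<noteq> y"
  proof -
    have "dense_below (CC - {x}) []" for x by (rule dense_below_Diff_nowhere_dense[OF CC_dense nowhere_dense_singleton])
    then have "\<exists>y\<in>CC - {x}. y \<in> cyl u" for x using dense_belowD[of "CC - {x}" "[]" u] by simp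
    then show ?thesis using cyl_meets_CC(1)[of u] by blast
  qed
  then obtain x y where xy: "x \<in> cyl u" "y \<in> cyl u" "x \<in> CC" "y \<in> CC" "x \<noteq> y" by blast
  have zero: "g b z = zeros" if "\<not> (g b z) 0" for b z using SS_head_False[OF gS that] .
  consider "b0" "b1" | "\<not> b0" | "\<not> b1" by blast
  then show False
  proof cases
    case 1
    show False
    proof (rule noneq)
      fix x assume x: "x \<in> cyl u"
      show "g False x = g True x"
      proof (rule eq_on_cyl_by_CC[OF Hausdorff_SS c c _ x])
        fix z assume z: "z \<in> cyl u" "z \<in> CC"
        obtain p q where pq: "g False z = one_cons p" "g True z = one_cons q"
          using head[OF z(1)] 1 one_cons_tail[of "g False z"] one_cons_tail[of "g True z"] by metis
        have "(g False z, g True z) \<in> RRa t'" using edge[of z z] z(2) by blast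
        then show "g False z = g True z" unfolding pq RRa_simps by simp
      qed
    qed
  next
    case 2
    then have "g False x = g False y" using zero head xy by metis
    then show False using edge[of x x] edge[of y x] xy by simp
  next
    case 3
    then have "g True x = g True y" using zero head xy by metis
    then show False using edge[of x x] edge[of x y] xy by simp
  qed
qed

text \<open>All neighbours of the centre would lie over one single point of Cantor space, so the reduction
would be locally constant.\<close>

lemma not_RRa_le_RR:
  assumes t: "t \<in> PPa" shows "\<not> (SS, RRa t) \<le>\<^sub>c (DD, RR t')"
proof
  assume "(SS, RRa t) \<le>\<^sub>c (DD, RR t')"
  then obtain f where f: "continuous_map SS DD f"
    and red: "\<And>p q. p \<in> topspace SS \<Longrightarrow> q \<in> topspace SS \<Longrightarrow> (p, q) \<in> RRa t \<longleftrightarrow> (f p, f q) \<in> RR t'"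
    by (rule c_leD) blast
  have top: "zeros \<in> topspace SS" "\<And>\<alpha>. one_cons \<alpha> \<in> topspace SS" by (auto simp: topspace_SS)
  have c: "continuous_map cantor DD (f \<circ> one_cons)" by (rule continuous_map_compose[OF continuous_map_one_cons f])
  have snd_eq: "snd p = snd q" if "(p, q) \<in> RR t'" for p q using that by (auto simp: RR_def)
  have "(snd \<circ> (f \<circ> one_cons)) \<alpha> = (\<lambda>_. snd (f zeros)) \<alpha>" for \<alpha>
  proof (rule eq_on_cyl_by_CC[OF Hausdorff_cantor, of "snd \<circ> (f \<circ> one_cons)" "\<lambda>_. snd (f zeros)" "[]"])
    show "continuous_map cantor cantor (snd \<circ> (f \<circ> one_cons))"
      by (rule continuous_map_compose[OF c continuous_map_DD_snd])
    show "(snd \<circ> (f \<circ> one_cons)) x = snd (f zeros)" if "x \<in> CC" for x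
    proof (cases rule: RRa_edge[OF t])
      case 1
      then have "(f zeros, f (one_cons x)) \<in> RR t'" using that red[OF top(1) top(2)[of x]] by simp
      from snd_eq[OF this] show ?thesis by simp
    next
      case 2
      then have "(f (one_cons x), f zeros) \<in> RR t'" using that red[OF top(2)[of x] top(1)] by simp
      from snd_eq[OF this] show ?thesis by simp
    qed
  qed auto
  then have s: "snd (f (one_cons \<alpha>)) = snd (f zeros)" for \<alpha> by simp
  obtain w b where b: "\<And>x. x \<in> cyl ([] @ w) \<Longrightarrow> fst ((f \<circ> one_cons) x) = b"
    using locally_constant_openin[OF c openin_DD_fst] by metis
  have "f (one_cons \<alpha>) = (b, snd (f zeros))" if "\<alpha> \<in> cyl w" for \<alpha>
    using b[of \<alpha>] that s[of \<alpha>] by (simp add: prod_eq_iff)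
  then show False
    by (rule RRa_not_constant[OF t, where f = f and B = "RR t'" and u = w and c = "(b, snd (f zeros))", rotated])
      (use red in auto)
qed

text \<open>Over the dense set \<open>CC\<close> edges between the sheets go to edges, so both sheets induce the same map
\<open>G\<close> of Cantor space, and on a small cylinder the sheets are mapped to different sheets. If they are
exchanged, the convention on tables with \<open>t True False = 0\<close> forces \<open>t\<close> to be symmetric.\<close>

lemma RR_le_RR_imp_eq:
  assumes t: "t \<in> PP" and t': "t' \<in> PP" and le: "(DD, RR t) \<le>\<^sub>c (DD, RR t')"
  shows "t = t'"
proof -
  obtain f where f: "continuous_map DD DD f"
    and red: "\<And>p q. p \<in> topspace DD \<Longrightarrow> q \<in> topspace DD \<Longrightarrow> (p, q) \<in> RR t \<longleftrightarrow> (f p, f q) \<in> RR t'"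
    using le by (rule c_leD) blast
  define g where "g b = f \<circ> Pair b" for b
  have c: "continuous_map cantor DD (g b)" for b
    unfolding g_def by (rule continuous_map_compose[OF continuous_map_DD_section f])
  define k where "k b = snd \<circ> g b" for b
  have kc: "continuous_map cantor cantor (k b)" for b
    unfolding k_def by (rule continuous_map_compose[OF c continuous_map_DD_snd])
  have t4: "t \<epsilon> \<eta> < 4" "t' \<epsilon> \<eta> < 4" for \<epsilon> \<eta> using t t' by (auto simp: PP_def tables_def)
  have t01: "t False True = 0" "t' False True = 0" using t t' by (auto simp: PP_def)
  obtain w0 a where a: "\<And>x. x \<in> cyl ([] @ w0) \<Longrightarrow> fst (g False x) = a"
    using locally_constant_openin[OF c openin_DD_fst] by metis
  obtain w1 b where b: "\<And>x. x \<in> cyl (w0 @ w1) \<Longrightarrow> fst (g True x) = b"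
    using locally_constant_openin[OF c openin_DD_fst] by metis
  define u where "u = w0 @ w1"
  define h where "h \<epsilon> = (if \<epsilon> then b else a)" for \<epsilon>
  have g: "g \<epsilon> x = (h \<epsilon>, k \<epsilon> x)" if "x \<in> cyl u" for \<epsilon> x
    using that a b cyl_append_subset[of w0 w1] unfolding u_def k_def h_def
    by (cases \<epsilon>) (auto simp: prod_eq_iff)
  have r: "x \<in> Sset (t \<epsilon> \<eta>) \<longleftrightarrow> k \<epsilon> x = k \<eta> x \<and> k \<epsilon> x \<in> Sset (t' (h \<epsilon>) (h \<eta>))" if "x \<in> cyl u" for x \<epsilon> \<eta>
  proof -
    have "x \<in> Sset (t \<epsilon> \<eta>) \<longleftrightarrow> (g \<epsilon> x, g \<eta> x) \<in> RR t'"
      using red[of "(\<epsilon>, x)" "(\<eta>, x)"] by (simp add: RR_iff g_def)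
    then show ?thesis using g[OF that] by (simp add: RR_iff)
  qed
  have "k False x = k True x" if "x \<in> cyl u" for x
    by (rule eq_on_cyl_by_CC[OF Hausdorff_cantor kc kc _ that]) (use r[of _ False True] t01 in \<open>auto simp: Sset_simps\<close>)
  then have keq: "k \<epsilon> x = k \<eta> x" if "x \<in> cyl u" for x \<epsilon> \<eta> using that by (cases \<epsilon>; cases \<eta>) auto
  define G where "G = k False"
  have r: "x \<in> Sset (t \<epsilon> \<eta>) \<longleftrightarrow> G x \<in> Sset (t' (h \<epsilon>) (h \<eta>))" if "x \<in> cyl u" for x \<epsilon> \<eta>
    using r[OF that, of \<epsilon> \<eta>] keq[OF that] unfolding G_def by metis
  have "a \<noteq> b"
  proof
    assume "a = b"
    then have "x \<in> CC \<longleftrightarrow> x \<in> Sset (t False False)" if "x \<in> cyl u" for x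
      using r[OF that, of False False] r[OF that, of False True] t01 by (simp add: h_def Sset_simps)
    then have "t False False = 0" using t4 by (intro CC_eq_Sset_on_cyl[of _ u]) auto
    then show False using t by (simp add: PP_def)
  qed
  have red_CC: "x \<in> CC \<longleftrightarrow> G x \<in> Sset (t' a b)" if "x \<in> cyl u" for x
    using r[OF that, of False True] t01 by (simp add: h_def Sset_simps)
  have tab: "t' a b = 0"
    by (rule CC_reduces_to_Sset[OF _ t4(2) red_CC]) (simp add: G_def kc)
  have "x \<in> CC \<longleftrightarrow> G x \<in> CC" if "x \<in> cyl u" for x using red_CC[OF that] tab by (simp add: Sset_simps)
  then have teq: "t \<epsilon> \<eta> = t' (h \<epsilon>) (h \<eta>)" for \<epsilon> \<eta>
    using Sset_index_eq[OF t4(1) t4(2), of u G] r by blast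
  show ?thesis
  proof (cases a)
    case False
    then have "b" using \<open>a \<noteq> b\<close> by simp
    then have "h \<epsilon> = \<epsilon>" for \<epsilon> using False by (simp add: h_def)
    then show ?thesis using teq by (simp add: fun_eq_iff)
  next
    case True
    then have "\<not> b" using \<open>a \<noteq> b\<close> by simp
    then have "h \<epsilon> = (\<not> \<epsilon>)" for \<epsilon> using True by (simp add: h_def)
    then have eqs: "t False False = t' True True" "t True True = t' False False" "t True False = t' False True"
      "t False True = t' True False" using teq by auto
    have "t False False \<le> t True True" "t' False False \<le> t' True True"
      using t t' eqs t01 by (auto simp: PP_def)
    then have "t \<epsilon> \<eta> = t' \<epsilon> \<eta>" for \<epsilon> \<eta> using eqs t01 by (cases \<epsilon>; cases \<eta>) auto
    then show ?thesis by (simp add: fun_eq_iff)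
  qed
qed

text \<open>The centre is fixed: an outer point has no outer neighbours except itself, so if the centre went to an outer
point, then the outer part would locally collapse to that point. The entries of the two tables then
correspond to each other under the map of the outer part.\<close>

lemma RRa_le_RRa_imp_eq:
  assumes t: "t \<in> PPa" and t': "t' \<in> PPa" and le: "(SS, RRa t) \<le>\<^sub>c (SS, RRa t')"
  shows "t = t'"
proof -
  obtain f where f: "continuous_map SS SS f"
    and red: "\<And>p q. p \<in> topspace SS \<Longrightarrow> q \<in> topspace SS \<Longrightarrow> (p, q) \<in> RRa t \<longleftrightarrow> (f p, f q) \<in> RRa t'"
    using le by (rule c_leD) blast
  have top: "zeros \<in> topspace SS" "\<And>\<alpha>. one_cons \<alpha> \<in> topspace SS" by (auto simp: topspace_SS)
  have fS: "f p \<in> topspace SS" if "p \<in> topspace SS" for p using continuous_map_funspace[OF f] that by auto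
  have c: "continuous_map cantor SS (f \<circ> one_cons)" by (rule continuous_map_compose[OF continuous_map_one_cons f])
  have t4: "t \<epsilon> \<eta> < 4" "t' \<epsilon> \<eta> < 4" for \<epsilon> \<eta> using t t' by (auto simp: PPa_def tables_def)
  obtain u b where "\<And>x. x \<in> cyl ([] @ u) \<Longrightarrow> ((f \<circ> one_cons) x) 0 = b"
    using locally_constant_openin[where h = "\<lambda>p. p 0", OF c openin_SS_head] by metis
  then have u: "f (one_cons x) 0 = b" if "x \<in> cyl u" for x using that by auto
  have b
  proof (rule ccontr)
    assume "\<not> b"
    then have "f (one_cons x) = zeros" if "x \<in> cyl u" for x using SS_head_False[OF fS[OF top(2)]] u[OF that] by simp
    then show False
      by (rule RRa_not_constant[OF t, where f = f and B = "RRa t'" and u = u and c = zeros, rotated])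
        (use red in auto)
  qed
  define G where "G = (\<lambda>z. z \<circ> Suc) \<circ> (f \<circ> one_cons)"
  have Gc: "continuous_map cantor cantor G" unfolding G_def by (rule continuous_map_compose[OF c continuous_map_SS_tail])
  have fG: "f (one_cons x) = one_cons (G x)" if "x \<in> cyl u" for x
    using one_cons_tail[of "f (one_cons x)"] u[OF that] \<open>b\<close> by (simp add: G_def)
  have fz: "f zeros = zeros"
  proof (rule ccontr)
    assume "f zeros \<noteq> zeros"
    then obtain \<beta> where \<beta>: "f zeros = one_cons \<beta>" using SS_cases[OF fS[OF top(1)]] by metis
    have "G x = (\<lambda>_. \<beta>) x" if "x \<in> cyl u" for x
    proof (rule eq_on_cyl_by_CC[OF Hausdorff_cantor Gc, of "\<lambda>_. \<beta>", OF _ _ that])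
      fix z assume z: "z \<in> cyl u" "z \<in> CC"
      show "G z = \<beta>"
        by (cases rule: RRa_edge[OF t])
          (use z red[OF top(1) top(2)[of z]] red[OF top(2)[of z] top(1)] in \<open>auto simp: \<beta> fG RRa_simps\<close>)
    qed auto
    then have "f (one_cons x) = one_cons \<beta>" if "x \<in> cyl u" for x using fG that by simp
    then show False
      by (rule RRa_not_constant[OF t, where f = f and B = "RRa t'" and u = u and c = "one_cons \<beta>", rotated])
        (use red in auto)
  qed
  have "t False False = 1 \<longleftrightarrow> t' False False = 1"
    using red[OF top(1) top(1)] fz by (simp add: RRa_simps)
  moreover have "t False False = 0 \<or> t False False = 1" "t' False False = 0 \<or> t' False False = 1"
    using t t' unfolding PPa_def by blast+
  ultimately have t00: "t False False = t' False False" by linarith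
  have r: "x \<in> Sset (t \<epsilon> \<eta>) \<longleftrightarrow> G x \<in> Sset (t' \<epsilon> \<eta>)" if "x \<in> cyl u" "\<epsilon> \<or> \<eta>" for x \<epsilon> \<eta>
  proof -
    have "x \<in> Sset (t False True) \<longleftrightarrow> G x \<in> Sset (t' False True)"
      using red[OF top(1) top(2)[of x]] unfolding fz fG[OF that(1)] RRa_simps .
    moreover have "x \<in> Sset (t True False) \<longleftrightarrow> G x \<in> Sset (t' True False)"
      using red[OF top(2)[of x] top(1)] unfolding fz fG[OF that(1)] RRa_simps .
    moreover have "x \<in> Sset (t True True) \<longleftrightarrow> G x \<in> Sset (t' True True)"
      using red[OF top(2)[of x] top(2)[of x]] unfolding fG[OF that(1)] RRa_simps by simp
    ultimately show ?thesis using that(2) by (cases \<epsilon>; cases \<eta>) simp_all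
  qed
  have "t False True = 0 \<or> t True False = 0" using t unfolding PPa_def mem_Collect_eq by (elim conjE)
  then obtain \<epsilon>0 \<eta>0 where e0: "\<epsilon>0 \<or> \<eta>0" "t \<epsilon>0 \<eta>0 = 0"
    using that[of False True] that[of True False] by (elim disjE) simp_all
  have red_CC: "x \<in> CC \<longleftrightarrow> G x \<in> Sset (t' \<epsilon>0 \<eta>0)" if "x \<in> cyl u" for x
    using r[OF that e0(1)] e0(2) by (simp add: Sset_simps)
  have "t' \<epsilon>0 \<eta>0 = 0" by (rule CC_reduces_to_Sset[OF Gc t4(2) red_CC])
  then have "x \<in> CC \<longleftrightarrow> G x \<in> CC" if "x \<in> cyl u" for x using red_CC[OF that] by (simp add: Sset_simps)
  then have "t \<epsilon> \<eta> = t' \<epsilon> \<eta>" if "\<epsilon> \<or> \<eta>" for \<epsilon> \<eta>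
    using Sset_index_eq[OF t4(1) t4(2), of u G] r that by blast
  then have "t \<epsilon> \<eta> = t' \<epsilon> \<eta>" for \<epsilon> \<eta> using t00 by (cases \<epsilon>; cases \<eta>) auto
  then show ?thesis by (simp add: fun_eq_iff)
qed

section \<open>The examples belong to the class\<close>

lemma Polish_homeomorphic:
  "X homeomorphic_space Y \<Longrightarrow> Polish_topology X \<longleftrightarrow> Polish_topology Y"
  unfolding Polish_topology_def
  using homeomorphic_completely_metrizable_space homeomorphic_separable_space by metis

lemma copy_homeomorphic: "inj h \<Longrightarrow> X homeomorphic_space fst (copy h (X, R))"
  using homeomorphic_map_copy homeomorphic_map_imp_homeomorphic_space by blast

text \<open>A space is moved along an injection onto a space of the type that is required in the definition.\<close>

lemma Polish_imp_analytic_space: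
  fixes X :: "'a topology" and h :: "'a \<Rightarrow> nat \<Rightarrow> real"
  assumes X: "Polish_topology X" and h: "inj h" shows "analytic_space X"
proof -
  define P where "P = fst (copy h (X, {}))"
  have hom: "X homeomorphic_space P" unfolding P_def by (rule copy_homeomorphic[OF h])
  then have P: "Polish_topology P" using X Polish_homeomorphic by blast
  have "analytic_in P (topspace P)"
    unfolding analytic_in_def by (intro conjI exI[of _ P] exI[of _ id]) (use P in auto)
  moreover have "X homeomorphic_space subtopology P (topspace P)" using hom by simp
  ultimately show ?thesis
    unfolding analytic_space_def using P X
    by (intro conjI exI[of _ P] exI[of _ "topspace P"])
      (auto simp: Polish_topology_def intro: completely_metrizable_imp_metrizable_space)
qed

lemma separable_cantor: "separable_space cantor"
  unfolding separable_space_def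
proof (intro exI conjI)
  show "countable CC" by (rule countable_CC)
  have "x \<in> cantor closure_of CC" for x
    unfolding in_closure_of
  proof (intro conjI allI impI)
    fix V assume "x \<in> V \<and> openin cantor V"
    then obtain n where "cyl (pre x n) \<subseteq> V" unfolding cantor_eq_seqtop openin_seqtop by blast
    then show "\<exists>y. y \<in> CC \<and> y \<in> V" using cyl_meets_CC(1)[of "pre x n"] by blast
  qed simp
  then show "cantor closure_of CC = topspace cantor" by auto
qed simp

lemma Polish_cantor: "Polish_topology cantor"
  unfolding Polish_topology_def using separable_cantor
  by (simp add: cantor_def completely_metrizable_space_product_topology completely_metrizable_space_discrete_topology)

lemma Polish_DD: "Polish_topology DD"
  unfolding Polish_topology_def
proof
  show "completely_metrizable_space DD"
    using Polish_cantor unfolding DD_def Polish_topology_def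
    by (simp add: completely_metrizable_space_prod_topology completely_metrizable_space_discrete_topology)
  have "continuous_map cantor (discrete_topology UNIV) (\<lambda>z :: nat \<Rightarrow> bool. z 0)"
    unfolding cantor_eq_seqtop continuous_map_seqtop
  proof (rule cont_onI)
    fix z :: "nat \<Rightarrow> bool" and V assume "z 0 \<in> V"
    then show "\<exists>n. \<forall>x\<in>UNIV. pre x n = pre z n \<longrightarrow> x 0 \<in> V"
      by (intro exI[of _ "Suc 0"]) (simp add: pre_eq_iff)
  qed simp
  then have "continuous_map cantor DD (\<lambda>z. (z 0, z \<circ> Suc))"
    unfolding DD_def by (rule continuous_map_pairedI[OF _ continuous_map_tail])
  moreover have "(\<lambda>z :: nat \<Rightarrow> bool. (z 0, z \<circ> Suc)) ` topspace cantor = topspace DD"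
  proof -
    have "p \<in> range (\<lambda>z :: nat \<Rightarrow> bool. (z 0, z \<circ> Suc))" for p
      by (rule range_eqI[of _ _ "case_nat (fst p) (snd p)"]) (simp add: comp_def)
    then show ?thesis unfolding topspace_cantor topspace_DD by blast
  qed
  ultimately show "separable_space DD" using separable_cantor separable_space_continuous_map_image by blast
qed

lemma closedin_SS: "closedin cantor ({zeros} \<union> {\<alpha>. \<alpha> 0})"
proof (intro closedin_Un closedin_cantor_singleton)
  have "closedin cantor {z \<in> topspace cantor. z 0 \<in> {True}}"
    unfolding cantor_def
    by (rule closedin_continuous_map_preimage[OF continuous_map_product_projection]) auto
  then show "closedin cantor {\<alpha>. \<alpha> 0}" by simp
qed

lemma Polish_SS: "Polish_topology SS"
  unfolding Polish_topology_def
proof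
  show "completely_metrizable_space SS"
    using Polish_cantor closedin_SS unfolding SS_def Polish_topology_def
    by (blast intro: completely_metrizable_space_closedin)
  define r where "r z = (if z 0 then z else zeros)" for z
  have "continuous_map cantor cantor r"
    unfolding cantor_eq_seqtop continuous_map_seqtop
  proof (rule cont_onI)
    fix z V assume "openin seqtop V" "r z \<in> V"
    then obtain n where n: "cyl (pre (r z) n) \<subseteq> V" unfolding openin_seqtop by blast
    have "r x \<in> V" if "pre x (Suc n) = pre z (Suc n)" for x
    proof -
      have "x 0 = z 0" "\<forall>i<n. x i = z i" using that unfolding pre_eq_iff by auto
      then have "r x \<in> cyl (pre (r z) n)" by (simp add: cyl_pre_iff pre_eq_iff r_def)
      then show ?thesis using n by blast
    qed
    then show "\<exists>n. \<forall>x\<in>UNIV. pre x n = pre z n \<longrightarrow> r x \<in> V" by blast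
  qed simp
  then have "continuous_map cantor SS r"
    unfolding SS_def by (auto simp: continuous_map_in_subtopology r_def)
  moreover have "r ` topspace cantor = topspace SS"
  proof -
    have "zeros = r zeros" "\<And>\<alpha>. \<alpha> 0 \<Longrightarrow> \<alpha> = r \<alpha>" by (auto simp: r_def)
    then have "{zeros} \<union> {\<alpha>. \<alpha> 0} \<subseteq> range r" by blast
    moreover have "range r \<subseteq> {zeros} \<union> {\<alpha>. \<alpha> 0}" by (auto simp: r_def)
    ultimately show ?thesis unfolding SS_def by auto
  qed
  ultimately show "separable_space SS" using separable_cantor separable_space_continuous_map_image by blast
qed

lemma analytic_cantor: "analytic_space cantor" and analytic_SS: "analytic_space SS"
proof -
  have "inj (\<lambda>(x :: nat \<Rightarrow> bool) i. of_bool (x i) :: real)" by (auto simp: inj_def fun_eq_iff)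
  then show "analytic_space cantor" "analytic_space SS"
    using Polish_imp_analytic_space Polish_cantor Polish_SS by blast+
qed

lemma analytic_DD: "analytic_space DD"
proof -
  have "inj (\<lambda>(b, x :: nat \<Rightarrow> bool) i. of_bool (case_nat b x i) :: real)"
  proof (rule injI)
    fix p q :: "bool \<times> (nat \<Rightarrow> bool)"
    assume eq: "(case p of (b, x) \<Rightarrow> \<lambda>i. of_bool (case_nat b x i) :: real) = (case q of (b, x) \<Rightarrow> \<lambda>i. of_bool (case_nat b x i))"
    obtain b x c y where pq: "p = (b, x)" "q = (c, y)" by (cases p, cases q) auto
    have e: "case_nat b x i = case_nat c y i" for i
      using fun_cong[OF eq, of i] unfolding pq prod.case of_bool_eq_iff .
    have "b = c" using e[of 0] by simp
    moreover have "x i = y i" for i using e[of "Suc i"] by simp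
    ultimately show "p = q" by (auto simp: pq)
  qed
  then show ?thesis using Polish_imp_analytic_space Polish_DD by blast
qed

lemma Borel_in_open: "openin X U \<Longrightarrow> Borel_in X U"
  unfolding Borel_in_def by (intro sigma_sets.Basic) simp

lemma Borel_in_Diff_top: "Borel_in X A \<Longrightarrow> Borel_in X (topspace X - A)"
  unfolding Borel_in_def by (rule sigma_sets.Compl)

lemma Borel_in_closed: "closedin X C \<Longrightarrow> Borel_in X C"
  using Borel_in_Diff_top[OF Borel_in_open[of X "topspace X - C"]] closedin_subset[of X C]
  by (simp add: double_diff closedin_def)

lemma Borel_in_sub: "Borel_in X A \<Longrightarrow> A \<subseteq> topspace X"
  unfolding Borel_in_def using sigma_sets_into_sp[of "{U. openin X U}" "topspace X" A] openin_subset by blast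

lemma Borel_in_Int: "Borel_in X A \<Longrightarrow> Borel_in X B \<Longrightarrow> Borel_in X (A \<inter> B)"
proof -
  assume A: "Borel_in X A" and B: "Borel_in X B"
  have "Borel_in X (topspace X - ((topspace X - A) \<union> (topspace X - B)))"
    using A B by (intro Borel_in_Diff_top Borel_in_Un)
  moreover have "topspace X - ((topspace X - A) \<union> (topspace X - B)) = A \<inter> B"
    using Borel_in_sub[OF A] by auto
  ultimately show ?thesis by simp
qed

lemma Borel_in_countable_Union:
  assumes "countable I" "\<And>i. i \<in> I \<Longrightarrow> Borel_in X (A i)" shows "Borel_in X (\<Union>i\<in>I. A i)"
  unfolding Borel_in_def
  by (rule sigma_sets_UNION) (use assms in \<open>auto simp: Borel_in_def\<close>)

lemma Borel_Sset: "i < 4 \<Longrightarrow> Borel_in cantor (Sset i)"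
proof -
  assume i: "i < 4"
  have "Borel_in cantor (\<Union>x\<in>CC. {x})"
    by (intro Borel_in_countable_Union countable_CC Borel_in_closed closedin_cantor_singleton)
  then have CC: "Borel_in cantor CC" by simp
  have "Borel_in cantor (- CC)" using Borel_in_Diff_top[OF CC] by (simp add: Compl_eq_Diff_UNIV)
  moreover have "Borel_in cantor {}" "Borel_in cantor UNIV"
    using Borel_in_open[of cantor "{}"] Borel_in_open[of cantor "topspace cantor"] openin_topspace[of cantor] by auto
  ultimately show ?thesis using less_4_cases[OF i] CC by (auto simp: Sset_simps)
qed

lemma Borel_equation:
  "Hausdorff_space Y \<Longrightarrow> continuous_map X Y f \<Longrightarrow> continuous_map X Y g \<Longrightarrow> Borel_in X {x \<in> topspace X. f x = g x}"
  by (rule Borel_in_closed[OF closedin_continuous_maps_eq])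

lemma gdelta_preimage_contra:
  assumes f: "continuous_map cantor Y f" and red: "\<And>x. f x \<in> R \<longleftrightarrow> x \<in> CC" shows "\<not> gdelta_in Y R"
proof
  assume "gdelta_in Y R"
  from gdelta_in_preimage[OF f this] have "gdelta_in cantor CC" by (simp add: red)
  then show False using CC_not_gdelta_on_cyl[of CC "[]"] by blast
qed

text \<open>The centre would lie on all the edges of a cycle, but no point lies on more than two of them.\<close>

lemma s_acyclic_star:
  assumes "\<And>p q. (p, q) \<in> R \<Longrightarrow> p = q \<or> p = c \<or> q = c" shows "s_acyclic R"
  unfolding s_acyclic_def path_acyclic_def
proof clarify
  fix n :: nat and x
  assume n: "2 \<le> n" and inj: "inj_on x {..n}" and path: "\<forall>i<n. (x i, x (Suc i)) \<in> symmetrization R"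
    and close: "(x n, x 0) \<in> symmetrization R"
  have s: "p = q \<or> p = c \<or> q = c" if "(p, q) \<in> symmetrization R" for p q
    using that assms by (auto simp: symmetrization_iff)
  have ne: "x i \<noteq> x j" if "i \<le> n" "j \<le> n" "i \<noteq> j" for i j using inj that by (auto simp: inj_on_def)
  have "(x 0, x 1) \<in> symmetrization R" "(x 1, x 2) \<in> symmetrization R" using path n by (auto simp: numeral_2_eq_2)
  then have "x 0 = x 1 \<or> x 0 = c \<or> x 1 = c" "x 1 = x 2 \<or> x 1 = c \<or> x 2 = c" "x n = x 0 \<or> x n = c \<or> x 0 = c"
    using s close by blast+
  then show False using ne[of 0 1] ne[of 1 2] ne[of 0 2] ne[of 1 n] ne[of 0 n] ne[of 1 0] n by auto
qed

lemma nonPi2_DeltaCC: "nonPi2_s_acyclic_relation (cantor, DeltaCC)"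
  unfolding nonPi2_s_acyclic_relation_def nonPi2_lcB_def
proof (simp only: prod.case snd_conv, intro conjI)
  let ?T = "prod_topology cantor cantor"
  show "analytic_space cantor" by (rule analytic_cantor)
  show "DeltaCC \<subseteq> topspace cantor \<times> topspace cantor" by simp
  have "Borel_in ?T ({p \<in> topspace ?T. fst p = snd p} \<inter> {p \<in> topspace ?T. fst p \<in> Sset 0})"
    by (intro Borel_in_Int Borel_equation[OF Hausdorff_cantor] Borel_in_preimage[OF Borel_Sset]
        continuous_map_fst continuous_map_snd) simp
  moreover have "{p \<in> topspace ?T. fst p = snd p} \<inter> {p \<in> topspace ?T. fst p \<in> Sset 0} = DeltaCC"
    by (auto simp: Sset_simps)
  ultimately show "Borel_in ?T DeltaCC" by simp
  have "{y. (x, y) \<in> DeltaCC} \<subseteq> {x}" "{y. (y, x) \<in> DeltaCC} \<subseteq> {x}" for x by auto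
  then show "locally_countable DeltaCC"
    unfolding locally_countable_def by (meson countable_subset countable_empty countable_insert)
  show "\<not> gdelta_in ?T DeltaCC"
  proof (rule gdelta_preimage_contra)
    show "continuous_map cantor ?T (\<lambda>x. (x, x))" by (intro continuous_map_pairedI) auto
  qed auto
  show "s_acyclic DeltaCC" by (rule s_acyclic_star[of _ undefined]) auto
qed

text \<open>All points of a path in \<open>RR t\<close> lie over the same point of Cantor space, and only two points do.\<close>

lemma nonPi2_RR:
  assumes t: "t \<in> PP" shows "nonPi2_s_acyclic_relation (DD, RR t)"
  unfolding nonPi2_s_acyclic_relation_def nonPi2_lcB_def
proof (simp only: prod.case snd_conv, intro conjI)
  let ?T = "prod_topology DD DD"
  have t4: "t \<epsilon> \<eta> < 4" for \<epsilon> \<eta> using t by (auto simp: PP_def tables_def)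
  have t01: "t False True = 0" using t by (auto simp: PP_def)
  show "analytic_space DD" by (rule analytic_DD)
  show "RR t \<subseteq> topspace DD \<times> topspace DD" by simp
  define E where "E = (\<lambda>(\<epsilon>, \<eta>). {p \<in> topspace ?T. fst p \<in> {p \<in> topspace DD. fst p = \<epsilon>}} \<inter>
      {p \<in> topspace ?T. snd p \<in> {p \<in> topspace DD. fst p = \<eta>}} \<inter>
      {p \<in> topspace ?T. (snd \<circ> fst) p = (snd \<circ> snd) p} \<inter> {p \<in> topspace ?T. (snd \<circ> fst) p \<in> Sset (t \<epsilon> \<eta>)})"
  have c: "continuous_map ?T cantor (snd \<circ> fst)" "continuous_map ?T cantor (snd \<circ> snd)"
    by (rule continuous_map_compose[OF continuous_map_fst continuous_map_DD_snd],
        rule continuous_map_compose[OF continuous_map_snd continuous_map_DD_snd])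
  have "Borel_in ?T (E q)" for q
    unfolding E_def case_prod_beta
    by (intro Borel_in_Int Borel_equation[OF Hausdorff_cantor c] Borel_in_preimage[OF Borel_Sset[OF t4] c(1)]
        Borel_in_preimage[OF Borel_in_open[OF openin_DD_fst] continuous_map_fst]
        Borel_in_preimage[OF Borel_in_open[OF openin_DD_fst] continuous_map_snd])
  then have "Borel_in ?T (\<Union>q. E q)" by (intro Borel_in_countable_Union) auto
  moreover have "(\<Union>q. E q) = RR t"
  proof (rule set_eqI)
    fix p :: "(bool \<times> (nat \<Rightarrow> bool)) \<times> (bool \<times> (nat \<Rightarrow> bool))"
    obtain \<epsilon> x \<eta> y where p: "p = ((\<epsilon>, x), (\<eta>, y))" by (metis surj_pair)
    show "p \<in> (\<Union>q. E q) \<longleftrightarrow> p \<in> RR t" unfolding p RR_iff E_def by auto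
  qed
  ultimately show "Borel_in ?T (RR t)" by simp
  have "{q. (p, q) \<in> RR t} \<subseteq> {(False, snd p), (True, snd p)}" "{q. (q, p) \<in> RR t} \<subseteq> {(False, snd p), (True, snd p)}"
    for p by (auto simp: RR_def)
  then show "locally_countable (RR t)"
    unfolding locally_countable_def by (meson countable_subset countable_empty countable_insert)
  show "\<not> gdelta_in ?T (RR t)"
  proof (rule gdelta_preimage_contra)
    show "continuous_map cantor ?T (\<lambda>x. ((False, x), (True, x)))"
      by (intro continuous_map_pairedI continuous_map_DD_section)
    show "((False, x), (True, x)) \<in> RR t \<longleftrightarrow> x \<in> CC" for x using t01 by (simp add: RR_iff Sset_simps)
  qed
  show "s_acyclic (RR t)"
    unfolding s_acyclic_def path_acyclic_def
  proof clarify
    fix n :: nat and x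
    assume n: "2 \<le> n" and inj: "inj_on x {..n}" and path: "\<forall>i<n. (x i, x (Suc i)) \<in> symmetrization (RR t)"
    have s: "snd p = snd q" if "(p, q) \<in> symmetrization (RR t)" for p q
      using that by (auto simp: symmetrization_iff RR_def)
    have "snd (x 0) = snd (x 1)" "snd (x 1) = snd (x 2)" using path n s by (auto simp: numeral_2_eq_2)
    moreover have "x 0 \<noteq> x 1" "x 1 \<noteq> x 2" "x 0 \<noteq> x 2"
      using n by (simp_all add: inj_on_eq_iff[OF inj])
    moreover have "fst (x 0) = fst (x 1) \<or> fst (x 1) = fst (x 2) \<or> fst (x 0) = fst (x 2)" by blast
    ultimately show False unfolding prod_eq_iff by simp
  qed
qed

lemma nonPi2_RRa:
  assumes t: "t \<in> PPa" shows "nonPi2_s_acyclic_relation (SS, RRa t)"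
  unfolding nonPi2_s_acyclic_relation_def nonPi2_lcB_def
proof (simp only: prod.case snd_conv, intro conjI)
  let ?T = "prod_topology SS SS"
  let ?tl = "\<lambda>z :: nat \<Rightarrow> bool. z \<circ> Suc"
  have t4: "t \<epsilon> \<eta> < 4" for \<epsilon> \<eta> using t by (auto simp: PPa_def tables_def)
  have t01: "t False True = 0 \<or> t False True = 1" "t True False = 0 \<or> t True False = 1"
    using t unfolding PPa_def by auto
  have top: "zeros \<in> topspace SS" "\<And>\<alpha>. one_cons \<alpha> \<in> topspace SS" by (auto simp: topspace_SS)
  show "analytic_space SS" by (rule analytic_SS)
  show "RRa t \<subseteq> topspace SS \<times> topspace SS" using top by (auto simp: RRa_def)
  define H where "H \<epsilon> = {p \<in> topspace SS. p 0 = \<epsilon>}" for \<epsilon> :: bool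
  define E where "E \<epsilon> \<eta> = {p \<in> topspace ?T. fst p \<in> H \<epsilon>} \<inter> {p \<in> topspace ?T. snd p \<in> H \<eta>}" for \<epsilon> \<eta>
  have E: "Borel_in ?T (E \<epsilon> \<eta>)" for \<epsilon> \<eta>
    unfolding E_def H_def
    by (intro Borel_in_Int Borel_in_preimage[OF Borel_in_open[OF openin_SS_head] continuous_map_fst]
        Borel_in_preimage[OF Borel_in_open[OF openin_SS_head] continuous_map_snd])
  have c: "continuous_map ?T cantor (?tl \<circ> fst)" "continuous_map ?T cantor (?tl \<circ> snd)"
    by (rule continuous_map_compose[OF continuous_map_fst continuous_map_SS_tail],
        rule continuous_map_compose[OF continuous_map_snd continuous_map_SS_tail])
  define B where "B = (if t False False = 1 then E False False else {}) \<union>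
    (E False True \<inter> {p \<in> topspace ?T. (?tl \<circ> snd) p \<in> Sset (t False True)}) \<union>
    (E True False \<inter> {p \<in> topspace ?T. (?tl \<circ> fst) p \<in> Sset (t True False)}) \<union>
    (E True True \<inter> {p \<in> topspace ?T. (?tl \<circ> fst) p = (?tl \<circ> snd) p} \<inter>
      {p \<in> topspace ?T. (?tl \<circ> fst) p \<in> Sset (t True True)})"
  have "Borel_in ?T (if t False False = 1 then E False False else {})"
    using E Borel_in_open[of ?T "{}"] by simp
  then have "Borel_in ?T B"
    unfolding B_def
    by (intro Borel_in_Un Borel_in_Int E Borel_equation[OF Hausdorff_cantor c]
      Borel_in_preimage[OF Borel_Sset[OF t4] c(1)] Borel_in_preimage[OF Borel_Sset[OF t4] c(2)])
  moreover have "B = RRa t"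
  proof -
    have hd: "\<not> zeros 0" "one_cons \<alpha> 0" "one_cons \<alpha> \<circ> Suc = \<alpha>" for \<alpha>
      by (auto simp: zeros_def one_cons_def comp_def)
    have iff: "(x, y) \<in> B \<longleftrightarrow> (x, y) \<in> RRa t" if "x \<in> topspace SS" "y \<in> topspace SS" for x y
      using that
      by (elim SS_cases) (simp_all add: B_def E_def H_def RRa_simps hd top)
    have "B \<subseteq> topspace SS \<times> topspace SS" unfolding B_def E_def by (auto split: if_splits)
    moreover have "RRa t \<subseteq> topspace SS \<times> topspace SS" using top by (auto simp: RRa_def)
    ultimately show ?thesis using iff by auto
  qed
  ultimately show "Borel_in ?T (RRa t)" by simp
  have cS: "countable (Sset (t False True))" "countable (Sset (t True False))"
    using t01 countable_CC by (auto simp: Sset_simps)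
  define K where "K x = insert zeros (insert x (one_cons ` Sset (t False True) \<union> one_cons ` Sset (t True False)))"
    for x
  have K: "countable (K x)" for x using cS by (simp add: K_def)
  have "{y. (x, y) \<in> RRa t} \<subseteq> K x" "{y. (y, x) \<in> RRa t} \<subseteq> K x" for x
    by (auto simp: RRa_def K_def)
  then show "locally_countable (RRa t)"
    unfolding locally_countable_def using K by (meson countable_subset)
  show "\<not> gdelta_in ?T (RRa t)"
  proof (cases rule: RRa_edge[OF t])
    case 1
    have "continuous_map cantor ?T (\<lambda>\<alpha>. (zeros, one_cons \<alpha>))"
      using top(1) by (intro continuous_map_pairedI continuous_map_one_cons) simp
    from gdelta_preimage_contra[OF this 1] show ?thesis .
  next
    case 2
    have "continuous_map cantor ?T (\<lambda>\<alpha>. (one_cons \<alpha>, zeros))"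
      using top(1) by (intro continuous_map_pairedI continuous_map_one_cons) simp
    from gdelta_preimage_contra[OF this 2] show ?thesis .
  qed
  show "s_acyclic (RRa t)" by (rule s_acyclic_star[of _ zeros]) (auto simp: RRa_def)
qed

lemma copy_eq: "copy h (X, R) = (fst (copy h (X, R)), map_prod h h ` R)"
  by (simp add: copy_def)

lemma topspace_copy: "inj h \<Longrightarrow> topspace (fst (copy h (X, R))) = h ` topspace X"
  using homeomorphic_imp_surjective_map[OF homeomorphic_map_copy] by metis

lemma continuous_map_copy: "inj h \<Longrightarrow> continuous_map X (fst (copy h (X, R))) h"
  using homeomorphic_imp_continuous_map[OF homeomorphic_map_copy] .

lemma continuous_map_copy_inv:
  assumes h: "inj h" shows "continuous_map (fst (copy h (X, R))) X (inv h)"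
  using continuous_map_pullback[OF continuous_map_id, of "h ` topspace X" "inv h" X] by (simp add: copy_def)

lemma map_prod_image_iff: "inj h \<Longrightarrow> (h x, h y) \<in> map_prod h h ` R \<longleftrightarrow> (x, y) \<in> R"
  by (auto simp: inj_eq)

lemma c_emb_copy:
  assumes h: "inj h" and R: "R \<subseteq> topspace X \<times> topspace X" shows "(X, R) \<sqsubseteq>\<^sub>c copy h (X, R)"
proof -
  have "(X, R) \<sqsubseteq>\<^sub>c (fst (copy h (X, R)), map_prod h h ` R)"
    by (rule c_embI[of _ _ h]) (use h R continuous_map_copy[OF h] map_prod_image_iff[OF h] in \<open>auto intro: inj_on_subset\<close>)
  then show ?thesis by (simp flip: copy_eq)
qed

lemma c_emb_copy_inv:
  assumes h: "inj h" and R: "R \<subseteq> topspace X \<times> topspace X" shows "copy h (X, R) \<sqsubseteq>\<^sub>c (X, R)"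
proof -
  have "(fst (copy h (X, R)), map_prod h h ` R) \<sqsubseteq>\<^sub>c (X, R)"
  proof (rule c_embI[of _ _ "inv h"])
    show "continuous_map (fst (copy h (X, R))) X (inv h)" by (rule continuous_map_copy_inv[OF h])
    show "inj_on (inv h) (topspace (fst (copy h (X, R))))"
      unfolding topspace_copy[OF h] using h by (auto simp: inj_on_def)
    show "map_prod h h ` R \<subseteq> topspace (fst (copy h (X, R))) \<times> topspace (fst (copy h (X, R)))"
      unfolding topspace_copy[OF h] using R by auto
    show "(x, y) \<in> map_prod h h ` R \<longleftrightarrow> (inv h x, inv h y) \<in> R"
      if "x \<in> topspace (fst (copy h (X, R)))" "y \<in> topspace (fst (copy h (X, R)))" for x y
      using that h unfolding topspace_copy[OF h] by (auto simp: map_prod_image_iff)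
  qed
  then show ?thesis by (simp flip: copy_eq)
qed

lemma c_emb_trans:
  assumes "S \<sqsubseteq>\<^sub>c T" "T \<sqsubseteq>\<^sub>c U" shows "S \<sqsubseteq>\<^sub>c U"
proof -
  obtain X A Y B Z C where STU: "S = (X, A)" "T = (Y, B)" "U = (Z, C)" by (cases S, cases T, cases U) auto
  obtain f where f: "continuous_map X Y f" "A = {(x, y) \<in> topspace X \<times> topspace X. (f x, f y) \<in> B}" "inj_on f (topspace X)"
    using assms(1) unfolding c_emb_def c_reduction_def STU by auto
  obtain g where g: "continuous_map Y Z g" "B = {(x, y) \<in> topspace Y \<times> topspace Y. (g x, g y) \<in> C}" "inj_on g (topspace Y)"
    using assms(2) unfolding c_emb_def c_reduction_def STU by auto
  have fY: "f x \<in> topspace Y" if "x \<in> topspace X" for x using continuous_map_funspace[OF f(1)] that by auto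
  show ?thesis unfolding STU
  proof (rule c_embI[of _ _ "g \<circ> f"])
    show "continuous_map X Z (g \<circ> f)" by (rule continuous_map_compose[OF f(1) g(1)])
    show "inj_on (g \<circ> f) (topspace X)" using f(3) g(3) fY by (auto simp: inj_on_def)
    show "A \<subseteq> topspace X \<times> topspace X" using f(2) by auto
    show "(x, y) \<in> A \<longleftrightarrow> ((g \<circ> f) x, (g \<circ> f) y) \<in> C" if "x \<in> topspace X" "y \<in> topspace X" for x y
      using that f(2) g(2) fY by auto
  qed
qed

lemma c_le_trans:
  assumes "S \<le>\<^sub>c T" "T \<le>\<^sub>c U" shows "S \<le>\<^sub>c U"
proof -
  obtain X A Y B Z C where STU: "S = (X, A)" "T = (Y, B)" "U = (Z, C)" by (cases S, cases T, cases U) auto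
  obtain f where f: "continuous_map X Y f" "A = {(x, y) \<in> topspace X \<times> topspace X. (f x, f y) \<in> B}"
    using assms(1) unfolding c_le_def c_reduction_def STU by auto
  obtain g where g: "continuous_map Y Z g" "B = {(x, y) \<in> topspace Y \<times> topspace Y. (g x, g y) \<in> C}"
    using assms(2) unfolding c_le_def c_reduction_def STU by auto
  have fY: "f x \<in> topspace Y" if "x \<in> topspace X" for x using continuous_map_funspace[OF f(1)] that by auto
  have "A = {(x, y) \<in> topspace X \<times> topspace X. ((g \<circ> f) x, (g \<circ> f) y) \<in> C}"
    using f(2) g(2) fY by auto
  then show ?thesis
    unfolding STU c_le_def c_reduction_def using continuous_map_compose[OF f(1) g(1)] by auto
qed

lemma c_emb_imp_le: "S \<sqsubseteq>\<^sub>c T \<Longrightarrow> S \<le>\<^sub>c T"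
  unfolding c_emb_def c_le_def by blast

lemma c_le_copies:
  assumes "inj h" "inj k" "R \<subseteq> topspace X \<times> topspace X" "Q \<subseteq> topspace Y \<times> topspace Y"
    "copy h (X, R) \<le>\<^sub>c copy k (Y, Q)"
  shows "(X, R) \<le>\<^sub>c (Y, Q)"
  using c_le_trans[OF c_le_trans[OF c_emb_imp_le[OF c_emb_copy[OF assms(1,3)]] assms(5)]
      c_emb_imp_le[OF c_emb_copy_inv[OF assms(2,4)]]] .

lemma path_acyclic_preimage:
  assumes S: "path_acyclic S" and inj: "inj_on f A" and sub: "S' \<subseteq> A \<times> A"
    and map: "\<And>x y. (x, y) \<in> S' \<Longrightarrow> (f x, f y) \<in> S"
  shows "path_acyclic S'"
  unfolding path_acyclic_def
proof clarify
  fix n :: nat and x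
  assume n: "2 \<le> n" and xinj: "inj_on x {..n}" and path: "\<forall>i<n. (x i, x (Suc i)) \<in> S'" and close: "(x n, x 0) \<in> S'"
  have xA: "x i \<in> A" if "i \<le> n" for i
  proof (cases "i = n")
    case True
    then show ?thesis using close sub by auto
  next
    case False
    then have "(x i, x (Suc i)) \<in> S'" using path that by simp
    then show ?thesis using sub by blast
  qed
  have "inj_on (f \<circ> x) {..n}"
    by (rule comp_inj_on[OF xinj inj_on_subset[OF inj]]) (use xA in auto)
  moreover have "\<forall>i<n. ((f \<circ> x) i, (f \<circ> x) (Suc i)) \<in> S" "((f \<circ> x) n, (f \<circ> x) 0) \<in> S"
    using path close map by auto
  ultimately show False using S n unfolding path_acyclic_def by blast
qed

text \<open>All parts of the definition are invariant under homeomorphisms.\<close>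

lemma nonPi2_copy:
  assumes h: "inj h" and R: "nonPi2_s_acyclic_relation (X, R)"
  shows "nonPi2_s_acyclic_relation (copy h (X, R))"
proof -
  have X: "analytic_space X" and sub: "R \<subseteq> topspace X \<times> topspace X" and Borel: "Borel_in (prod_topology X X) R"
    and loc: "locally_countable R" and ng: "\<not> gdelta_in (prod_topology X X) R" and acyc: "s_acyclic R"
    using R unfolding nonPi2_s_acyclic_relation_def nonPi2_lcB_def by auto
  define Y where "Y = fst (copy h (X, R))"
  define Q where "Q = map_prod h h ` R"
  have topY: "topspace Y = h ` topspace X" unfolding Y_def by (rule topspace_copy[OF h])
  have hc: "continuous_map X Y h" unfolding Y_def by (rule continuous_map_copy[OF h])
  have ic: "continuous_map Y X (inv h)" unfolding Y_def by (rule continuous_map_copy_inv[OF h])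
  have hom: "X homeomorphic_space Y" unfolding Y_def by (rule copy_homeomorphic[OF h])
  have "analytic_space Y"
    using X hom homeomorphic_separable_space[OF hom] homeomorphic_metrizable_space[OF hom]
      homeomorphic_space_trans homeomorphic_space_sym unfolding analytic_space_def by metis
  moreover have "Q \<subseteq> topspace Y \<times> topspace Y" using sub unfolding Q_def topY by auto
  moreover have "Borel_in (prod_topology Y Y) Q"
  proof -
    have "continuous_map (prod_topology Y Y) (prod_topology X X) (\<lambda>p. ((inv h \<circ> fst) p, (inv h \<circ> snd) p))"
      by (intro continuous_map_pairedI continuous_map_compose[OF continuous_map_fst ic] continuous_map_compose[OF continuous_map_snd ic])
    from Borel_in_preimage[OF Borel this]
    have "Borel_in (prod_topology Y Y) {p \<in> topspace (prod_topology Y Y). (inv h (fst p), inv h (snd p)) \<in> R}" by simp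
    moreover have "{p \<in> topspace (prod_topology Y Y). (inv h (fst p), inv h (snd p)) \<in> R} = Q"
    proof -
      have "(h a, h b) \<in> Q \<longleftrightarrow> (a, b) \<in> R" for a b unfolding Q_def by (rule map_prod_image_iff[OF h])
      moreover have "Q \<subseteq> h ` topspace X \<times> h ` topspace X" using sub unfolding Q_def by auto
      ultimately show ?thesis unfolding topspace_prod_topology topY using h by (auto simp: inv_f_f)
    qed
    ultimately show ?thesis by simp
  qed
  moreover have "locally_countable Q"
    unfolding locally_countable_def
  proof (intro conjI allI)
    fix x
    have "{y. (x, y) \<in> Q} \<subseteq> h ` {y. (inv h x, y) \<in> R}" using h unfolding Q_def by (auto simp: inv_f_f)
    then show "countable {y. (x, y) \<in> Q}" using loc unfolding locally_countable_def by (meson countable_image countable_subset)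
    have "{y. (y, x) \<in> Q} \<subseteq> h ` {y. (y, inv h x) \<in> R}" using h unfolding Q_def by (auto simp: inv_f_f)
    then show "countable {y. (y, x) \<in> Q}" using loc unfolding locally_countable_def by (meson countable_image countable_subset)
  qed
  moreover have "\<not> gdelta_in (prod_topology Y Y) Q"
  proof
    assume g: "gdelta_in (prod_topology Y Y) Q"
    have "continuous_map (prod_topology X X) (prod_topology Y Y) (\<lambda>p. ((h \<circ> fst) p, (h \<circ> snd) p))"
      by (intro continuous_map_pairedI continuous_map_compose[OF continuous_map_fst hc] continuous_map_compose[OF continuous_map_snd hc])
    from gdelta_in_preimage[OF this g]
    have "gdelta_in (prod_topology X X) {p \<in> topspace (prod_topology X X). (h (fst p), h (snd p)) \<in> Q}" by simp
    moreover have "{p \<in> topspace (prod_topology X X). (h (fst p), h (snd p)) \<in> Q} = R"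
      using sub unfolding Q_def map_prod_image_iff[OF h] by auto
    ultimately show False using ng by simp
  qed
  moreover have "s_acyclic Q"
    unfolding s_acyclic_def
  proof (rule path_acyclic_preimage)
    show "path_acyclic (symmetrization R)" using acyc by (simp add: s_acyclic_def)
    show "inj_on (inv h) (range h)" using h by (auto simp: inj_on_def)
    show "symmetrization Q \<subseteq> range h \<times> range h" by (auto simp: symmetrization_def Q_def)
    show "(inv h x, inv h y) \<in> symmetrization R" if "(x, y) \<in> symmetrization Q" for x y
      using that h by (auto simp: symmetrization_iff Q_def inv_f_f)
  qed
  ultimately have "nonPi2_s_acyclic_relation (Y, Q)"
    unfolding nonPi2_s_acyclic_relation_def nonPi2_lcB_def by simp
  then show ?thesis unfolding Y_def Q_def by (simp flip: copy_eq)
qed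

section \<open>The antichain bases\<close>

lemma RR_sub: "RR t \<subseteq> topspace DD \<times> topspace DD"
  by simp

lemma RRa_sub: "RRa t \<subseteq> topspace SS \<times> topspace SS"
  by (auto simp: RRa_def topspace_SS)

lemma DeltaCC_sub: "DeltaCC \<subseteq> topspace cantor \<times> topspace cantor"
  by simp

lemma CC_family_cases:
  assumes "S \<in> CC_family"
  obtains (diagonal) "S = on_cantor (cantor, DeltaCC)" | (double) t where "t \<in> PP" "S = on_D (DD, RR t)"
    | (star) t where "t \<in> PPa" "S = on_cantor (SS, RRa t)"
  using assms unfolding CC_family_def AA_family_def by blast

text \<open>This single statement gives both antichain properties, since an embedding is a reduction.\<close>

lemma CC_family_le_imp_eq:
  assumes S: "S \<in> CC_family" and T: "T \<in> CC_family" and le: "S \<le>\<^sub>c T" shows "S = T"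
proof -
  show ?thesis
    using S
  proof (cases rule: CC_family_cases)
    case diagonal
    show ?thesis
      using T
    proof (cases rule: CC_family_cases)
      case (double t)
      then show ?thesis using not_DeltaCC_le_RR[of t] le diagonal
          c_le_copies[OF inj_Inl inj_Inr DeltaCC_sub RR_sub] by blast
    next
      case (star t)
      then show ?thesis using not_DeltaCC_le_RRa[of t] le diagonal
          c_le_copies[OF inj_Inl inj_Inl DeltaCC_sub RRa_sub] by blast
    qed (simp add: diagonal)
  next
    case (double t)
    note t = this
    show ?thesis
      using T
    proof (cases rule: CC_family_cases)
      case diagonal
      then show ?thesis using not_RR_le_DeltaCC[of t] le t
          c_le_copies[OF inj_Inr inj_Inl RR_sub DeltaCC_sub] by blast
    next
      case (double t')
      then have "(DD, RR t) \<le>\<^sub>c (DD, RR t')" using le t c_le_copies[OF inj_Inr inj_Inr RR_sub RR_sub] by blast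
      then show ?thesis using RR_le_RR_imp_eq double t by blast
    next
      case (star t')
      then show ?thesis using not_RR_le_RRa[of t] le t
          c_le_copies[OF inj_Inr inj_Inl RR_sub RRa_sub] by blast
    qed
  next
    case (star t)
    note t = this
    show ?thesis
      using T
    proof (cases rule: CC_family_cases)
      case diagonal
      then show ?thesis using not_RRa_le_DeltaCC[of t] le t
          c_le_copies[OF inj_Inl inj_Inl RRa_sub DeltaCC_sub] by blast
    next
      case (double t')
      then show ?thesis using not_RRa_le_RR[of t] le t
          c_le_copies[OF inj_Inl inj_Inr RRa_sub RR_sub] by blast
    next
      case (star t')
      then have "(SS, RRa t) \<le>\<^sub>c (SS, RRa t')" using le t c_le_copies[OF inj_Inl inj_Inl RRa_sub RRa_sub] by blast
      then show ?thesis using RRa_le_RRa_imp_eq star t by blast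
    qed
  qed
qed

lemma CC_family_nonPi2:
  assumes "S \<in> CC_family" shows "nonPi2_s_acyclic_relation S"
  using assms
proof (cases rule: CC_family_cases)
  case diagonal
  then show ?thesis using nonPi2_copy[OF inj_Inl nonPi2_DeltaCC] by simp
next
  case (double t)
  then show ?thesis using nonPi2_copy[OF inj_Inr nonPi2_RR] by simp
next
  case (star t)
  then show ?thesis using nonPi2_copy[OF inj_Inl nonPi2_RRa] by simp
qed

lemma CC_family_emb:
  assumes "nonPi2_s_acyclic_relation T" shows "\<exists>S\<in>CC_family. S \<sqsubseteq>\<^sub>c T"
proof -
  obtain X R where T: "T = (X, R)" by (cases T)
  have lc: "acyclic_relation X R" and ng: "\<not> gdelta_in (prod_topology X X) R"
    using assms unfolding T nonPi2_s_acyclic_relation_def nonPi2_lcB_def acyclic_relation_def by auto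
  have mem: "on_cantor (cantor, DeltaCC) \<in> CC_family" "\<And>t. t \<in> PP \<Longrightarrow> on_D (DD, RR t) \<in> CC_family"
    "\<And>t. t \<in> PPa \<Longrightarrow> on_cantor (SS, RRa t) \<in> CC_family"
    unfolding CC_family_def AA_family_def by blast+
  show ?thesis
    using acyclic_relation.embed_basis[OF lc ng]
  proof (elim disjE bexE)
    assume "(cantor, DeltaCC) \<sqsubseteq>\<^sub>c (X, R)"
    then show ?thesis using c_emb_trans[OF c_emb_copy_inv[OF inj_Inl DeltaCC_sub]] mem(1) T by blast
  next
    fix t assume "t \<in> PP" "(DD, RR t) \<sqsubseteq>\<^sub>c (X, R)"
    then show ?thesis using c_emb_trans[OF c_emb_copy_inv[OF inj_Inr RR_sub]] mem(2) T by blast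
  next
    fix t assume "t \<in> PPa" "(SS, RRa t) \<sqsubseteq>\<^sub>c (X, R)"
    then show ?thesis using c_emb_trans[OF c_emb_copy_inv[OF inj_Inl RRa_sub]] mem(3) T by blast
  qed
qed

text \<open>Tables are counted by their four entries.\<close>

definition table :: "nat \<Rightarrow> nat \<Rightarrow> nat \<Rightarrow> nat \<Rightarrow> bool \<Rightarrow> bool \<Rightarrow> nat" where
  "table a b c d \<epsilon> \<eta> = (if \<epsilon> then if \<eta> then d else c else if \<eta> then b else a)"

lemma table_simps: "table a b c d False False = a" "table a b c d False True = b"
  "table a b c d True False = c" "table a b c d True True = d"
  by (simp_all add: table_def)

lemma table_collapse: "table (t False False) (t False True) (t True False) (t True True) = t"
  by (intro ext) (auto simp: table_def)

lemma table_inject: "table a b c d = table a' b' c' d' \<longleftrightarrow> a = a' \<and> b = b' \<and> c = c' \<and> d = d'"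
  by (metis table_simps)

lemma table_in_tables: "table a b c d \<in> tables \<longleftrightarrow> a < 4 \<and> b < 4 \<and> c < 4 \<and> d < 4"
  unfolding tables_def by (auto simp: table_def all_bool_eq)

lemma card_tables:
  fixes B :: "(nat \<times> nat \<times> nat \<times> nat) set"
  assumes "\<And>t. t \<in> A \<longleftrightarrow> (t False False, t False True, t True False, t True True) \<in> B"
  shows "card A = card B"
proof -
  define f where "f = (\<lambda>(a, b, c, d). table a b c d)"
  have "A = f ` B"
  proof (rule set_eqI, rule iffI)
    fix t assume "t \<in> A"
    then have "(t False False, t False True, t True False, t True True) \<in> B" using assms by blast
    then have "f (t False False, t False True, t True False, t True True) \<in> f ` B" by (rule imageI)
    then show "t \<in> f ` B" by (simp add: f_def table_collapse)
  next
    fix t assume "t \<in> f ` B"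
    then obtain a b c d where "(a, b, c, d) \<in> B" "t = table a b c d" by (auto simp: f_def)
    then show "t \<in> A" using assms by (simp add: table_simps)
  qed
  moreover have "inj_on f B" by (auto simp: inj_on_def f_def table_inject)
  ultimately show ?thesis by (simp add: card_image)
qed

lemma tables_iff:
  "t \<in> tables \<longleftrightarrow> t False False < 4 \<and> t False True < 4 \<and> t True False < 4 \<and> t True True < 4"
  unfolding tables_def by (simp add: all_bool_eq conj_ac)

lemma card_PP: "card PP = 33"
proof -
  define L where "L = filter (\<lambda>(a, b, c, d). c = 0 \<longrightarrow> a \<le> d)
    (List.product [1, 2, 3 :: nat] (List.product [0 :: nat] (List.product [0, 1, 2, 3 :: nat] [1, 2, 3 :: nat])))"
  have "t \<in> PP \<longleftrightarrow> (t False False, t False True, t True False, t True True) \<in> set L" for t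
  proof -
    have L: "(a, b, c, d) \<in> set L \<longleftrightarrow>
        a \<in> {1, 2, 3} \<and> b = 0 \<and> c \<in> {0, 1, 2, 3} \<and> d \<in> {1, 2, 3} \<and> (c = 0 \<longrightarrow> a \<le> d)" for a b c d
      unfolding L_def set_filter set_product mem_Collect_eq mem_Times_iff fst_conv snd_conv prod.case list.set
      by blast
    have range: "a \<in> {1, 2, 3} \<longleftrightarrow> a < 4 \<and> a \<noteq> 0" "a \<in> {0, 1, 2, 3} \<longleftrightarrow> a < 4" for a :: nat by auto
    show ?thesis unfolding L range PP_def mem_Collect_eq tables_iff
      using zero_less_numeral[of "num.Bit0 (num.Bit0 num.One)", where 'a = nat] by metis
  qed
  then have "card PP = card (set L)" by (rule card_tables)
  also have "\<dots> = length L" by (rule distinct_card) (simp add: L_def distinct_product)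
  also have "\<dots> = 33" by (simp add: L_def)
  finally show ?thesis .
qed

lemma card_PPa: "card PPa = 18"
proof -
  define L where "L = filter (\<lambda>(a, b, c, d). b = 0 \<or> c = 0)
    (List.product [0, 1 :: nat] (List.product [0, 1 :: nat] (List.product [0, 1 :: nat] [1, 2, 3 :: nat])))"
  have "t \<in> PPa \<longleftrightarrow> (t False False, t False True, t True False, t True True) \<in> set L" for t
  proof -
    have L: "(a, b, c, d) \<in> set L \<longleftrightarrow>
        a \<in> {0, 1} \<and> b \<in> {0, 1} \<and> c \<in> {0, 1} \<and> d \<in> {1, 2, 3} \<and> (b = 0 \<or> c = 0)" for a b c d
      unfolding L_def set_filter set_product mem_Collect_eq mem_Times_iff fst_conv snd_conv prod.case list.set
      by blast
    have range: "a \<in> {1, 2, 3} \<longleftrightarrow> a < 4 \<and> a \<noteq> 0" "a \<in> {0, 1} \<longrightarrow> a < 4" for a :: nat by auto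
    show ?thesis unfolding L range(1) PPa_def mem_Collect_eq tables_iff
      using range(2)[of "t False False"] range(2)[of "t False True"] range(2)[of "t True False"] by satx
  qed
  then have "card PPa = card (set L)" by (rule card_tables)
  also have "\<dots> = length L" by (rule distinct_card) (simp add: L_def distinct_product)
  also have "\<dots> = 18" by (simp add: L_def)
  finally show ?thesis .
qed

lemma c_le_refl: "R \<subseteq> topspace X \<times> topspace X \<Longrightarrow> (X, R) \<le>\<^sub>c (X, R)"
  unfolding c_le_def c_reduction_def by (auto intro!: exI[of _ id])

text \<open>The distinctness of the listed relations comes for free from their incomparability; 52 = 1 + 33 + 18.\<close>

lemma card_CC_family: "card CC_family = 52"
proof -
  define A where "A = (\<lambda>t. on_D (DD, RR t)) ` PP"
  define B where "B = (\<lambda>t. on_cantor (SS, RRa t)) ` PPa"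
  have fin: "finite PP" "finite PPa" using card_PP card_PPa by (metis card.infinite zero_neq_numeral)+
  have "inj_on (\<lambda>t. on_D (DD, RR t)) PP"
  proof (rule inj_onI)
    fix t t' assume t: "t \<in> PP" "t' \<in> PP" and eq: "on_D (DD, RR t) = on_D (DD, RR t')"
    have "RR t = RR t'" using copy_inject(2)[OF inj_Inr eq] .
    then have "(DD, RR t) \<le>\<^sub>c (DD, RR t')" using c_le_refl[OF RR_sub] by metis
    then show "t = t'" using RR_le_RR_imp_eq t by blast
  qed
  then have cA: "card A = 33" "finite A" unfolding A_def using card_PP fin by (simp_all add: card_image)
  have "inj_on (\<lambda>t. on_cantor (SS, RRa t)) PPa"
  proof (rule inj_onI)
    fix t t' assume t: "t \<in> PPa" "t' \<in> PPa" and eq: "on_cantor (SS, RRa t) = on_cantor (SS, RRa t')"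
    have "RRa t = RRa t'" using copy_inject(2)[OF inj_Inl eq] .
    then have "(SS, RRa t) \<le>\<^sub>c (SS, RRa t')" using c_le_refl[OF RRa_sub] by metis
    then show "t = t'" using RRa_le_RRa_imp_eq t by blast
  qed
  then have cB: "card B = 18" "finite B" unfolding B_def using card_PPa fin by (simp_all add: card_image)
  have refl: "on_cantor (SS, RRa t) \<le>\<^sub>c on_cantor (SS, RRa t)" for t
    using c_le_trans[OF c_emb_imp_le[OF c_emb_copy_inv[OF inj_Inl RRa_sub]] c_emb_imp_le[OF c_emb_copy[OF inj_Inl RRa_sub]]] .
  have "A \<inter> B = {}"
  proof (rule ccontr)
    assume "A \<inter> B \<noteq> {}"
    then obtain S where "S \<in> A" "S \<in> B" by blast
    obtain t where t: "t \<in> PP" "S = on_D (DD, RR t)" using \<open>S \<in> A\<close> unfolding A_def by (rule imageE)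
    obtain t' where "S = on_cantor (SS, RRa t')" using \<open>S \<in> B\<close> unfolding B_def by (rule imageE)
    then have "on_D (DD, RR t) \<le>\<^sub>c on_cantor (SS, RRa t')" using refl[of t'] t(2) by simp
    then show False using not_RR_le_RRa[OF t(1)] c_le_copies[OF inj_Inr inj_Inl RR_sub RRa_sub] by blast
  qed
  moreover have "on_cantor (cantor, DeltaCC) \<notin> A \<union> B"
  proof
    assume "on_cantor (cantor, DeltaCC) \<in> A \<union> B"
    moreover have r: "on_cantor (cantor, DeltaCC) \<le>\<^sub>c on_cantor (cantor, DeltaCC)"
      using c_le_trans[OF c_emb_imp_le[OF c_emb_copy_inv[OF inj_Inl DeltaCC_sub]] c_emb_imp_le[OF c_emb_copy[OF inj_Inl DeltaCC_sub]]] .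
    ultimately consider t where "t \<in> PP" "on_cantor (cantor, DeltaCC) \<le>\<^sub>c on_D (DD, RR t)"
      | t where "t \<in> PPa" "on_cantor (cantor, DeltaCC) \<le>\<^sub>c on_cantor (SS, RRa t)"
      unfolding A_def B_def by auto
    then show False
    proof cases
      case 1
      then show False using not_DeltaCC_le_RR c_le_copies[OF inj_Inl inj_Inr DeltaCC_sub RR_sub] by blast
    next
      case 2
      then show False using not_DeltaCC_le_RRa c_le_copies[OF inj_Inl inj_Inl DeltaCC_sub RRa_sub] by blast
    qed
  qed
  ultimately have "card (insert (on_cantor (cantor, DeltaCC)) (A \<union> B)) = 52"
    using cA cB by (simp add: card_Un_disjoint card_insert_if)
  moreover have "CC_family = insert (on_cantor (cantor, DeltaCC)) (A \<union> B)"
    unfolding CC_family_def AA_family_def A_def B_def by auto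
  ultimately show ?thesis by simp
qed

definition matching_table :: "bool \<Rightarrow> bool \<Rightarrow> nat" where
  "matching_table = table 1 0 0 1"

definition star_table :: "bool \<Rightarrow> bool \<Rightarrow> nat" where
  "star_table = table 0 0 0 1"

lemma matching_table_PP: "matching_table \<in> PP"
  by (simp add: PP_def matching_table_def table_in_tables table_simps)

lemma star_table_PPa: "star_table \<in> PPa"
  by (simp add: PPa_def star_table_def table_in_tables table_simps)

lemma GGm_eq: "GGm = RR matching_table"
proof (rule set_eqI)
  fix p :: "(bool \<times> (nat \<Rightarrow> bool)) \<times> (bool \<times> (nat \<Rightarrow> bool))"
  obtain \<epsilon> x \<eta> y where p: "p = ((\<epsilon>, x), (\<eta>, y))" by (metis surj_pair)
  show "p \<in> GGm \<longleftrightarrow> p \<in> RR matching_table"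
    unfolding p RR_iff GGm_def matching_table_def table_def
    by (cases \<epsilon>; cases \<eta>) (auto simp: Sset_simps)
qed

lemma GGma_eq: "GGma = RRa star_table"
  unfolding GGma_def symmetrization_def RRa_def star_table_def table_simps by (auto simp: Sset_simps)

lemma GG_subset_CC_family: "GG_family \<subseteq> CC_family"
  unfolding GG_family_def CC_family_def AA_family_def GGm_eq GGma_eq
  using matching_table_PP star_table_PPa by blast

lemma graph_rel_copy:
  assumes h: "inj h" and R: "graph_rel R" shows "graph_rel (snd (copy h (X, R)))"
  using R h unfolding graph_rel_def copy_def by (auto simp: sym_def irrefl_def inj_eq)

lemma symmetrization_graph: "graph_rel R \<Longrightarrow> symmetrization R = R"
  unfolding graph_rel_def symmetrization_def by (auto dest: symD)

text \<open>A graph is its own symmetrization.\<close>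

lemma acyclic_graph_iff:
  "nonPi2_acyclic_graph S \<longleftrightarrow> nonPi2_s_acyclic_relation S \<and> graph_rel (snd S)"
  unfolding nonPi2_acyclic_graph_def nonPi2_s_acyclic_relation_def s_acyclic_def
  using symmetrization_graph by metis

lemma GG_family_graph:
  assumes "S \<in> GG_family" shows "nonPi2_acyclic_graph S"
proof -
  have "graph_rel GGm" unfolding graph_rel_def sym_def irrefl_def GGm_def by auto
  moreover have "graph_rel GGma"
    unfolding graph_rel_def sym_def irrefl_def GGma_def by (auto simp: symmetrization_iff one_cons_ne_zeros)
  ultimately have "graph_rel (snd S)"
    using assms graph_rel_copy[OF inj_Inl] graph_rel_copy[OF inj_Inr] unfolding GG_family_def by blast
  moreover have "nonPi2_s_acyclic_relation S" using assms GG_subset_CC_family CC_family_nonPi2 by blast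
  ultimately show ?thesis by (simp add: acyclic_graph_iff)
qed

lemma graph_rel_reduct:
  assumes "(X, A) \<le>\<^sub>c (Y, B)" "graph_rel B" "A \<subseteq> topspace X \<times> topspace X" shows "graph_rel A"
proof -
  obtain f where f: "\<And>x y. x \<in> topspace X \<Longrightarrow> y \<in> topspace X \<Longrightarrow> (x, y) \<in> A \<longleftrightarrow> (f x, f y) \<in> B"
    using assms(1) by (rule c_leD) blast
  have "sym A"
  proof (rule symI)
    fix x y assume xy: "(x, y) \<in> A"
    then have "x \<in> topspace X" "y \<in> topspace X" using assms(3) by auto
    then show "(y, x) \<in> A" using f xy assms(2) unfolding graph_rel_def by (meson symD)
  qed
  moreover have "irrefl A"
    using f assms(2,3) unfolding graph_rel_def irrefl_def by blast
  ultimately show ?thesis by (simp add: graph_rel_def)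
qed

lemma RR_graph_imp:
  assumes t: "t \<in> PP" and g: "graph_rel (RR t)" shows "t = matching_table"
proof -
  have t4: "t \<epsilon> \<eta> < 4" for \<epsilon> \<eta> using t by (auto simp: PP_def tables_def)
  have loop: "t \<epsilon> \<epsilon> = 1" for \<epsilon>
  proof -
    have "x \<notin> Sset (t \<epsilon> \<epsilon>)" for x
      using g unfolding graph_rel_def irrefl_def by (metis RR_iff)
    then have "Sset (t \<epsilon> \<epsilon>) = {}" by blast
    also have "{} = Sset 1" by (simp add: Sset_def)
    finally have "Sset (t \<epsilon> \<epsilon>) = Sset 1" .
    then show ?thesis using Sset_inject[OF t4] by simp
  qed
  have t01: "t False True = 0" using t by (simp add: PP_def)
  have "x \<in> Sset (t True False) \<longleftrightarrow> x \<in> Sset (t False True)" for x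
    using g unfolding graph_rel_def sym_def by (metis RR_iff)
  then have t10: "t True False = 0" using Sset_inject[OF t4 t4, of True False False True] t01 by auto
  have "t = table (t False False) (t False True) (t True False) (t True True)" by (rule table_collapse[symmetric])
  then show ?thesis by (simp add: loop t01 t10 matching_table_def)
qed

lemma RRa_graph_imp:
  assumes t: "t \<in> PPa" and g: "graph_rel (RRa t)" shows "t = star_table"
proof -
  have t4: "t \<epsilon> \<eta> < 4" for \<epsilon> \<eta> using t by (auto simp: PPa_def tables_def)
  have "t False False \<noteq> 1" using g unfolding graph_rel_def irrefl_def by (metis RRa_simps(1))
  then have t00: "t False False = 0" using t by (auto simp: PPa_def)
  have "\<alpha> \<notin> Sset (t True True)" for \<alpha> using g unfolding graph_rel_def irrefl_def by (metis RRa_simps(4))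
  then have "Sset (t True True) = {}" by blast
  also have "{} = Sset 1" by (simp add: Sset_def)
  finally have "Sset (t True True) = Sset 1" .
  then have t11: "t True True = 1" using Sset_inject[OF t4] by simp
  have "\<alpha> \<in> Sset (t True False) \<longleftrightarrow> \<alpha> \<in> Sset (t False True)" for \<alpha>
    using g unfolding graph_rel_def sym_def by (metis RRa_simps(2,3))
  then have "t True False = t False True" using Sset_inject[OF t4 t4, of True False False True] by auto
  moreover have "t False True = 0 \<or> t True False = 0" using t unfolding PPa_def by simp
  ultimately have t01: "t False True = 0" "t True False = 0" by auto
  have "t = table (t False False) (t False True) (t True False) (t True True)" by (rule table_collapse[symmetric])
  then show ?thesis by (simp add: t00 t01 t11 star_table_def)
qed

text \<open>The member of \<open>CC_family\<close> that embeds is a graph, being reducible to one.\<close>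

lemma GG_family_emb:
  assumes "nonPi2_acyclic_graph T" shows "\<exists>S\<in>GG_family. S \<sqsubseteq>\<^sub>c T"
proof -
  obtain X R where T: "T = (X, R)" by (cases T)
  have g: "graph_rel R" and cls: "nonPi2_s_acyclic_relation T" using assms by (auto simp: acyclic_graph_iff T)
  obtain S where S: "S \<in> CC_family" "S \<sqsubseteq>\<^sub>c T" using CC_family_emb[OF cls] by blast
  have le: "S \<le>\<^sub>c (X, R)" using c_emb_imp_le[OF S(2)] T by simp
  have "S \<in> GG_family"
    using S(1)
  proof (cases rule: CC_family_cases)
    case diagonal
    have "(cantor, DeltaCC) \<le>\<^sub>c (X, R)"
      using c_le_trans[OF c_emb_imp_le[OF c_emb_copy[OF inj_Inl DeltaCC_sub]]] le diagonal by blast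
    from graph_rel_reduct[OF this g DeltaCC_sub] have "irrefl DeltaCC" by (simp add: graph_rel_def)
    then have "CC = {}" unfolding irrefl_def by blast
    then show ?thesis using CC_ne(1) by blast
  next
    case (double t)
    have "(DD, RR t) \<le>\<^sub>c (X, R)"
      using c_le_trans[OF c_emb_imp_le[OF c_emb_copy[OF inj_Inr RR_sub]]] le double by blast
    from graph_rel_reduct[OF this g RR_sub] have "t = matching_table" by (rule RR_graph_imp[OF double(1)])
    then show ?thesis using double by (simp add: GG_family_def GGm_eq)
  next
    case (star t)
    have "(SS, RRa t) \<le>\<^sub>c (X, R)"
      using c_le_trans[OF c_emb_imp_le[OF c_emb_copy[OF inj_Inl RRa_sub]]] le star by blast
    from graph_rel_reduct[OF this g RRa_sub] have "t = star_table" by (rule RRa_graph_imp[OF star(1)])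
    then show ?thesis using star by (simp add: GG_family_def GGma_eq)
  qed
  then show ?thesis using S(2) by blast
qed

theorem theorem1p7:
  shows
    "(card CC_family = 52 \<and>
      antichain_basis (\<sqsubseteq>\<^sub>c) (\<sqsubseteq>\<^sub>c)
        nonPi2_s_acyclic_relation (nonPi2_s_acyclic_relation :: 'a relspace \<Rightarrow> bool) CC_family \<and>
      antichain_basis (\<le>\<^sub>c) (\<le>\<^sub>c)
        nonPi2_s_acyclic_relation (nonPi2_s_acyclic_relation :: 'a relspace \<Rightarrow> bool) CC_family) \<and>
     (antichain_basis (\<sqsubseteq>\<^sub>c) (\<sqsubseteq>\<^sub>c)
        nonPi2_acyclic_graph (nonPi2_acyclic_graph :: 'a relspace \<Rightarrow> bool) GG_family \<and>
      antichain_basis (\<le>\<^sub>c) (\<le>\<^sub>c)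
        nonPi2_acyclic_graph (nonPi2_acyclic_graph :: 'a relspace \<Rightarrow> bool) GG_family)"
proof (intro conjI)
  have anti: "is_antichain (\<le>\<^sub>c) CC_family"
    unfolding is_antichain_def using CC_family_le_imp_eq by metis
  have anti_emb: "is_antichain (\<sqsubseteq>\<^sub>c) CC_family"
    using anti c_emb_imp_le unfolding is_antichain_def by metis
  have antiG: "is_antichain (\<le>\<^sub>c) GG_family" "is_antichain (\<sqsubseteq>\<^sub>c) GG_family"
    using anti anti_emb GG_subset_CC_family unfolding is_antichain_def by blast+
  show "card CC_family = 52" by (rule card_CC_family)
  show "antichain_basis (\<sqsubseteq>\<^sub>c) (\<sqsubseteq>\<^sub>c)
      nonPi2_s_acyclic_relation (nonPi2_s_acyclic_relation :: 'a relspace \<Rightarrow> bool) CC_family"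
    unfolding antichain_basis_def is_basis_def using anti_emb CC_family_nonPi2 CC_family_emb by blast
  show "antichain_basis (\<le>\<^sub>c) (\<le>\<^sub>c)
      nonPi2_s_acyclic_relation (nonPi2_s_acyclic_relation :: 'a relspace \<Rightarrow> bool) CC_family"
    unfolding antichain_basis_def is_basis_def
    using anti CC_family_nonPi2 CC_family_emb c_emb_imp_le by meson
  show "antichain_basis (\<sqsubseteq>\<^sub>c) (\<sqsubseteq>\<^sub>c)
      nonPi2_acyclic_graph (nonPi2_acyclic_graph :: 'a relspace \<Rightarrow> bool) GG_family"
    unfolding antichain_basis_def is_basis_def using antiG GG_family_graph GG_family_emb by blast
  show "antichain_basis (\<le>\<^sub>c) (\<le>\<^sub>c)
      nonPi2_acyclic_graph (nonPi2_acyclic_graph :: 'a relspace \<Rightarrow> bool) GG_family"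
    unfolding antichain_basis_def is_basis_def
    using antiG GG_family_graph GG_family_emb c_emb_imp_le by meson
qed

end
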